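(* If $L$ is a link with no unlinked, unknotted components, then $$t_C(L) + 4 \leq t(L).$$
   Context: Links are nonempty tame links in $S^3$, unoriented and considered up to ambient isotopy. A link $L$ has no unlinked, unknotted components if it does not have an unknotted component which is unlinked (split, i.e. separable by an embedded sphere) from the rest of $L$; in particular the unknot itself does not satisfy this condition. Edge tiles. There are 11 edge tiles $T_0,\dots,T_{10}$, each a unit square carrying curves whose endpoints are midpoints of its sides: $T_0$ is empty; $T_1,T_2,T_3,T_4$ each carry a single arc joining the midpoints of two adjacent sides (respectively left/bottom, bottom/right, right/top, top/left); $T_5$ carries a segment joining the left and right midpoints; $T_6$ carries a segment joining the bottom and top midpoints; $T_7,T_8$ are the two tiles carrying two disjoint arcs, each joining midpoints of adjacent sides; $T_9,T_{10}$ carry the horizontal and the vertical segment crossing once at the center, with the two possible choices of over/under information. Edge mosaics. An edge mosaic is a finite rectangular grid of edge tiles such that every endpoint of a curve on a tile coincides with an endpoint of a curve on the edge-adjacent tile (in particular no endpoints lie on the outer boundary of the grid). It is thus a link diagram, and it represents the corresponding link. The edge tile number $t(L)$ is the minimum number of nonempty tiles (tiles other than $T_0$) in an edge mosaic representing $L$. Corner tiles. The pattern on each corner tile is the pattern on the corresponding edge tile rotated clockwise by $\pi/4$, with the curve endpoints now placed at corners of the square: $T_0$ is empty; $T_1,T_2,T_3,T_4$ carry a single arc joining the two left, the two bottom, the two right, the two top corners, respectively; $T_5$ carries a segment from upper-left to lower-right corner; $T_6$ carries a segment from lower-left to upper-right corner; $T_7,T_8$ are the two tiles carrying two disjoint arcs,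 each joining two adjacent corners; $T_9,T_{10}$ carry both diagonals crossing once at the center, with the two possible choices of over/under information. Corner mosaics. A corner mosaic is a finite rectangular grid of corner tiles such that every vertex of the grid is an endpoint of either no curve or exactly two curves on the tiles meeting at that vertex. It is thus a link diagram and represents the corresponding link. The corner tile number $t_C(L)$ is the minimum number of nonempty tiles in a corner mosaic representing $L$. *)

theory Defs
  imports "HOL-Analysis.Analysis" "HOL-Library.Extended_Nat"
begin

section \<open>Links in the 3-sphere\<close>

text \<open>
  Euclidean 3-space is the product of the plane (the complex numbers), into which link diagrams
  are drawn, and the real line of heights.  The 3-sphere is the unit sphere of the 4-dimensional
  space \<open>space \<times> real\<close>; its north pole plays the role of the point at infinity.
\<close>

type_synonym space = "complex \<times> real"

definition S3 :: "(space \<times> real) set" where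
  "S3 = sphere 0 1"

text \<open>The inverse of stereographic projection from the north pole \<open>(0, 1)\<close>.\<close>

definition to_S3 :: "space \<Rightarrow> space \<times> real" where
  "to_S3 v = ((2 / ((norm v)\<^sup>2 + 1)) *\<^sub>R v, ((norm v)\<^sup>2 - 1) / ((norm v)\<^sup>2 + 1))"

definition ambient_isotopic :: "'a::topological_space set \<Rightarrow> 'a set \<Rightarrow> 'a set \<Rightarrow> bool" where
  "ambient_isotopic X A B \<longleftrightarrow>
     (\<exists>h :: real \<Rightarrow> 'a \<Rightarrow> 'a.
        continuous_on ({0..1} \<times> X) (\<lambda>(t, x). h t x) \<and>
        (\<forall>t\<in>{0..1}. \<exists>g. homeomorphism X X (h t) g) \<and>
        (\<forall>x\<in>X. h 0 x = x) \<and>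
        h 1 ` A = B)"

text \<open>
  A finite disjoint union of circles: its circles are exactly its connected components.
\<close>

definition is_link :: "(space \<times> real) set \<Rightarrow> bool" where
  "is_link L \<longleftrightarrow>
     L \<subseteq> S3 \<and> L \<noteq> {} \<and> finite (components L) \<and>
     (\<forall>K\<in>components L. K homeomorphic sphere (0::complex) 1)"

definition polygonal :: "space set \<Rightarrow> bool" where
  "polygonal P \<longleftrightarrow> (\<exists>F. finite F \<and> P = (\<Union>(a, b)\<in>F. closed_segment a b))"

definition tame_link :: "(space \<times> real) set \<Rightarrow> bool" where
  "tame_link L \<longleftrightarrow> is_link L \<and> (\<exists>P. polygonal P \<and> ambient_isotopic S3 L (to_S3 ` P))"

definition unknotted :: "(space \<times> real) set \<Rightarrow> bool" where
  "unknotted K \<longleftrightarrow> ambient_isotopic S3 K (to_S3 ` {(z, 0) |z. norm z = 1})"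

text \<open>
  \<open>K\<close> is separated from the rest of \<open>L\<close> by an embedded 2-sphere.  If \<open>L = K\<close>, the rest is empty
  and the last condition is void.
\<close>

definition unlinked_in :: "(space \<times> real) set \<Rightarrow> (space \<times> real) set \<Rightarrow> bool" where
  "unlinked_in L K \<longleftrightarrow>
     (\<exists>S \<subseteq> S3 - L. S homeomorphic sphere (0::space) 1 \<and>
        (\<exists>U \<in> components (S3 - S). \<exists>V \<in> components (S3 - S).
           U \<noteq> V \<and> K \<subseteq> U \<and> L - K \<subseteq> V))"

definition no_unlinked_unknotted_components :: "(space \<times> real) set \<Rightarrow> bool" where
  "no_unlinked_unknotted_components L \<longleftrightarrow>
     \<not> (\<exists>K\<in>components L. unknotted K \<and> unlinked_in L K)"

section \<open>Tiles\<close>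

datatype tile = T0 | T1 | T2 | T3 | T4 | T5 | T6 | T7 | T8 | T9 | T10

text \<open>
  All tiles are squares of side 2.  An edge tile centred at the origin has its side midpoints at
  \<open>- 1\<close> (left), \<open>- \<i>\<close> (bottom), \<open>1\<close> (right) and \<open>\<i>\<close> (top).  A strand \<open>(a, b, h)\<close> is a curve from
  \<open>a\<close> to \<open>b\<close> whose middle point has height \<open>h\<close>; the endpoints always have height \<open>0\<close>.  The height
  is \<open>1\<close> for the over-strand of a crossing and \<open>0\<close> for every other strand.
\<close>

type_synonym strand = "complex \<times> complex \<times> real"

fun strands :: "tile \<Rightarrow> strand set" where
  "strands T0 = {}"
| "strands T1 = {(- 1, - \<i>, 0)}"
| "strands T2 = {(- \<i>, 1, 0)}"
| "strands T3 = {(1, \<i>, 0)}"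
| "strands T4 = {(\<i>, - 1, 0)}"
| "strands T5 = {(- 1, 1, 0)}"
| "strands T6 = {(- \<i>, \<i>, 0)}"
| "strands T7 = {(- 1, - \<i>, 0), (1, \<i>, 0)}"
| "strands T8 = {(- \<i>, 1, 0), (\<i>, - 1, 0)}"
| "strands T9 = {(- 1, 1, 1), (- \<i>, \<i>, 0)}"
| "strands T10 = {(- 1, 1, 0), (- \<i>, \<i>, 1)}"

text \<open>
  Edge and corner mosaics are treated uniformly by means of a factor \<open>r\<close> by which the edge tile
  pattern is multiplied: it is \<open>1\<close> for edge tiles and \<open>1 - \<i>\<close> for corner tiles.  The latter is the
  clockwise rotation by \<open>pi/4\<close> together with the scaling by \<open>sqrt 2\<close> that moves the endpoints from
  the side midpoints to the corners of the square.
\<close>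

definition edge_factor :: complex where
  "edge_factor = 1"

definition corner_factor :: complex where
  "corner_factor = 1 - \<i>"

text \<open>
  A strand is drawn as a polygonal arc with two segments.  Its middle point lies over \<open>(a + b) / 4\<close>,
  which is the centre of the tile if \<open>a\<close> and \<open>b\<close> are opposite.  Otherwise it is halfway between the
  centre and the chord from \<open>a\<close> to \<open>b\<close>, so that an arc joining two adjacent corners of a corner tile
  runs inside the tile and not along its side.
\<close>

definition strand_curve :: "complex \<Rightarrow> complex \<Rightarrow> strand \<Rightarrow> space set" where
  "strand_curve r c = (\<lambda>(a, b, h).
     closed_segment (c + r * a, 0) (c + r * ((a + b) / 4), h) \<union>
     closed_segment (c + r * ((a + b) / 4), h) (c + r * b, 0))"

definition strand_ends :: "complex \<Rightarrow> complex \<Rightarrow> strand \<Rightarrow> complex set" where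
  "strand_ends r c = (\<lambda>(a, b, h). {c + r * a, c + r * b})"

section \<open>Mosaics\<close>

text \<open>
  A grid with \<open>m\<close> columns and \<open>n\<close> rows is given by its tiles \<open>T i j\<close> for \<open>i < m\<close> and \<open>j < n\<close>;
  other values of \<open>T\<close> are irrelevant.  Columns are counted from the left, rows from the bottom.
\<close>

type_synonym grid = "nat \<Rightarrow> nat \<Rightarrow> tile"

definition centre :: "nat \<Rightarrow> nat \<Rightarrow> complex" where
  "centre i j = Complex (2 * real i) (2 * real j)"

definition tile_ends :: "complex \<Rightarrow> grid \<Rightarrow> nat \<Rightarrow> nat \<Rightarrow> complex set" where
  "tile_ends r T i j = (\<Union>s\<in>strands (T i j). strand_ends r (centre i j) s)"

definition edge_adjacent :: "nat \<Rightarrow> nat \<Rightarrow> nat \<Rightarrow> nat \<Rightarrow> bool" where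
  "edge_adjacent i j k l \<longleftrightarrow>
     i = k \<and> (j = Suc l \<or> l = Suc j) \<or> j = l \<and> (i = Suc k \<or> k = Suc i)"

definition edge_mosaic :: "nat \<Rightarrow> nat \<Rightarrow> grid \<Rightarrow> bool" where
  "edge_mosaic m n T \<longleftrightarrow>
     (\<forall>i<m. \<forall>j<n. \<forall>p\<in>tile_ends edge_factor T i j.
        \<exists>k<m. \<exists>l<n. edge_adjacent i j k l \<and> p \<in> tile_ends edge_factor T k l)"

text \<open>The vertices of the grid are the points \<open>(2 i - 1, 2 j - 1)\<close> with \<open>i \<le> m\<close> and \<open>j \<le> n\<close>.\<close>

definition corner_mosaic :: "nat \<Rightarrow> nat \<Rightarrow> grid \<Rightarrow> bool" where
  "corner_mosaic m n T \<longleftrightarrow>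
     (\<forall>i\<le>m. \<forall>j\<le>n.
        card {(k, l, s). k < m \<and> l < n \<and> s \<in> strands (T k l) \<and>
                Complex (2 * real i - 1) (2 * real j - 1) \<in> strand_ends corner_factor (centre k l) s}
        \<in> {0, 2})"

definition mosaic_curve :: "complex \<Rightarrow> nat \<Rightarrow> nat \<Rightarrow> grid \<Rightarrow> space set" where
  "mosaic_curve r m n T =
     (\<Union>i<m. \<Union>j<n. \<Union>s\<in>strands (T i j). strand_curve r (centre i j) s)"

definition mosaic_represents ::
    "complex \<Rightarrow> nat \<Rightarrow> nat \<Rightarrow> grid \<Rightarrow> (space \<times> real) set \<Rightarrow> bool" where
  "mosaic_represents r m n T L \<longleftrightarrow> ambient_isotopic S3 L (to_S3 ` mosaic_curve r m n T)"

definition nonempty_tiles :: "nat \<Rightarrow> nat \<Rightarrow> grid \<Rightarrow> nat" where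
  "nonempty_tiles m n T = card {(i, j). i < m \<and> j < n \<and> T i j \<noteq> T0}"

text \<open>
  The tile numbers are minima of sets of natural numbers.  They are taken in \<open>enat\<close>, where the
  infimum of a nonempty set of natural numbers is its minimum and that of the empty set is \<open>\<infinity>\<close>
  (every tame link has mosaics of both kinds, so that the latter does not arise for such links).
\<close>

definition edge_tile_number :: "(space \<times> real) set \<Rightarrow> enat" where
  "edge_tile_number L =
     Inf {enat (nonempty_tiles m n T) |m n T.
            edge_mosaic m n T \<and> mosaic_represents edge_factor m n T L}"

definition corner_tile_number :: "(space \<times> real) set \<Rightarrow> enat" where
  "corner_tile_number L =
     Inf {enat (nonempty_tiles m n T) |m n T.
            corner_mosaic m n T \<and> mosaic_represents corner_factor m n T L}"

end

theory Submission
  imports Defs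
begin

text \<open>
  Multiplication by \<open>1 - \<i>\<close> carries the edge tile at the lattice point \<open>(i, j)\<close> onto the corner tile in the
  cell \<open>(i + j, j - i)\<close>, so that an edge mosaic is also a corner mosaic in which only the cells of one
  parity are used.  The cells of the other parity surround the vertices of the edge mosaic.  When the
  grid has been trimmed to its nonempty rows and columns, each of its four sides is occupied by caps,
  arcs that leave the side only inwards.  Pushing a cap inwards by half a tile places it in the
  vertex cells, where it occupies one tile less than before; a turn at a corner of the grid is cut off.
  Since each side has at least one cap, this saves four tiles.

  The push needs at least three rows and three columns.  One row or column carries no closed curve,
  and a mosaic with two rows or two columns consists of disjoint octagons, the first of which is a
  split unknot.

  All isotopies but rotations and radial ones come from the Alexander trick, so that it is enough to
  give continuous bijections of the plane that move points by a bounded amount: translations and shears.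
\<close>

section \<open>Isotopies of space and of the 3-sphere\<close>

text \<open>No moves on diagrams are used. Each isotopy ends in a map of the plane that keeps
  heights, and its effect on the curve is an equality of images. Crossings do no harm: a tile
  without an end on its outward side carries at most one strand, so an outermost row has height 0
  and, in the frame of its side, is the graph of a function. The obstacle is that one shear has to
  flatten this graph and yet fix all tiles below, including the strands that hang off the ends of
  the caps. It has room to do so because a cap rises from its end with slope 3 and the strand
  hanging there falls at least as steeply near that end. The number 3 comes from the shape of the
  strands: a turn bends over \<open>(a + b) / 4\<close>, so its halves have slopes 3 and
  \<open>1 / 3\<close> in the frame of a side. Where two sides meet, the push of one also shortens
  the flattened row of the other. Two perpendicular half arcs are left at an occupied corner, and a
  shear along the diagonal turns them into the single arc of one corner tile.\<close>

lemma ambient_isotopic_trans: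
  assumes "ambient_isotopic X A B" "ambient_isotopic X B C"
  shows "ambient_isotopic X A C"
proof -
  obtain h where h: "continuous_on ({0..1} \<times> X) (\<lambda>(t, x). h t x)"
      "\<And>t. t \<in> {0..1} \<Longrightarrow> \<exists>g. homeomorphism X X (h t) g"
      "\<And>x. x \<in> X \<Longrightarrow> h 0 x = x" "h (1::real) ` A = B"
    using assms(1) unfolding ambient_isotopic_def by blast
  obtain k where k: "continuous_on ({0..1} \<times> X) (\<lambda>(t, x). k t x)"
      "\<And>t. t \<in> {0..1} \<Longrightarrow> \<exists>g. homeomorphism X X (k t) g"
      "\<And>x. x \<in> X \<Longrightarrow> k 0 x = x" "k (1::real) ` B = C"
    using assms(2) unfolding ambient_isotopic_def by blast
  have im: "h t ` X = X" if "t \<in> {0..1}" for t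
    using h(2)[OF that] by (auto simp: homeomorphism_def)
  have "continuous_on ({0..1} \<times> X) (\<lambda>p. (fst p, (\<lambda>(t, x). h t x) p))"
    by (intro continuous_intros h(1))
  moreover have "(\<lambda>p. (fst p, (\<lambda>(t, x). h t x) p)) ` ({0..1} \<times> X) \<subseteq> {0..1} \<times> X"
    using im by fastforce
  ultimately have "continuous_on ({0..1} \<times> X) (\<lambda>p. (\<lambda>(t, x). k t x) (fst p, (\<lambda>(t, x). h t x) p))"
    by (rule continuous_on_compose2[OF k(1)])
  then have "continuous_on ({0..1} \<times> X) (\<lambda>(t, x). k t (h t x))"
    by (simp add: case_prod_unfold)
  moreover have "\<exists>g. homeomorphism X X (\<lambda>x. k t (h t x)) g" if t: "t \<in> {0..1}" for t
  proof -
    obtain a b where "homeomorphism X X (h t) a" "homeomorphism X X (k t) b"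
      using h(2)[OF t] k(2)[OF t] by blast
    from homeomorphism_compose[OF this] show ?thesis by (auto simp: o_def)
  qed
  moreover have "\<forall>x\<in>X. k 0 (h 0 x) = x" using h(3) k(3) by auto
  moreover have "(\<lambda>x. k 1 (h 1 x)) ` A = C" using h(4) k(4) by auto
  ultimately show ?thesis
    unfolding ambient_isotopic_def by (intro exI[of _ "\<lambda>t x. k t (h t x)"]) auto
qed

lemma ambient_isotopicE:
  assumes "ambient_isotopic X A B"
  obtains h g where "continuous_on ({0..1} \<times> X) (\<lambda>(t, x). h t x)"
    "\<And>t. t \<in> {0..1} \<Longrightarrow> \<exists>k. homeomorphism X X (h t) k" "\<And>x. x \<in> X \<Longrightarrow> h 0 x = x"
    "h (1::real) ` A = B" "homeomorphism X X (h 1) g"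
proof -
  obtain h where h: "continuous_on ({0..1} \<times> X) (\<lambda>(t, x). h t x)"
    "\<And>t. t \<in> {0..1} \<Longrightarrow> \<exists>k. homeomorphism X X (h t) k" "\<And>x. x \<in> X \<Longrightarrow> h 0 x = x" "h (1::real) ` A = B"
    using assms unfolding ambient_isotopic_def by blast
  have "(1::real) \<in> {0..1}" by simp
  from h(2)[OF this] obtain g where "homeomorphism X X (h 1) g" by (elim exE)
  then show ?thesis using h that by metis
qed

section \<open>Stereographic projection\<close>

definition north :: "space \<times> real" where
  "north = (0, 1)"

definition from_S3 :: "space \<times> real \<Rightarrow> space" where
  "from_S3 x = (1 / (1 - snd x)) *\<^sub>R fst x"

lemma sq_pos: "(norm (v::space))\<^sup>2 + 1 > 0"
  by (smt (verit) zero_le_power2)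

lemma to_S3_in_S3: "to_S3 v \<in> S3"
proof -
  define n where "n = (norm v)\<^sup>2"
  have n: "n \<ge> 0" by (simp add: n_def)
  have "(2 / (n + 1) * norm v)\<^sup>2 + ((n - 1) / (n + 1))\<^sup>2 = 1"
    using n by (simp add: power_mult_distrib power_divide flip: n_def)
      (simp add: divide_simps power2_eq_square, algebra)
  moreover have "norm (to_S3 v) = sqrt ((2 / (n + 1) * norm v)\<^sup>2 + ((n - 1) / (n + 1))\<^sup>2)"
    using n by (simp add: to_S3_def norm_Pair power_divide flip: n_def)
  ultimately show ?thesis by (simp add: S3_def)
qed

lemma to_S3_neq_north: "to_S3 v \<noteq> north"
  using sq_pos[of v] by (auto simp: to_S3_def north_def)

lemma from_to_S3 [simp]: "from_S3 (to_S3 v) = v"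
proof -
  define n where "n = (norm v)\<^sup>2"
  have n: "n \<ge> 0" by (simp add: n_def)
  have "1 - (n - 1) / (n + 1) = 2 / (n + 1)" using n by (simp add: field_simps)
  moreover have "(n + 1) / 2 * (2 / (n + 1)) = 1" using n by (simp add: divide_simps)
  ultimately show ?thesis using n
    by (simp add: from_S3_def to_S3_def del: times_divide_eq_right times_divide_eq_left flip: n_def)
qed

lemma inj_to_S3: "inj to_S3"
  by (metis from_to_S3 injI)

lemma snd_less_1:
  assumes "x \<in> S3" "x \<noteq> north"
  shows "snd x < 1"
proof -
  have e: "(norm (fst x))\<^sup>2 + (snd x)\<^sup>2 = 1"
    using assms(1) by (cases x) (simp add: S3_def norm_Pair real_sqrt_eq_1_iff)
  have "snd x \<le> 1"
    using e by (smt (verit) one_less_power zero_le_power2 pos2)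
  moreover have "snd x \<noteq> 1"
  proof
    assume "snd x = 1"
    then have "fst x = 0" using e by simp
    then show False using \<open>snd x = 1\<close> assms(2) by (cases x) (simp add: north_def)
  qed
  ultimately show ?thesis by simp
qed

lemma to_from_S3:
  assumes "x \<in> S3" "x \<noteq> north"
  shows "to_S3 (from_S3 x) = x"
proof -
  obtain v s where x: "x = (v, s)" by (cases x)
  have s: "s < 1" using snd_less_1[OF assms] x by simp
  have e: "(norm v)\<^sup>2 = (1 - s) * (1 + s)"
    using assms(1) by (simp add: x S3_def norm_Pair real_sqrt_eq_1_iff power2_eq_square algebra_simps)
  have "(norm (from_S3 x))\<^sup>2 = (1 - s) * (1 + s) / (1 - s)\<^sup>2"
    using s by (simp add: from_S3_def x power_divide flip: e)
  also have "\<dots> = (1 + s) / (1 - s)" using s by (simp add: power2_eq_square)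
  finally have n: "(norm (from_S3 x))\<^sup>2 = (1 + s) / (1 - s)" .
  have n1: "(norm (from_S3 x))\<^sup>2 + 1 = 2 / (1 - s)" "(norm (from_S3 x))\<^sup>2 - 1 = 2 * s / (1 - s)"
    using s by (simp_all add: n field_simps)
  show ?thesis unfolding to_S3_def n1 using s by (simp add: from_S3_def x)
qed

lemma dist_north: "dist (to_S3 v) north = 2 / sqrt ((norm v)\<^sup>2 + 1)"
proof -
  define n where "n = (norm v)\<^sup>2"
  have n: "n \<ge> 0" by (simp add: n_def)
  have a: "(n - 1) / (n + 1) - 1 = - (2 / (n + 1))" using n by (simp add: field_simps)
  have "(2 / (n + 1) * norm v)\<^sup>2 + (2 / (n + 1))\<^sup>2 = (2 / (n+1))\<^sup>2 * (n + 1)"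
    unfolding power_mult_distrib n_def[symmetric] by (simp only: distrib_left mult_1_right)
  also have "\<dots> = 4 / (n + 1)" using n by (simp add: power2_eq_square divide_simps)
  finally have b: "(2 / (n + 1) * norm v)\<^sup>2 + (2 / (n + 1))\<^sup>2 = 4 / (n + 1)" .
  have "dist (to_S3 v) north = sqrt ((2 / (n + 1) * norm v)\<^sup>2 + (2 / (n + 1))\<^sup>2)"
    using n a by (simp add: to_S3_def north_def dist_norm norm_Pair flip: n_def)
  also have "\<dots> = 2 / sqrt (n + 1)" unfolding b using n by (simp add: real_sqrt_divide)
  finally show ?thesis by (simp add: n_def)
qed

lemma dist_north_less_iff:
  assumes "e > 0"
  shows "dist (to_S3 v) north < e \<longleftrightarrow> (norm v)\<^sup>2 + 1 > 4 / e\<^sup>2"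
proof -
  define s where "s = sqrt ((norm v)\<^sup>2 + 1)"
  have s: "s > 0" "s\<^sup>2 = (norm v)\<^sup>2 + 1" using sq_pos[of v] by (auto simp: s_def)
  have "2 / s < e \<longleftrightarrow> 2 / e < s" using s assms by (simp add: field_simps)
  also have "\<dots> \<longleftrightarrow> (2 / e)\<^sup>2 < s\<^sup>2"
    using s assms by (smt (verit) divide_pos_pos power2_less_imp_less power_strict_mono pos2)
  finally show ?thesis by (simp add: dist_north s_def[symmetric] s(2) power_divide)
qed

lemma continuous_on_from_S3: "continuous_on (S3 - {north}) from_S3"
  unfolding from_S3_def using snd_less_1
  by (intro continuous_intros) (force simp: S3_def)

lemma continuous_on_to_S3: "continuous_on A to_S3"
  unfolding to_S3_def using sq_pos
  by (intro continuous_intros) (metis less_irrefl)+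

lemma north_in_S3: "north \<in> S3"
  by (simp add: north_def S3_def norm_Pair)

lemma to_S3_image_UNIV: "range to_S3 = S3 - {north}"
proof (intro equalityI subsetI)
  fix x assume "x \<in> S3 - {north}"
  then show "x \<in> range to_S3" using to_from_S3[of x] by (metis DiffE rangeI singletonI)
next
  fix x assume "x \<in> range to_S3"
  then show "x \<in> S3 - {north}" using to_S3_in_S3 to_S3_neq_north by (metis DiffI rangeE singletonD)
qed

lemma compact_S3: "compact S3"
  by (simp add: S3_def)

text \<open>The isotopy is extended by fixing \<open>north\<close>. The assumption
  \<open>proper\<close>, uniform in time, says that points far out stay far out, and this is
  continuity at \<open>north\<close>. Continuity of the inverses comes from the compactness of the
  sphere.\<close>

lemma ambient_isotopic_to_S3:
  fixes g :: "real \<Rightarrow> space \<Rightarrow> space"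
  assumes cont: "continuous_on ({0..1} \<times> UNIV) (\<lambda>(t, x). g t x)"
    and bij: "\<And>t. t \<in> {0..1} \<Longrightarrow> bij (g t)"
    and id: "\<And>x. g 0 x = x"
    and proper: "\<And>B. \<exists>C. \<forall>t\<in>{0..1}. \<forall>x. norm (g t x) \<le> B \<longrightarrow> norm x \<le> C"
  shows "ambient_isotopic S3 (to_S3 ` A) (to_S3 ` g 1 ` A)"
proof -
  define h where "h t x = (if x = north then north else to_S3 (g t (from_S3 x)))" for t x
  have h_to: "h t (to_S3 v) = to_S3 (g t v)" for t v
    by (simp add: h_def to_S3_neq_north)
  have h_north: "h t north = north" for t by (simp add: h_def)
  have S3_cases: "\<exists>v. x = to_S3 v" if "x \<in> S3" "x \<noteq> north" for x
    using to_from_S3[OF that] by metis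
  have "continuous_on ({0..1} \<times> (S3 - {north})) (\<lambda>p. (fst p, from_S3 (snd p)))"
    by (intro continuous_intros continuous_on_compose2[OF continuous_on_from_S3]) auto
  then have "continuous_on ({0..1} \<times> (S3 - {north})) (\<lambda>p. (\<lambda>(t, x). g t x) (fst p, from_S3 (snd p)))"
    by (rule continuous_on_compose2[OF cont]) auto
  then have c1: "continuous_on ({0..1} \<times> (S3 - {north})) (\<lambda>p. to_S3 (g (fst p) (from_S3 (snd p))))"
    by (intro continuous_on_compose2[OF continuous_on_to_S3[of UNIV]]) auto
  have c1: "continuous_on ({0..1} \<times> (S3 - {north})) (\<lambda>(t, x). h t x)"
    by (rule continuous_on_eq[OF c1]) (simp add: h_def case_prod_unfold mem_Times_iff)
  have c2: "continuous (at (t, x) within {0..1} \<times> S3) (\<lambda>(t, x). h t x)"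
    if t: "t \<in> {0..1}" and x: "x \<in> S3" for t x
  proof (cases "x = north")
    case False
    have eq: "{0..1} \<times> (S3 - {north}) = ({0..1} \<times> S3) \<inter> (UNIV \<times> (- {north}))" by auto
    have "continuous (at (t, x) within {0..1} \<times> (S3 - {north})) (\<lambda>(t, x). h t x)"
      using c1 t x False by (auto simp: continuous_on_eq_continuous_within)
    moreover have "at (t, x) within {0..1} \<times> (S3 - {north}) = at (t, x) within {0..1} \<times> S3"
      unfolding eq using False by (intro at_within_nhd[of _ "UNIV \<times> (- {north})"]) (auto intro: open_Times)
    ultimately show ?thesis by simp
  next
    case True
    show ?thesis unfolding continuous_within_eps_delta
    proof (intro allI impI)
      fix e :: real assume e: "e > 0"
      \<comment> \<open>Outside the ball of radius \<open>C\<close>, points are mapped outside the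
        ball that corresponds to the \<open>e\<close>-neighbourhood of \<open>north\<close>;
        \<open>d\<close> is the distance to \<open>north\<close> that corresponds to
        \<open>C\<close>.\<close>
      obtain C where C: "\<And>t x. t \<in> {0..1} \<Longrightarrow> norm (g t x) \<le> sqrt (4 / e\<^sup>2) \<Longrightarrow> norm x \<le> C"
        using proper by blast
      define d where "d = 2 / sqrt (C\<^sup>2 + 1)"
      have C1: "C\<^sup>2 + 1 > 0" by (smt (verit) zero_le_power2)
      have d: "d > 0" "4 / d\<^sup>2 = C\<^sup>2 + 1" using C1 by (auto simp: d_def power_divide)
      show "\<exists>d>0. \<forall>x'\<in>{0..1} \<times> S3. dist x' (t, x) < d \<longrightarrow>
          dist ((\<lambda>(t, x). h t x) x') ((\<lambda>(t, x). h t x) (t, x)) < e"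
      proof (intro exI[of _ d] conjI ballI impI d(1))
        fix y assume y: "y \<in> {0..1} \<times> S3" "dist y (t, x) < d"
        obtain s u where y': "y = (s, u)" by (cases y)
        have du: "dist u north < d" using y(2) dist_snd_le[of y "(t,x)"] True by (simp add: y')
        show "dist ((\<lambda>(t, x). h t x) y) ((\<lambda>(t, x). h t x) (t, x)) < e"
        proof (cases "u = north")
          case False
          moreover have "u \<in> S3" using y(1) y' by simp
          ultimately obtain v where v: "u = to_S3 v" using S3_cases by blast
          have "(norm v)\<^sup>2 > C\<^sup>2" using du dist_north_less_iff[OF d(1)] by (simp add: v d(2))
          then have "\<not> norm v \<le> C" by (smt (verit) norm_ge_zero power_mono)
          moreover have "s \<in> {0..1}" using y(1) y' by simp
          ultimately have "\<not> norm (g s v) \<le> sqrt (4 / e\<^sup>2)" using C by blast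
          then have "(norm (g s v))\<^sup>2 > (sqrt (4 / e\<^sup>2))\<^sup>2"
            by (intro power_strict_mono) auto
          then have "(norm (g s v))\<^sup>2 + 1 > 4 / e\<^sup>2" by simp
          then show ?thesis using dist_north_less_iff[OF e] by (simp add: True h_north y' v h_to)
        qed (simp add: y' True h_north e)
      qed
    qed
  qed
  have c: "continuous_on ({0..1} \<times> S3) (\<lambda>(t, x). h t x)"
    unfolding continuous_on_eq_continuous_within
  proof
    fix p :: "real \<times> space \<times> real" assume "p \<in> {0..1} \<times> S3"
    then show "continuous (at p within {0..1} \<times> S3) (\<lambda>(t, x). h t x)"
      using c2[of "fst p" "snd p"] unfolding prod.collapse by (simp only: mem_Times_iff)
  qed
  have hom: "\<exists>k. homeomorphism S3 S3 (h t) k" if t: "t \<in> {0..1}" for t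
  proof (rule homeomorphism_compact[OF compact_S3])
    have "continuous_on S3 (\<lambda>x. (\<lambda>(t, x). h t x) (t, x))"
      using t by (intro continuous_on_compose2[OF c] continuous_intros) auto
    then show "continuous_on S3 (h t)" by simp
    have i: "g t v = g t v' \<longleftrightarrow> v = v'" for v v' using bij[OF t] by (auto simp: bij_def inj_eq)
    show "h t ` S3 = S3"
    proof (intro equalityI subsetI)
      fix x assume "x \<in> h t ` S3"
      then obtain y where "x = h t y" by blast
      then show "x \<in> S3" using north_in_S3 to_S3_in_S3 by (simp add: h_def)
    next
      fix x assume x: "x \<in> S3"
      show "x \<in> h t ` S3"
      proof (cases "x = north")
        case True then show ?thesis using north_in_S3 h_north by (metis image_eqI)
      next
        case False
        then obtain v where "x = to_S3 v" using S3_cases x by blast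
        moreover obtain v' where "v = g t v'" using bij[OF t] by (meson bij_pointE)
        ultimately have "x = h t (to_S3 v')" by (simp add: h_to)
        then show ?thesis using to_S3_in_S3 by blast
      qed
    qed
    show "inj_on (h t) S3"
    proof (rule inj_onI)
      fix x y assume xy: "x \<in> S3" "y \<in> S3" "h t x = h t y"
      have "h t u = north \<longleftrightarrow> u = north" for u by (simp add: h_def to_S3_neq_north)
      then have n: "x = north \<longleftrightarrow> y = north" using xy(3) by metis
      show "x = y"
      proof (cases "x = north")
        case False
        obtain v u where vu: "x = to_S3 v" "y = to_S3 u" using S3_cases xy False n by blast
        then have "g t v = g t u" using xy(3) inj_eq[OF inj_to_S3] by (simp add: h_to)
        then show ?thesis using vu i by simp
      qed (use n in simp)
    qed
  qed
  have "h 1 ` to_S3 ` A = to_S3 ` g 1 ` A" by (simp add: h_to image_image)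
  moreover have "\<forall>x\<in>S3. h 0 x = x" using to_from_S3 by (simp add: h_def id)
  ultimately show ?thesis
    unfolding ambient_isotopic_def using c hom by blast
qed

definition isotopic :: "space set \<Rightarrow> space set \<Rightarrow> bool" where
  "isotopic A B \<longleftrightarrow> ambient_isotopic S3 (to_S3 ` A) (to_S3 ` B)"

lemma isotopic_trans [trans]: "isotopic A B \<Longrightarrow> isotopic B C \<Longrightarrow> isotopic A C"
  unfolding isotopic_def by (rule ambient_isotopic_trans)

text \<open>The isotopy of the Alexander trick, for maps that move all points by a bounded amount.\<close>

lemma isotopic_bounded_displacement:
  fixes f :: "space \<Rightarrow> space"
  assumes f: "continuous_on UNIV f" "bij f" "\<And>x. dist (f x) x \<le> C"
  shows "isotopic A (f ` A)"
proof -
  define g where "g t x = (if t = 0 then x else t *\<^sub>R f ((1 / t) *\<^sub>R x))" for t :: real and x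
  \<comment> \<open>Conjugation with the scaling by \<open>t\<close> multiplies displacements by
    \<open>t\<close>. This bound gives both continuity at time 0 and properness.\<close>
  have near: "dist (g t x) x \<le> t * C" if "t \<ge> 0" for t x
  proof (cases "t = 0")
    case False
    have "dist (g t x) x = norm (t *\<^sub>R (f ((1 / t) *\<^sub>R x) - (1 / t) *\<^sub>R x))"
      using False by (simp add: g_def dist_norm scaleR_diff_right)
    also have "\<dots> = t * dist (f ((1 / t) *\<^sub>R x)) ((1 / t) *\<^sub>R x)"
      using that by (simp add: dist_norm)
    also have "\<dots> \<le> t * C" using that f(3) by (intro mult_left_mono)
    finally show ?thesis .
  qed (simp add: g_def)
  have C0: "C \<ge> 0" using f(3)[of 0] zero_le_dist[of "f 0" 0] by linarith
  have "isotopic A (g 1 ` A)"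
    unfolding isotopic_def
  proof (rule ambient_isotopic_to_S3)
    have "continuous_on ({0<..1} \<times> UNIV) (\<lambda>p::real \<times> space. fst p *\<^sub>R f ((1 / fst p) *\<^sub>R snd p))"
      by (intro continuous_intros continuous_on_compose2[OF f(1)]) auto
    then have c1: "continuous_on ({0<..1} \<times> UNIV) (\<lambda>(t, x). g t x)"
      by (rule continuous_on_eq) (simp add: g_def case_prod_unfold mem_Times_iff)
    have "continuous (at (t, x) within {0..1} \<times> UNIV) (\<lambda>(t, x). g t x)" if t: "t \<in> {0..1}" for t x
    proof (cases "t = 0")
      case False
      have "(t, x) \<in> {0<..1} \<times> UNIV" using t False by auto
      then have "continuous (at (t, x) within {0<..1} \<times> UNIV) (\<lambda>(t, x). g t x)"
        using c1 unfolding continuous_on_eq_continuous_within by blast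
      moreover have "at (t, x) within {0<..1} \<times> UNIV = at (t, x) within {0..1} \<times> (UNIV :: space set)"
        using False t by (intro at_within_nhd[of _ "{0<..} \<times> UNIV"]) (auto intro: open_Times)
      ultimately show ?thesis by simp
    next
      case True
      show ?thesis unfolding continuous_within_eps_delta
      proof (intro allI impI)
        fix e :: real assume e: "e > 0"
        define d where "d = e / (1 + C)"
        have d: "d > 0" using e C0 by (simp add: d_def)
        show "\<exists>d>0. \<forall>x'\<in>{0..1} \<times> UNIV. dist x' (t, x) < d \<longrightarrow>
          dist ((\<lambda>(t, x). g t x) x') ((\<lambda>(t, x). g t x) (t, x)) < e"
        proof (intro exI[of _ d] conjI ballI impI d)
          fix y :: "real \<times> space" assume y: "y \<in> {0..1} \<times> UNIV" "dist y (t, x) < d"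
          obtain s u where y': "y = (s, u)" by (cases y)
          have s: "s < d" using y dist_fst_le[of y "(t,x)"] True by (auto simp: y' dist_real_def)
          have u: "dist u x < d" using y dist_snd_le[of y "(t,x)"] by (auto simp: y')
          have "dist (g s u) x \<le> dist (g s u) u + dist u x" by (rule dist_triangle)
          also have "\<dots> \<le> s * C + dist u x" using near[of s u] y(1) y' by simp
          also have "\<dots> < d * C + d" using s u C0 by (intro add_le_less_mono mult_right_mono) auto
          also have "\<dots> = d * (1 + C)" by (simp add: algebra_simps)
          also have "\<dots> = e" using C0 by (simp add: d_def)
          finally show "dist ((\<lambda>(t, x). g t x) y) ((\<lambda>(t, x). g t x) (t, x)) < e"
            by (simp add: y' True g_def)
        qed
      qed
    qed
    then show "continuous_on ({0..1} \<times> UNIV) (\<lambda>(t, x). g t x)"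
      unfolding continuous_on_eq_continuous_within by (metis mem_Times_iff prod.collapse)
    show "bij (g t)" if "t \<in> {0..1}" for t
    proof (cases "t = 0")
      case True then show ?thesis using bij_id by (simp add: g_def[abs_def] id_def)
    next
      case False
      have s: "bij ((*\<^sub>R) c :: space \<Rightarrow> space)" if "c \<noteq> 0" for c :: real
        using that by (intro o_bij[of "(*\<^sub>R) (1/c)"]) (auto simp: fun_eq_iff)
      have "bij ((*\<^sub>R) t \<circ> (f \<circ> (*\<^sub>R) (1 / t)))"
        using False by (intro bij_comp s f(2)) auto
      then show ?thesis using False by (simp add: g_def[abs_def] o_def)
    qed
    show "g 0 x = x" for x by (simp add: g_def)
    show "\<exists>D. \<forall>t\<in>{0..1}. \<forall>x. norm (g t x) \<le> B \<longrightarrow> norm x \<le> D" for B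
    proof (intro exI ballI allI impI)
      fix t :: real and x assume "t \<in> {0..1}" "norm (g t x) \<le> B"
      then have "norm x \<le> B + t * C" using near[of t x] norm_triangle_ineq3[of "g t x" x]
        by (simp add: dist_norm)
      also have "\<dots> \<le> B + 1 * C" using \<open>t \<in> {0..1}\<close> C0 by (intro add_left_mono mult_right_mono) auto
      finally show "norm x \<le> B + 1 * C" .
    qed
  qed
  then show ?thesis by (simp add: g_def[abs_def])
qed

section \<open>Isotopies from maps of the plane\<close>

definition plane_map :: "(complex \<Rightarrow> complex) \<Rightarrow> space \<Rightarrow> space" where
  "plane_map f p = (f (fst p), snd p)"

lemma bij_plane_map:
  assumes "bij f"
  shows "bij (plane_map f)"
  by (rule o_bij[of "plane_map (inv f)"]) 
    (simp_all add: plane_map_def fun_eq_iff inv_f_f[OF bij_is_inj[OF assms]] surj_f_inv_f[OF bij_is_surj[OF assms]])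

lemma continuous_on_plane_map:
  assumes "continuous_on UNIV f"
  shows "continuous_on UNIV (plane_map f)"
proof -
  have "continuous_on UNIV (\<lambda>p::space. f (fst p))"
    by (rule continuous_on_compose2[OF assms]) (auto intro: continuous_intros)
  then show ?thesis unfolding plane_map_def by (intro continuous_intros)
qed

lemma norm_plane_map_ge:
  assumes m: "0 \<le> m" "m \<le> 1" and f: "m * norm (fst p) \<le> norm (f (fst p))"
  shows "m * norm p \<le> norm (plane_map f p)"
proof -
  obtain z h where p: "p = (z, h)" by (cases p)
  have "m * norm p = sqrt ((m * norm z)\<^sup>2 + (m * norm h)\<^sup>2)"
    using m by (simp add: p norm_Pair power_mult_distrib real_sqrt_mult flip: distrib_left)
  also have "\<dots> \<le> norm (plane_map f p)"
    unfolding plane_map_def p fst_conv snd_conv norm_Pair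
    using f m by (intro real_sqrt_le_mono add_mono power_mono) (auto simp: p mult_left_le_one_le)
  finally show ?thesis .
qed

lemma isotopic_plane_map:
  assumes "continuous_on UNIV f" "bij f" "\<And>z. dist (f z) z \<le> C"
  shows "isotopic A (plane_map f ` A)"
proof (rule isotopic_bounded_displacement)
  show "dist (plane_map f x) x \<le> C" for x
    using assms(3)[of "fst x"] by (cases x) (simp add: plane_map_def dist_Pair_Pair)
qed (intro continuous_on_plane_map bij_plane_map assms)+

lemma isotopic_translate: "isotopic A (plane_map (\<lambda>z. z + c) ` A)"
proof (rule isotopic_plane_map)
  show "continuous_on UNIV (\<lambda>z. z + c)" by (intro continuous_intros)
  show "bij (\<lambda>z. z + c)" by (rule bij_plus_right)
  show "dist (z + c) z \<le> norm c" for z by (simp add: dist_norm)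
qed

text \<open>Displacements are unbounded unless \<open>w = 1\<close>, so a path of multiplications is
  used instead of the Alexander trick: \<open>exp (t * Ln w)\<close> leads from 1 to
  \<open>w\<close>, and its absolute value is at least \<open>min 1 (norm w)\<close>, which gives
  properness.\<close>

lemma isotopic_mult:
  assumes "w \<noteq> 0"
  shows "isotopic A (plane_map (\<lambda>z. w * z) ` A)"
proof -
  define g where "g t = plane_map (\<lambda>z. exp (of_real t * Ln w) * z)" for t :: real
  have ex: "norm (exp (of_real t * Ln w)) \<ge> min 1 (norm w)" if "t \<in> {0..1}" for t
  proof -
    have "norm (exp (of_real t * Ln w)) = exp (t * ln (norm w))"
      using assms by (simp add: Re_Ln)
    moreover have "exp (t * ln (norm w)) \<ge> min 1 (norm w)"
    proof (cases "norm w \<ge> 1")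
      case True then show ?thesis using that by auto
    next
      case False
      then have "ln (norm w) \<le> 0" using assms by simp
      then have "1 * ln (norm w) \<le> t * ln (norm w)"
        using that by (intro mult_right_mono_neg) auto
      then have "exp (1 * ln (norm w)) \<le> exp (t * ln (norm w))" by simp
      then show ?thesis using assms by simp
    qed
    ultimately show ?thesis by (simp only:)
  qed
  define m where "m = min 1 (norm w)"
  have m: "m > 0" "m \<le> 1" using assms by (auto simp: m_def)
  have "isotopic A (g 1 ` A)"
    unfolding isotopic_def
  proof (rule ambient_isotopic_to_S3)
    show "continuous_on ({0..1} \<times> UNIV) (\<lambda>(t, x). g t x)"
      unfolding g_def plane_map_def case_prod_unfold by (intro continuous_intros)
    show "bij (g t)" for t unfolding g_def
      by (intro bij_plane_map o_bij[of "\<lambda>z. z / exp (of_real t * Ln w)"]) (auto simp: o_def)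
    show "g 0 x = x" for x by (simp add: g_def plane_map_def)
    show "\<exists>C. \<forall>t\<in>{0..1}. \<forall>x. norm (g t x) \<le> B \<longrightarrow> norm x \<le> C" for B
    proof (intro exI ballI allI impI)
      fix t x assume t: "t \<in> {0..1::real}" and x: "norm (g t x) \<le> B"
      have "m * norm x \<le> norm (g t x)"
        unfolding g_def using m ex[OF t]
        by (intro norm_plane_map_ge) (auto simp: norm_mult m_def[symmetric] intro: mult_right_mono simp del: norm_exp_eq_Re)
      then have "m * norm x \<le> B" using x by simp
      then show "norm x \<le> B / m" using m by (simp add: field_simps)
    qed
  qed
  then show ?thesis using assms by (simp add: g_def)
qed

text \<open>Points slide along rays: at time \<open>t\<close> the ray through \<open>z\<close> is
  multiplied by \<open>(1 - t) + t * N (sgn z)\<close>, a factor that depends on the ray only. It is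
  at least \<open>min 1 c\<close>, hence every stage is a bijection and the family is
  proper.\<close>

lemma isotopic_radial:
  fixes N :: "complex \<Rightarrow> real"
  assumes N: "continuous_on UNIV N" "\<And>t z. t \<ge> 0 \<Longrightarrow> N (of_real t * z) = t * N z"
    and c: "c > 0" "\<And>z. N z \<ge> c * norm z"
  shows "isotopic ({z. N z = 1} \<times> {0}) (sphere 0 1 \<times> {0})"
proof -
  define r where "r t z = (1 - t) *\<^sub>R z + (t * N z) *\<^sub>R sgn z" for t and z :: complex
  define g where "g t = plane_map (r t)" for t :: real
  define m where "m = min 1 c"
  have m: "m > 0" "m \<le> 1" "m \<le> c" using c by (auto simp: m_def)
  have N0 [simp]: "N 0 = 0" using N(2)[of 0 0] by simp
  have Npos: "N z > 0" if "z \<noteq> 0" for z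
    using c(1) c(2)[of z] that by (smt (verit) mult_pos_pos zero_less_norm_iff)
  have r_eq: "r t z = of_real ((1 - t) + t * N (sgn z)) * z" for t z
  proof (cases "z = 0")
    case False
    have "N z = N (of_real (norm z) * sgn z)"
      using False by (simp add: sgn_div_norm scaleR_conv_of_real mult.assoc[symmetric])
    also have "\<dots> = norm z * N (sgn z)" by (rule N(2)) simp
    finally have "N z = norm z * N (sgn z)" .
    then show ?thesis using False
      by (simp add: r_def scaleR_conv_of_real sgn_div_norm algebra_simps)
  qed (simp add: r_def)
  have fac: "(1 - t) + t * N (sgn z) \<ge> m" if "t \<in> {0..1}" "z \<noteq> 0" for t z
  proof -
    have "(1 - t) * m + t * m \<le> (1 - t) * 1 + t * N (sgn z)"
      using that m c(2)[of "sgn z"] by (intro add_mono mult_left_mono) (auto simp: norm_sgn)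
    then show ?thesis by (simp add: algebra_simps)
  qed
  have sgn_r: "sgn (r t z) = sgn z" if "t \<in> {0..1}" for t z
  proof (cases "z = 0")
    case False
    have "sgn (r t z) = of_real (sgn ((1 - t) + t * N (sgn z))) * sgn z"
      unfolding r_eq by (simp only: sgn_mult sgn_of_real)
    then show ?thesis using fac[OF that False] m by (simp add: sgn_if)
  qed (simp add: r_eq)
  have bij_r: "bij (r t)" if t: "t \<in> {0..1}" for t
  proof (rule bijI)
    show "inj (r t)"
    proof (rule injI)
      fix x y assume e: "r t x = r t y"
      then have s: "sgn x = sgn y" using sgn_r[OF t] by metis
      show "x = y"
      proof (cases "x = 0 \<or> y = 0")
        case True then show ?thesis using s by (metis sgn_zero_iff)
      next
        case False
        then show ?thesis using e s fac[OF t, of x] m unfolding r_eq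
          by (metis mult_left_cancel not_le of_real_eq_0_iff)
      qed
    qed
    have "\<exists>x. r t x = y" for y
    proof (cases "y = 0")
      case True then show ?thesis by (intro exI[of _ 0]) (simp add: r_eq)
    next
      case False
      define a where "a = (1 - t) + t * N (sgn y)"
      have a: "a > 0" using fac[OF t False] m by (simp add: a_def)
      have "sgn (of_real (1 / a) * y) = sgn y" using a by (simp add: sgn_mult sgn_of_real flip: of_real_inverse)
      then have "r t (of_real (1 / a) * y) = y" using a unfolding r_eq
        by (simp add: a_def[symmetric])
      then show ?thesis by blast
    qed
    then show "surj (r t)" by (metis surj_def)
  qed
  have "isotopic ({z. N z = 1} \<times> {0}) (g 1 ` ({z. N z = 1} \<times> {0}))"
    unfolding isotopic_def
  proof (rule ambient_isotopic_to_S3)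
    \<comment> \<open>At 0 the direction \<open>sgn z\<close> is discontinuous, but it is bounded
      and \<open>N z\<close> tends to 0.\<close>
    have "isCont (\<lambda>z. N z *\<^sub>R sgn z) z" for z
    proof (cases "z = 0")
      case False
      have "isCont N z" using N(1) by (simp add: continuous_on_eq_continuous_at)
      then show ?thesis using False by (intro continuous_intros isCont_sgn) auto
    next
      case True
      have "(N \<longlongrightarrow> 0) (at 0)"
        using N(1) by (auto simp: continuous_on_eq_continuous_at isCont_def) (metis N0)
      then have "((\<lambda>z. N z *\<^sub>R sgn z) \<longlongrightarrow> 0) (at 0)"
        by (rule tendsto_0_le[where K = 1]) (auto simp: norm_sgn)
      then show ?thesis by (simp add: True isCont_def)
    qed
    then have "continuous_on UNIV (\<lambda>z. N z *\<^sub>R sgn z)" by (simp add: continuous_at_imp_continuous_on)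
    then have cN: "continuous_on ({0..1} \<times> UNIV) (\<lambda>p::real \<times> space. N (fst (snd p)) *\<^sub>R sgn (fst (snd p)))"
      by (rule continuous_on_compose2) (auto intro!: continuous_intros)
    have "continuous_on ({0..1} \<times> UNIV) (\<lambda>p::real \<times> space.
      ((1 - fst p) *\<^sub>R fst (snd p) + fst p *\<^sub>R (N (fst (snd p)) *\<^sub>R sgn (fst (snd p))), snd (snd p)))"
      by (intro continuous_on_Pair continuous_on_add[OF _ continuous_on_scaleR[OF _ cN]] continuous_intros)
    then show "continuous_on ({0..1} \<times> UNIV) (\<lambda>(t, x). g t x)"
      by (simp add: g_def plane_map_def r_def case_prod_unfold)
    show "bij (g t)" if "t \<in> {0..1}" for t
      unfolding g_def by (intro bij_plane_map bij_r that)
    show "g 0 x = x" for x by (simp add: g_def plane_map_def r_def)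
    show "\<exists>C. \<forall>t\<in>{0..1}. \<forall>x. norm (g t x) \<le> B \<longrightarrow> norm x \<le> C" for B
    proof (intro exI ballI allI impI)
      fix t x assume t: "t \<in> {0..1::real}" and x: "norm (g t x) \<le> B"
      have "m * norm z \<le> norm (r t z)" for z
        using fac[OF t, of z] m by (cases "z = 0") (auto simp: r_eq norm_mult simp del: of_real_add of_real_diff of_real_mult intro!: mult_right_mono)
      then have "m * norm x \<le> norm (g t x)"
        unfolding g_def using m by (intro norm_plane_map_ge) auto
      then have "m * norm x \<le> B" using x by simp
      then show "norm x \<le> B / m" using m by (simp add: field_simps)
    qed
  qed
  moreover have "g 1 ` ({z. N z = 1} \<times> {0}) = sphere 0 1 \<times> {0}"
  proof -
    have "r 1 ` {z. N z = 1} = sphere 0 1"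
    proof (intro equalityI subsetI)
      fix y assume "y \<in> r 1 ` {z. N z = 1}"
      then obtain z where z: "N z = 1" "y = r 1 z" by auto
      then have "z \<noteq> 0" by auto
      then show "y \<in> sphere 0 1" using z by (simp add: r_def norm_sgn)
    next
      fix y :: complex assume y: "y \<in> sphere 0 1"
      then have "y \<noteq> 0" by auto
      define z where "z = of_real (1 / N y) * y"
      have p: "N y > 0" using Npos \<open>y \<noteq> 0\<close> by simp
      have "N z = 1" unfolding z_def using p by (subst N(2)) auto
      moreover have "sgn z = y" using p y unfolding z_def sgn_mult sgn_of_real
        by (simp add: sgn_div_norm)
      ultimately have "r 1 z = y" by (simp add: r_def)
      then show "y \<in> r 1 ` {z. N z = 1}" using \<open>N z = 1\<close> by blast
    qed
    moreover have "g 1 ` ({z. N z = 1} \<times> {0}) = (r 1 ` {z. N z = 1}) \<times> {0}"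
      by (auto simp: g_def plane_map_def image_iff)
    ultimately show ?thesis by simp
  qed
  ultimately show ?thesis by simp
qed

section \<open>Shears of the plane\<close>

text \<open>On the vertical line over \<open>x\<close>, nothing moves up to the floor
  \<open>B x\<close>; above it the drop grows at rate \<open>k\<close> until it reaches
  \<open>F x\<close>, and from there on the line is translated.\<close>

definition shear :: "(real \<Rightarrow> real) \<Rightarrow> real \<Rightarrow> (real \<Rightarrow> real) \<Rightarrow> complex \<Rightarrow> complex" where
  "shear F k B z = Complex (Re z) (Im z - max 0 (min (F (Re z)) (k * (Im z - B (Re z)))))"

text \<open>The frame has origin \<open>p\<close> and first axis \<open>w\<close>; the length of
  \<open>w\<close> is free, so that frames can be scaled as well as rotated.\<close>

definition shear_at ::
    "complex \<Rightarrow> complex \<Rightarrow> (real \<Rightarrow> real) \<Rightarrow> real \<Rightarrow> (real \<Rightarrow> real) \<Rightarrow> complex \<Rightarrow> complex" where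
  "shear_at p w F k B z = p + w * shear F k B ((z - p) / w)"

lemma shear_below:
  assumes "k > 0" "Im z \<le> B (Re z)"
  shows "shear F k B z = z"
proof -
  have "k * (Im z - B (Re z)) \<le> 0" using assms by (intro mult_nonneg_nonpos) auto
  then have "max 0 (min (F (Re z)) (k * (Im z - B (Re z)))) = 0" by linarith
  then show ?thesis by (simp add: shear_def complex_eq_iff)
qed

lemma shear_above:
  assumes "F (Re z) \<ge> 0" "k * (Im z - B (Re z)) \<ge> F (Re z)"
  shows "shear F k B z = Complex (Re z) (Im z - F (Re z))"
  using assms by (simp add: shear_def max_def min_def)

text \<open>Vertical lines are preserved. On each of them the map is strictly increasing because
  \<open>k < 1\<close>, and the bounded drop supplies the interval for the intermediate value
  theorem.\<close>

lemma bij_shear: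
  assumes F: "\<And>x. F x \<le> C" and k: "0 < k" "k < 1"
  shows "bij (shear F k B)"
proof -
  define g where "g x y = y - max 0 (min (F x) (k * (y - B x)))" for x y
  have mono: "g x y < g x y'" if "y < y'" for x y y'
  proof -
    have "k * (y' - B x) - k * (y - B x) < y' - y"
      using mult_strict_right_mono[of k 1 "y' - y"] that k by (simp add: algebra_simps)
    moreover have "k * (y' - B x) - k * (y - B x) \<ge> 0"
      using that k by (simp add: right_diff_distrib[symmetric])
    ultimately show ?thesis unfolding g_def by linarith
  qed
  have surj: "\<exists>y. g x y = c" for x c
  proof -
    define D where "D = max 0 C"
    have b: "g x y \<le> y" "y - D \<le> g x y" for y
      using F[of x] by (auto simp: g_def D_def)
    have "\<exists>y\<ge>c. y \<le> c + D \<and> g x y = c"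
    proof (rule IVT')
      show "continuous_on {c..c + D} (g x)" unfolding g_def by (intro continuous_intros)
    qed (use b[of c] b[of "c + D"] in \<open>auto simp: D_def\<close>)
    then show ?thesis by blast
  qed
  have eq: "shear F k B z = Complex (Re z) (g (Re z) (Im z))" for z by (simp add: shear_def g_def)
  show ?thesis
  proof (rule bijI)
    show "inj (shear F k B)"
      using mono by (intro injI complex_eqI) (auto simp: eq, metis less_irrefl linorder_neqE_linordered_idom)
    have "\<exists>z. shear F k B z = c" for c
    proof -
      obtain y where "g (Re c) y = Im c" using surj by blast
      then show ?thesis by (intro exI[of _ "Complex (Re c) y"]) (simp add: eq)
    qed
    then show "surj (shear F k B)" by (metis surj_def)
  qed
qed

lemma continuous_on_shear:
  assumes "continuous_on UNIV F" "continuous_on UNIV B"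
  shows "continuous_on UNIV (shear F k B)"
proof -
  have "continuous_on UNIV (\<lambda>z. F (Re z))" "continuous_on UNIV (\<lambda>z. B (Re z))"
    by (rule continuous_on_compose2[OF assms(1)] continuous_on_compose2[OF assms(2)];
        auto intro: continuous_intros)+
  then show ?thesis unfolding shear_def[abs_def] Complex_eq by (intro continuous_intros)
qed

lemma isotopic_shear_at:
  assumes w: "w \<noteq> 0" and c: "continuous_on UNIV F" "continuous_on UNIV B"
    and F: "\<And>x. F x \<le> C" and k: "0 < k" "k < 1"
  shows "isotopic A (plane_map (shear_at p w F k B) ` A)"
proof (rule isotopic_plane_map)
  have "continuous_on UNIV (\<lambda>z. shear F k B ((z - p) / w))"
    using w by (intro continuous_on_compose2[OF continuous_on_shear[OF c]] continuous_intros) auto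
  then show "continuous_on UNIV (shear_at p w F k B)"
    unfolding shear_at_def[abs_def] by (intro continuous_intros)
  have "bij (\<lambda>z. p + w * z)" "bij (\<lambda>z. (z - p) / w)"
    by (rule o_bij[of "\<lambda>z. (z - p) / w"] o_bij[of "\<lambda>z. p + w * z"]; use w in \<open>simp add: fun_eq_iff\<close>)+
  then have "bij ((\<lambda>z. p + w * z) \<circ> (shear F k B \<circ> (\<lambda>z. (z - p) / w)))"
    by (intro bij_comp bij_shear[OF F k])
  then show "bij (shear_at p w F k B)" by (simp add: shear_at_def[abs_def] o_def)
  fix z
  define \<zeta> where "\<zeta> = (z - p) / w"
  have "shear_at p w F k B z - z = w * (shear F k B \<zeta> - \<zeta>)"
  proof -
    have "w * \<zeta> = z - p" using w by (simp add: \<zeta>_def)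
    then show ?thesis by (simp add: shear_at_def \<zeta>_def[symmetric] right_diff_distrib)
  qed
  moreover have "norm (shear F k B \<zeta> - \<zeta>) \<le> max 0 C"
  proof -
    have "shear F k B \<zeta> - \<zeta> = - (\<i> * of_real (max 0 (min (F (Re \<zeta>)) (k * (Im \<zeta> - B (Re \<zeta>))))))"
      by (simp add: complex_eq_iff shear_def)
    then have "norm (shear F k B \<zeta> - \<zeta>) = \<bar>max 0 (min (F (Re \<zeta>)) (k * (Im \<zeta> - B (Re \<zeta>))))\<bar>"
      by (simp only: norm_minus_cancel norm_mult norm_of_real) simp
    then show ?thesis using F[of "Re \<zeta>"] by simp
  qed
  ultimately show "dist (shear_at p w F k B z) z \<le> norm w * max 0 C"
    by (simp add: dist_norm norm_mult mult_left_mono)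
qed

lemma shear_at_frame: "w \<noteq> 0 \<Longrightarrow> shear_at p w F k B (p + w * z) = p + w * shear F k B z"
  by (simp add: shear_at_def)

section \<open>Curves on tiles\<close>

definition units :: "complex set" where
  "units = {1, - 1, \<i>, - \<i>}"

lemma units_neq [simp]:
  "(1::complex) \<noteq> - 1" "(- 1::complex) \<noteq> 1" "\<i> \<noteq> - \<i>" "- \<i> \<noteq> \<i>" "1 \<noteq> \<i>" "1 \<noteq> - \<i>" "- 1 \<noteq> \<i>"
  "\<i> \<noteq> 1" "\<i> \<noteq> - 1" "- \<i> \<noteq> 1" "- \<i> \<noteq> - 1" "- 1 \<noteq> - \<i>"
  by (auto simp: complex_eq_iff)

lemma units_nonzero: "w \<in> units \<Longrightarrow> w \<noteq> 0"
  by (auto simp: units_def)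

definition has_end :: "tile \<Rightarrow> complex \<Rightarrow> bool" where
  "has_end t u \<longleftrightarrow> (\<exists>(a, b, h)\<in>strands t. u = a \<or> u = b)"

definition tile_curve :: "tile \<Rightarrow> space set" where
  "tile_curve t = (\<Union>s\<in>strands t. strand_curve 1 0 s)"

definition tile_at :: "complex \<Rightarrow> tile \<Rightarrow> space set" where
  "tile_at c t = plane_map (\<lambda>z. c + z) ` tile_curve t"

lemma plane_map_image_segment:
  "plane_map (\<lambda>z. c + r * z) ` closed_segment (a, h) (b, k) =
    closed_segment (c + r * a, h) (c + r * b, k)"
proof -
  have e: "plane_map (\<lambda>z. c + r * z) ((1 - u) *\<^sub>R (a, h) + u *\<^sub>R (b, k)) =
      (1 - u) *\<^sub>R (c + r * a, h) + u *\<^sub>R (c + r * b, k)" for u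
    by (simp add: plane_map_def scaleR_conv_of_real algebra_simps)
  have s: "closed_segment x y = (\<lambda>u. (1 - u) *\<^sub>R x + u *\<^sub>R y) ` {0..1}" for x y :: space
    by (auto simp: closed_segment_def)
  show ?thesis unfolding s image_image e ..
qed

lemma strand_curve_plane_map:
  "strand_curve r c s = plane_map (\<lambda>z. c + r * z) ` strand_curve 1 0 s"
  by (cases s) (simp add: strand_curve_def image_Un plane_map_image_segment)

lemma strand_curve_commute: "strand_curve r c (a, b, h) = strand_curve r c (b, a, h)"
  by (simp add: strand_curve_def closed_segment_commute Un_commute add.commute)

lemma strand_curve_rotate:
  "strand_curve 1 0 (w * a, w * b, h) = plane_map (\<lambda>z. w * z) ` strand_curve 1 0 (a, b, h)"
proof -
  have "strand_curve w 0 (a, b, h) = strand_curve 1 0 (w * a, w * b, h)"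
    by (simp add: strand_curve_def algebra_simps)
  then show ?thesis using strand_curve_plane_map[of w 0 "(a, b, h)"] by simp
qed

text \<open>In the frame of its own end, a half strand of a turn runs from 1 to
  \<open>(1 + \<i>) / 4\<close> or \<open>(1 - \<i>) / 4\<close>, where the cone condition is an
  equality; a straight one stays on the axis. Towards any other side a half strand does not get
  beyond \<open>1 / 4\<close>. These are finitely many linear cases.\<close>

lemma half_strand_cone:
  assumes "a \<in> units" "b \<in> units" "u \<in> units" "a \<noteq> b"
    and "(z, h) \<in> closed_segment (a, 0) ((a + b) / 4, k)"
  shows "(Re (z / u) \<le> 1 / 2 \<or> u = a \<and> 3 * \<bar>Im (z / u)\<bar> \<le> 1 - Re (z / u))
    \<and> \<bar>Re z\<bar> + \<bar>Im z\<bar> \<le> 1"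
proof -
  obtain s where s: "0 \<le> s" "s \<le> 1" and z: "z = (1 - s) *\<^sub>R a + s *\<^sub>R ((a + b) / 4)"
    using assms(5) by (auto simp: closed_segment_def)
  show ?thesis using assms(1-4) s unfolding z units_def
    by (elim insertE emptyE; hypsubst; simp; linarith?)
qed

lemma strands_units: "(a, b, h) \<in> strands t \<Longrightarrow> a \<in> units \<and> b \<in> units \<and> a \<noteq> b"
  by (cases t) (auto simp: units_def)

text \<open>
  The cone at the midpoint of a side is narrow enough to be left fixed by a push of the adjacent row.
\<close>

lemma tile_curve_cone:
  assumes "(z, h) \<in> tile_curve t" "u \<in> units"
  shows "(Re (z / u) \<le> 1 / 2 \<or> has_end t u \<and> 3 * \<bar>Im (z / u)\<bar> \<le> 1 - Re (z / u))
    \<and> \<bar>Re z\<bar> + \<bar>Im z\<bar> \<le> 1"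
proof -
  obtain a b k where s: "(a, b, k) \<in> strands t" "(z, h) \<in> strand_curve 1 0 (a, b, k)"
    using assms(1) by (auto simp: tile_curve_def)
  note ab = strands_units[OF s(1)]
  have e: "has_end t a" "has_end t b" using s(1) by (auto simp: has_end_def)
  have "(z, h) \<in> closed_segment (a, 0) ((a + b) / 4, k) \<or> (z, h) \<in> closed_segment (b, 0) ((b + a) / 4, k)"
    using s(2) by (auto simp: strand_curve_def closed_segment_commute add.commute)
  then show ?thesis
    using half_strand_cone[of a b u z h k] half_strand_cone[of b a u z h k] ab e assms(2) by metis
qed

lemma has_end_units: "has_end t u \<Longrightarrow> u \<in> units"
  using strands_units by (auto simp: has_end_def)

text \<open>The four tiles with two strands have ends on all sides, so only \<open>T0\<close> and
  the single strands remain. Among these the two lateral ends decide everything, also whether there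
  is an inward end. All heights are 0.\<close>

lemma tile_curve_outward:
  assumes "w \<in> units" "\<not> has_end t (\<i> * w)"
  shows "has_end t w \<Longrightarrow> has_end t (- w) \<Longrightarrow>
      tile_curve t = strand_curve 1 0 (w * 1, w * (- 1), 0) \<and> \<not> has_end t (- \<i> * w)"
    and "has_end t w \<Longrightarrow> \<not> has_end t (- w) \<Longrightarrow>
      tile_curve t = strand_curve 1 0 (w * 1, w * (- \<i>), 0) \<and> has_end t (- \<i> * w)"
    and "\<not> has_end t w \<Longrightarrow> has_end t (- w) \<Longrightarrow>
      tile_curve t = strand_curve 1 0 (w * (- 1), w * (- \<i>), 0) \<and> has_end t (- \<i> * w)"
    and "\<not> has_end t w \<Longrightarrow> \<not> has_end t (- w) \<Longrightarrow> t = T0"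
  using assms
  by (cases t; auto simp: units_def has_end_def tile_curve_def strand_curve_commute)+

section \<open>Pushing in one side of a mosaic\<close>

text \<open>
  \<open>a i\<close> says that the tiles \<open>i\<close> and \<open>i + 1\<close> of an outermost row are joined by the curve.  Above the
  covered abscissae, the curve is the graph of \<open>profile a - 1\<close>.
\<close>

definition covered :: "(int \<Rightarrow> bool) \<Rightarrow> real set" where
  "covered a = (\<Union>i\<in>{i. a i}. {2 * of_int i .. 2 * of_int i + 2})"

text \<open>The height of a cap at distance \<open>d\<close> from its nearer end: slope 3 up to the
  bend of the turn at \<open>d = 1 / 4\<close>, slope \<open>1 / 3\<close> up to
  \<open>d = 1\<close>, then the straight strands at height 1.\<close>

definition ramp :: "real \<Rightarrow> real" where
  "ramp d = min 1 (min (3 * d) (2 / 3 + d / 3))"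

text \<open>The distance to the uncovered set combines all caps of a row into one continuous
  function that vanishes between them. As \<open>infdist\<close> to the empty set is 0,
  \<open>profile_flat\<close> and \<open>side_tile\<close> ask for a nonempty uncovered set.\<close>

definition profile :: "(int \<Rightarrow> bool) \<Rightarrow> real \<Rightarrow> real" where
  "profile a x = ramp (infdist x (- covered a))"

lemma profile_bounds: "0 \<le> profile a x" "profile a x \<le> 1"
  using infdist_nonneg[of x "- covered a"] by (auto simp: profile_def ramp_def)

lemma continuous_on_profile: "continuous_on A (profile a)"
  unfolding profile_def[abs_def] ramp_def by (intro continuous_intros) auto

lemma uncovered:
  assumes "\<not> a i" "2 * of_int i < x" "x < 2 * of_int i + 2"
  shows "x \<notin> covered a"
proof
  assume "x \<in> covered a"
  then obtain j where j: "a j" "2 * of_int j \<le> x" "x \<le> 2 * of_int j + 2"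
    by (auto simp: covered_def)
  have "real_of_int j < of_int (i + 1)" "real_of_int i < of_int (j + 1)" using assms j by simp_all
  then have "i = j" unfolding of_int_less_iff by linarith
  then show False using assms(1) j(1) by blast
qed

lemma uncovered_nonempty: "\<not> a i \<Longrightarrow> - covered a \<noteq> {}"
  using uncovered[of a i "2 * of_int i + 1"] by auto

lemma covered_point:
  assumes "x \<in> covered a" "2 * of_int i - 1 \<le> x" "x \<le> 2 * of_int i + 1"
  shows "(a i \<and> 2 * of_int i \<le> x) \<or> (a (i - 1) \<and> x \<le> 2 * of_int i)"
proof -
  obtain j where j: "a j" "2 * of_int j \<le> x" "x \<le> 2 * of_int j + 2"
    using assms(1) by (auto simp: covered_def)
  have "real_of_int j < of_int (i + 1)" "real_of_int (i - 2) < of_int j"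
    using assms j by simp_all
  then have "j = i \<or> j = i - 1" unfolding of_int_less_iff by linarith
  then show ?thesis using j by auto
qed

text \<open>The uncovered set is open, so the ends of the caps, where the distance would be
  attained, can only be approached.\<close>

lemma infdist_le_approach:
  fixes x :: real
  assumes "\<And>e. 0 < e \<Longrightarrow> e < 1 \<Longrightarrow> \<exists>y\<in>S. \<bar>x - y\<bar> \<le> d + e"
  shows "infdist x S \<le> d"
proof (rule field_le_epsilon)
  fix e :: real assume "e > 0"
  then obtain y where "y \<in> S" "\<bar>x - y\<bar> \<le> d + min e (1 / 2)"
    using assms[of "min e (1 / 2)"] by (auto simp: min_less_iff_disj)
  then show "infdist x S \<le> d + e"
    by (intro infdist_le2[of y]) (auto simp: dist_real_def)
qed

lemma infdist_ge:
  assumes "S \<noteq> {}" "\<And>y. y \<in> S \<Longrightarrow> \<bar>x - y\<bar> \<ge> d"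
  shows "infdist x S \<ge> (d::real)"
  using assms by (auto simp: infdist_def dist_real_def intro!: cINF_greatest)

lemma profile_up:
  assumes "a i" "\<not> a (i - 1)" "2 * of_int i \<le> x" "x \<le> 2 * of_int i + 1"
  shows "profile a x = ramp (x - 2 * of_int i)"
proof -
  have "\<exists>y\<in>- covered a. \<bar>x - y\<bar> \<le> x - 2 * of_int i + e" if "0 < e" "e < 1" for e
    using uncovered[of a "i - 1" "2 * of_int i - e"] assms that
    by (intro bexI[of _ "2 * of_int i - e"]) auto
  then have "infdist x (- covered a) \<le> x - 2 * of_int i" by (rule infdist_le_approach)
  moreover have "infdist x (- covered a) \<ge> x - 2 * of_int i"
  proof (rule infdist_ge[OF uncovered_nonempty[of a, OF assms(2)]])
    fix y assume "y \<in> - covered a"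
    then have "\<not> (2 * of_int i \<le> y \<and> y \<le> 2 * of_int i + 2)" using assms(1) by (auto simp: covered_def)
    then show "x - 2 * of_int i \<le> \<bar>x - y\<bar>" using assms(3,4) by linarith
  qed
  ultimately show ?thesis by (simp add: profile_def)
qed

lemma profile_down:
  assumes "a (i - 1)" "\<not> a i" "2 * of_int i - 1 \<le> x" "x \<le> 2 * of_int i"
  shows "profile a x = ramp (2 * of_int i - x)"
proof -
  have "\<exists>y\<in>- covered a. \<bar>x - y\<bar> \<le> 2 * of_int i - x + e" if "0 < e" "e < 1" for e
    using uncovered[of a i "2 * of_int i + e"] assms that
    by (intro bexI[of _ "2 * of_int i + e"]) auto
  then have "infdist x (- covered a) \<le> 2 * of_int i - x" by (rule infdist_le_approach)
  moreover have "infdist x (- covered a) \<ge> 2 * of_int i - x"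
  proof (rule infdist_ge[OF uncovered_nonempty[of a, OF assms(2)]])
    fix y assume "y \<in> - covered a"
    then have "\<not> (2 * of_int (i - 1) \<le> y \<and> y \<le> 2 * of_int (i - 1) + 2)"
      using assms(1) by (auto simp: covered_def simp del: of_int_diff)
    then show "2 * of_int i - x \<le> \<bar>x - y\<bar>" using assms(3,4) by simp linarith
  qed
  ultimately show ?thesis by (simp add: profile_def)
qed

lemma profile_flat:
  assumes "a (i - 1)" "a i" "2 * of_int i - 1 \<le> x" "x \<le> 2 * of_int i + 1" "- covered a \<noteq> {}"
  shows "profile a x = 1"
proof -
  have "infdist x (- covered a) \<ge> 1"
  proof (rule infdist_ge[OF assms(5)])
    fix y assume y: "y \<in> - covered a"
    then have "\<not> (2 * of_int (i - 1) \<le> y \<and> y \<le> 2 * of_int (i - 1) + 2)"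
      using assms(1) by (auto simp: covered_def simp del: of_int_diff)
    moreover have "\<not> (2 * of_int i \<le> y \<and> y \<le> 2 * of_int i + 2)"
      using y assms(2) by (auto simp: covered_def)
    ultimately show "1 \<le> \<bar>x - y\<bar>" using assms(3,4) by simp linarith
  qed
  then show ?thesis by (simp add: profile_def ramp_def)
qed

text \<open>If one of the two arcs at \<open>2 * of_int i\<close> is missing, this abscissa is a
  limit of uncovered points, and \<open>ramp d\<close> is at most \<open>3 * d\<close>. The bound
  matches the cone that \<open>tile_curve_cone\<close> gives for a strand ending there.\<close>

lemma profile_le:
  assumes "\<not> (a (i - 1) \<and> a i)"
  shows "profile a x \<le> 3 * \<bar>x - 2 * of_int i\<bar>"
proof -
  have "infdist x (- covered a) \<le> \<bar>x - 2 * of_int i\<bar>"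
  proof (rule infdist_le_approach)
    fix e :: real assume e: "0 < e" "e < 1"
    show "\<exists>y\<in>- covered a. \<bar>x - y\<bar> \<le> \<bar>x - 2 * of_int i\<bar> + e"
    proof (cases "a i")
      case True
      then show ?thesis using uncovered[of a "i - 1" "2 * of_int i - e"] assms e
        by (intro bexI[of _ "2 * of_int i - e"]) auto
    next
      case False
      then show ?thesis using uncovered[of a i "2 * of_int i + e"] e
        by (intro bexI[of _ "2 * of_int i + e"]) auto
    qed
  qed
  then show ?thesis by (simp add: profile_def ramp_def min_def)
qed

section \<open>Strands of an outermost row as graphs\<close>

lemma closed_segment_graph:
  assumes "x0 \<le> x1"
  shows "closed_segment (Complex x0 (\<alpha> * x0 + \<beta>), 0 :: real) (Complex x1 (\<alpha> * x1 + \<beta>), 0) =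
    (\<lambda>x. (Complex x (\<alpha> * x + \<beta>), 0)) ` {x0..x1}"
proof -
  have s: "closed_segment x y = (\<lambda>u. (1 - u) *\<^sub>R x + u *\<^sub>R y) ` {0..1}" for x y :: "'a::real_vector"
    by (auto simp: closed_segment_def)
  have "(1 - u) *\<^sub>R (Complex x0 (\<alpha> * x0 + \<beta>), 0 :: real) + u *\<^sub>R (Complex x1 (\<alpha> * x1 + \<beta>), 0) =
      (\<lambda>x. (Complex x (\<alpha> * x + \<beta>), 0)) ((1 - u) *\<^sub>R x0 + u *\<^sub>R x1)" for u
    by (simp add: complex_eq_iff algebra_simps)
  moreover have "{x0..x1} = closed_segment x0 x1" using assms by (simp add: closed_segment_eq_real_ivl)
  ultimately show ?thesis by (simp only: s image_image)
qed

text \<open>The two segments of a turn lie on lines that meet at abscissa \<open>1 / 4\<close> or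
  \<open>- 1 / 4\<close>, where the minimum in \<open>ramp\<close> passes from one line to the
  other.\<close>

lemma strand_arc_graph:
  "strand_curve 1 0 (1, - \<i>, 0) = (\<lambda>x. (Complex x (ramp x - 1), 0)) ` {0..1}" (is ?A)
  "strand_curve 1 0 (- 1, - \<i>, 0) = (\<lambda>x. (Complex x (ramp (- x) - 1), 0)) ` {- 1..0}" (is ?B)
  "strand_curve 1 0 (1, - 1, 0) = (\<lambda>x. (Complex x 0, 0)) ` {- 1..1}" (is ?C)
proof -
  let ?g = "\<lambda>x y. (Complex x y, 0::real)"
  have "strand_curve 1 0 (1, - \<i>, 0) =
      closed_segment (?g 0 (3 * 0 + - 1)) (?g (1 / 4) (3 * (1 / 4) + - 1)) \<union>
      closed_segment (?g (1 / 4) (1 / 3 * (1 / 4) + - (1 / 3))) (?g 1 (1 / 3 * 1 + - (1 / 3)))"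
    by (simp add: strand_curve_def closed_segment_commute Un_commute Complex_eq diff_divide_distrib)
  also have "\<dots> = (\<lambda>x. ?g x (3 * x + - 1)) ` {0..1 / 4} \<union> (\<lambda>x. ?g x (1 / 3 * x + - (1 / 3))) ` {1 / 4..1}"
    by (intro arg_cong2[where f = "(\<union>)"] closed_segment_graph) auto
  also have "\<dots> = (\<lambda>x. ?g x (ramp x - 1)) ` {0..1 / 4} \<union> (\<lambda>x. ?g x (ramp x - 1)) ` {1 / 4..1}"
    by (intro arg_cong2[where f = "(\<union>)"] image_cong refl) (auto simp: ramp_def min_def)
  also have "\<dots> = (\<lambda>x. ?g x (ramp x - 1)) ` ({0..1 / 4} \<union> {1 / 4..1})" by (rule image_Un[symmetric])
  also have "{0..1 / 4} \<union> {1 / 4..1::real} = {0..1}" by auto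
  finally show ?A .
  have e: "- (\<i> / 4) - 1 / 4 = - (1 / 4) - \<i> / 4" by (rule complex_eqI) auto
  have "strand_curve 1 0 (- 1, - \<i>, 0) =
      closed_segment (?g (- 1 / 4) (- 3 * (- 1 / 4) + - 1)) (?g 0 (- 3 * 0 + - 1)) \<union>
      closed_segment (?g (- 1) (- 1 / 3 * - 1 + - (1 / 3))) (?g (- 1 / 4) (- 1 / 3 * (- 1 / 4) + - (1 / 3)))"
    by (simp add: strand_curve_def closed_segment_commute Un_commute Complex_eq diff_divide_distrib e)
  also have "\<dots> = (\<lambda>x. ?g x (- 3 * x + - 1)) ` {- 1 / 4..0} \<union> (\<lambda>x. ?g x (- 1 / 3 * x + - (1 / 3))) ` {- 1..- 1 / 4}"
    by (intro arg_cong2[where f = "(\<union>)"] closed_segment_graph) auto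
  also have "\<dots> = (\<lambda>x. ?g x (ramp (- x) - 1)) ` {- 1 / 4..0} \<union> (\<lambda>x. ?g x (ramp (- x) - 1)) ` {- 1..- 1 / 4}"
    by (intro arg_cong2[where f = "(\<union>)"] image_cong refl) (auto simp: ramp_def min_def)
  also have "\<dots> = (\<lambda>x. ?g x (ramp (- x) - 1)) ` ({- 1 / 4..0} \<union> {- 1..- 1 / 4})" by (rule image_Un[symmetric])
  also have "{- 1 / 4..0} \<union> {- 1..- 1 / 4} = {- 1..0::real}" by auto
  finally show ?B .
  have "strand_curve 1 0 (1, - 1, 0) =
      closed_segment (?g 0 (0 * 0 + 0)) (?g 1 (0 * 1 + 0)) \<union>
      closed_segment (?g (- 1) (0 * - 1 + 0)) (?g 0 (0 * 0 + 0))"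
    by (simp add: strand_curve_def closed_segment_commute Un_commute Complex_eq diff_divide_distrib)
  also have "\<dots> = (\<lambda>x. ?g x (0 * x + 0)) ` {0..1} \<union> (\<lambda>x. ?g x (0 * x + 0)) ` {- 1..0}"
    by (intro arg_cong2[where f = "(\<union>)"] closed_segment_graph) auto
  also have "\<dots> = (\<lambda>x. ?g x (0 * x + 0)) ` ({0..1} \<union> {- 1..0})" by (rule image_Un[symmetric])
  also have "{0..1} \<union> {- 1..0} = {- 1..1::real}" by auto
  finally show ?C by simp
qed

definition row_graph ::
    "complex \<Rightarrow> complex \<Rightarrow> (real \<Rightarrow> real) \<Rightarrow> real set \<Rightarrow> space set" where
  "row_graph p w f X = (\<lambda>x. (p + w * Complex x (f x), 0)) ` X"

text \<open>The four cases for the lateral ends of the tile are the flat part of a cap, its left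
  end, its right end, and a place outside all caps.\<close>

lemma side_tile:
  assumes w: "w \<in> units" and t: "\<not> has_end t (\<i> * w)"
    and a: "has_end t w \<longleftrightarrow> a i" "has_end t (- w) \<longleftrightarrow> a (i - 1)" and ne: "- covered a \<noteq> {}"
  shows "tile_at (p + w * (2 * of_int i)) t =
    row_graph p w (\<lambda>x. profile a x - 1) (covered a \<inter> {2 * of_int i - 1..2 * of_int i + 1})"
proof -
  define X where "X = covered a \<inter> {2 * of_int i - 1..2 * of_int i + 1}"
  define c where "c = 2 * real_of_int i"
  have sub: "x \<in> covered a" if "a j" "2 * of_int j \<le> x" "x \<le> 2 * of_int j + 2" for x j
    using that by (auto simp: covered_def)
  have cov: "a i \<Longrightarrow> {c..c + 1} \<subseteq> covered a" "a (i - 1) \<Longrightarrow> {c - 1..c} \<subseteq> covered a"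
    by (auto simp: c_def intro: sub[of i] sub[of "i - 1"])
  have X1: "a i \<Longrightarrow> a (i - 1) \<Longrightarrow> X = (\<lambda>x. c + x) ` {- 1..1}"
    "a i \<Longrightarrow> \<not> a (i - 1) \<Longrightarrow> X = (\<lambda>x. c + x) ` {0..1}"
    "\<not> a i \<Longrightarrow> a (i - 1) \<Longrightarrow> X = (\<lambda>x. c + x) ` {- 1..0}"
    "\<not> a i \<Longrightarrow> \<not> a (i - 1) \<Longrightarrow> X = {}"
    using cov covered_point[of _ a i] unfolding image_add_atLeastAtMost X_def c_def[symmetric]
    by force+
  have gr: "row_graph p w (\<lambda>x. profile a x - 1) ((\<lambda>x. c + x) ` S) =
      plane_map (\<lambda>z. p + w * (2 * of_int i) + z) ` plane_map (\<lambda>z. w * z) `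
      (\<lambda>x. (Complex x (g x - 1), 0)) ` S" if "\<And>x. x \<in> S \<Longrightarrow> profile a (c + x) = g x" for S g
  proof -
    have "Complex (c + x) y = 2 * of_int i + Complex x y" for x y by (simp add: complex_eq_iff c_def)
    then show ?thesis unfolding row_graph_def image_image
      by (intro image_cong refl) (simp add: plane_map_def that distrib_left)
  qed
  have "tile_at (p + w * (2 * of_int i)) t = row_graph p w (\<lambda>x. profile a x - 1) X"
  proof (cases "a i"; cases "a (i - 1)")
    assume "a i" "a (i - 1)"
    then show ?thesis using tile_curve_outward(1)[OF w t] a profile_flat[of a i] ne
      unfolding X1(1)[OF \<open>a i\<close> \<open>a (i - 1)\<close>] strand_curve_rotate tile_at_def strand_arc_graph
      by (subst gr[of _ "\<lambda>_. 1"]) (auto simp: c_def strand_curve_rotate strand_arc_graph)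
  next
    assume "a i" "\<not> a (i - 1)"
    then show ?thesis using tile_curve_outward(2)[OF w t] a profile_up[of a i]
      unfolding X1(2)[OF \<open>a i\<close> \<open>\<not> a (i - 1)\<close>] strand_curve_rotate tile_at_def strand_arc_graph
      by (subst gr[of _ ramp]) (auto simp: c_def strand_curve_rotate strand_arc_graph)
  next
    assume "\<not> a i" "a (i - 1)"
    then show ?thesis using tile_curve_outward(3)[OF w t] a profile_down[of a i]
      unfolding X1(3)[OF \<open>\<not> a i\<close> \<open>a (i - 1)\<close>] strand_curve_rotate tile_at_def strand_arc_graph
      by (subst gr[of _ "\<lambda>x. ramp (- x)"]) (auto simp: c_def strand_curve_rotate strand_arc_graph)
  next
    assume "\<not> a i" "\<not> a (i - 1)"
    then show ?thesis using tile_curve_outward(4)[OF w t] a X1(4)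
      by (simp add: tile_at_def tile_curve_def row_graph_def)
  qed
  then show ?thesis by (simp add: X_def)
qed

text \<open>
  The shear fixes what lies below \<open>- 1 - profile a / 2\<close>, which leaves room for the curves that hang off
  the row, and the factor \<open>2 / 3\<close> makes it take the graph of \<open>profile a - 1\<close> to the line at height \<open>- 1\<close>.
\<close>

definition push :: "complex \<Rightarrow> complex \<Rightarrow> (int \<Rightarrow> bool) \<Rightarrow> complex \<Rightarrow> complex" where
  "push p w a = shear_at p w (profile a) (2 / 3) (\<lambda>x. - 1 - profile a x / 2)"

lemma isotopic_push: "w \<noteq> 0 \<Longrightarrow> isotopic A (plane_map (push p w a) ` A)"
  unfolding push_def
  by (rule isotopic_shear_at[where C = 1])
    (auto intro!: continuous_intros continuous_on_profile profile_bounds)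

lemma push_row_graph:
  assumes "w \<noteq> 0"
  shows "plane_map (push p w a) ` row_graph p w (\<lambda>x. profile a x - 1) X = row_graph p w (\<lambda>x. - 1) X"
  unfolding row_graph_def image_image plane_map_def fst_conv snd_conv push_def shear_at_frame[OF assms]
  using profile_bounds by (intro image_cong refl) (simp add: shear_above)

lemma push_fixed:
  assumes "w \<noteq> 0" "Im z \<le> - 1 - profile a (Re z) / 2"
  shows "push p w a (p + w * z) = p + w * z"
  using assms by (simp add: push_def shear_at_frame shear_below)

lemma push_fixed_deep:
  assumes "w \<noteq> 0" "Im z \<le> - 3 / 2"
  shows "push p w a (p + w * z) = p + w * z"
  using assms profile_bounds(2)[of a "Re z"] by (intro push_fixed) auto

text \<open>The shear fixes everything up to height \<open>- 3 / 2\<close>. A tile at depth 1 gets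
  higher only along a strand with an outward end, hence, by the last assumption, below the end of a
  cap. At height \<open>Im y\<close> in the tile, the cone bounds the profile by
  \<open>1 - Im y\<close>, and \<open>- 2 + Im y\<close> is at most
  \<open>- 1 - (1 - Im y) / 2\<close> because \<open>Im y \<le> 1\<close>.\<close>

lemma push_fixed_tile:
  assumes w: "w \<in> units" and d: "d \<ge> 1"
    and e: "d = 1 \<Longrightarrow> has_end t (\<i> * w) \<Longrightarrow> \<not> (a (i - 1) \<and> a i)"
  shows "plane_map (push p w a) ` tile_at (p + w * (2 * of_int i - 2 * of_int d * \<i>)) t =
    tile_at (p + w * (2 * of_int i - 2 * of_int d * \<i>)) t"
proof -
  have "push p w a (p + w * (2 * of_int i - 2 * of_int d * \<i>) + z) =
      p + w * (2 * of_int i - 2 * of_int d * \<i>) + z" if z: "(z, h) \<in> tile_curve t" for z h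
  proof -
    have w0: "w \<noteq> 0" using w units_nonzero by blast
    define y where "y = z / w"
    define c where "c = 2 * of_int i - 2 * of_int d * \<i> + y"
    have iw: "\<i> * w \<in> units" using w by (auto simp: units_def)
    have q: "z / (\<i> * w) = - \<i> * y" using w0 by (simp add: y_def field_simps)
    have cone: "Im y \<le> 1 / 2 \<or> has_end t (\<i> * w) \<and> 3 * \<bar>Re y\<bar> \<le> 1 - Im y"
      using tile_curve_cone[OF z iw] unfolding q by simp
    have "\<bar>Im y\<bar> \<le> 1" using tile_curve_cone[OF z iw] w unfolding y_def units_def by auto
    have "Im c \<le> - 1 - profile a (Re c) / 2"
    proof (cases "Im y \<le> 1 / 2 \<or> d \<ge> 2")
      case True
      have "real_of_int d \<ge> 1" using d by simp
      moreover have "real_of_int d \<ge> 2" if "d \<ge> 2" using that by simp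
      ultimately have "Im c \<le> - 3 / 2" using True \<open>\<bar>Im y\<bar> \<le> 1\<close> by (auto simp: c_def)
      then show ?thesis using profile_bounds(2)[of a "Re c"] by simp
    next
      case False
      then have d1: "d = 1" and h: "has_end t (\<i> * w)" "3 * \<bar>Re y\<bar> \<le> 1 - Im y" using cone d by auto
      have "profile a (Re c) \<le> 3 * \<bar>Re c - 2 * of_int i\<bar>"
        by (rule profile_le) (use e d1 h in simp)
      then have "profile a (Re c) \<le> 1 - Im y" using h(2) by (simp add: c_def)
      then show ?thesis using d1 \<open>\<bar>Im y\<bar> \<le> 1\<close> by (simp add: c_def)
    qed
    then have "push p w a (p + w * c) = p + w * c" by (rule push_fixed[OF w0])
    moreover have "p + w * c = p + w * (2 * of_int i - 2 * of_int d * \<i>) + z"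
      using w0 by (simp add: c_def y_def distrib_left)
    ultimately show ?thesis by simp
  qed
  then show ?thesis unfolding tile_at_def image_image
    by (intro image_cong refl) (auto simp: plane_map_def)
qed

section \<open>Pushing in the border of a mosaic\<close>

text \<open>
  A unit \<open>w\<close> stands for the side of the grid that is traversed in direction \<open>w\<close> when the grid is
  run around clockwise: \<open>1\<close> is the top side and \<open>\<i> * w\<close> is the outward normal of the side \<open>w\<close>.  In the
  frame of the side \<open>w\<close>, the tile \<open>cell w i d\<close> is the \<open>i\<close>-th one in the row at depth \<open>d\<close> below that side.
\<close>

locale grid_mosaic =
  fixes Z :: "int \<Rightarrow> int \<Rightarrow> tile" and M N :: int
  assumes outside: "Z i j \<noteq> T0 \<Longrightarrow> 0 \<le> i \<and> i \<le> M \<and> 0 \<le> j \<and> j \<le> N"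
    and horizontal: "has_end (Z i j) 1 \<longleftrightarrow> has_end (Z (i + 1) j) (- 1)"
    and vertical: "has_end (Z i j) \<i> \<longleftrightarrow> has_end (Z i (j + 1)) (- \<i>)"
begin

text \<open>The index of the last tile along the side \<open>w\<close>, one less than the number of
  tiles. In the same sense \<open>len (\<i> * w)\<close> is the greatest depth below that
  side.\<close>

definition len :: "complex \<Rightarrow> int" where
  "len w = (if w = 1 \<or> w = - 1 then M else N)"

text \<open>The centre of the first tile of the side \<open>w\<close>, found from the middle
  \<open>M + N * \<i>\<close> of the grid by going half the depth outwards and half the side
  backwards.\<close>

definition origin :: "complex \<Rightarrow> complex" where
  "origin w = of_int M + of_int N * \<i> + w * (of_int (len (\<i> * w)) * \<i> - of_int (len w))"

definition cell :: "complex \<Rightarrow> int \<Rightarrow> int \<Rightarrow> tile" where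
  "cell w i d = (if w = 1 then Z i (N - d) else if w = - \<i> then Z (M - d) (N - i)
    else if w = - 1 then Z (M - i) d else Z d i)"

definition pos :: "complex \<Rightarrow> int \<Rightarrow> int \<Rightarrow> complex" where
  "pos w i d = origin w + w * (2 * of_int i - 2 * of_int d * \<i>)"

definition arc :: "complex \<Rightarrow> int \<Rightarrow> bool" where
  "arc w i \<longleftrightarrow> has_end (cell w i 0) w"

definition rect :: "complex \<Rightarrow> int set \<Rightarrow> int set \<Rightarrow> space set" where
  "rect w I D = (\<Union>i\<in>I. \<Union>d\<in>D. tile_at (pos w i d) (cell w i d))"

lemma len_simps [simp]: "w \<in> units \<Longrightarrow> len (- w) = len w" "len 1 = M" "len \<i> = N"
  by (auto simp: len_def units_def)

lemma units_closed: "w \<in> units \<Longrightarrow> \<i> * w \<in> units" "w \<in> units \<Longrightarrow> - w \<in> units" "w \<in> units \<Longrightarrow> - (\<i> * w) \<in> units"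
  by (auto simp: units_def)

lemma origin_turn:
  assumes "w \<in> units"
  shows "origin w = origin (\<i> * w) + \<i> * w * (2 * of_int (len (\<i> * w)))"
    "origin (- (\<i> * w)) = origin w + w * (2 * of_int (len w))"
    "origin (- w) = origin w + w * (2 * of_int (len w) - 2 * of_int (len (\<i> * w)) * \<i>)"
  using assms by (auto simp: units_def origin_def len_def algebra_simps)

lemma cell_turn:
  assumes "w \<in> units"
  shows "cell (\<i> * w) i d = cell w d (len (\<i> * w) - i)"
    "cell (- (\<i> * w)) i d = cell w (len w - d) i"
    "cell (- w) i d = cell w (len w - i) (len (\<i> * w) - d)"
  using assms by (auto simp: units_def cell_def len_def)

lemma pos_turn:
  assumes "w \<in> units"
  shows "pos (\<i> * w) i d = pos w d (len (\<i> * w) - i)"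
    "pos (- (\<i> * w)) i d = pos w (len w - d) i"
    "pos (- w) i d = pos w (len w - i) (len (\<i> * w) - d)"
  using assms by (auto simp: units_def pos_def origin_def len_def algebra_simps)

lemma cell_horizontal: "w \<in> units \<Longrightarrow> has_end (cell w i d) w \<longleftrightarrow> has_end (cell w (i + 1) d) (- w)"
  using horizontal[of i "N - d"] horizontal[of "M - i - 1" d] vertical[of d i] vertical[of "M - d" "N - i - 1"]
  by (auto simp: units_def cell_def algebra_simps)

lemma cell_vertical:
  assumes "w \<in> units"
  shows "has_end (cell w i (d + 1)) (\<i> * w) \<longleftrightarrow> has_end (cell w i d) (- \<i> * w)"
  using assms horizontal[of d i] horizontal[of "M - d - 1" "N - i"] vertical[of i "N - d - 1"] vertical[of "M - i" d]
  by (auto simp: units_def cell_def algebra_simps)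

lemma cell_outside:
  assumes "w \<in> units" "cell w i d \<noteq> T0"
  shows "0 \<le> i" "i \<le> len w" "0 \<le> d" "d \<le> len (\<i> * w)"
  using assms outside[of i "N - d"] outside[of "M - i" d] outside[of d i] outside[of "M - d" "N - i"]
  by (auto simp: units_def cell_def len_def)

lemma has_end_T0 [simp]: "\<not> has_end T0 u"
  by (simp add: has_end_def)

lemma no_outward: "w \<in> units \<Longrightarrow> \<not> has_end (cell w i 0) (\<i> * w)"
  using cell_vertical[of w i "- 1"] cell_outside(3)[of w i "- 1"] by fastforce

lemma arc_prev: "w \<in> units \<Longrightarrow> has_end (cell w i 0) (- w) \<longleftrightarrow> arc w (i - 1)"
  using cell_horizontal[of w "i - 1" 0] by (simp add: arc_def)

lemma arc_range:
  assumes "w \<in> units" "arc w i"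
  shows "0 \<le> i" "i < len w"
proof -
  have "cell w i 0 \<noteq> T0" "cell w (i + 1) 0 \<noteq> T0"
    using assms cell_horizontal[of w i 0] by (auto simp: arc_def)
  then show "0 \<le> i" "i < len w" using cell_outside[OF assms(1)] by fastforce+
qed

text \<open>A corner tile lacks two outward ends, so it is empty or a turn that joins the beginning
  of \<open>w\<close> to the end of the preceding side \<open>\<i> * w\<close>.\<close>

lemma arc_corner: "w \<in> units \<Longrightarrow> arc w 0 \<longleftrightarrow> arc (\<i> * w) (len (\<i> * w) - 1)"
proof -
  assume w: "w \<in> units"
  have iw: "\<i> * w \<in> units" using units_closed w by blast
  have c: "cell (\<i> * w) (len (\<i> * w)) 0 = cell w 0 0" by (simp add: cell_turn[OF w])
  have "arc (\<i> * w) (len (\<i> * w) - 1) \<longleftrightarrow> has_end (cell w 0 0) (- (\<i> * w))"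
    using arc_prev[OF iw, of "len (\<i> * w)"] c by simp
  moreover have "\<not> has_end (cell w 0 0) (- w)"
    using no_outward[OF iw, of "len (\<i> * w)"] c by simp
  ultimately show ?thesis
    using tile_curve_outward(2,4)[OF w no_outward[OF w], of 0] has_end_T0
    unfolding arc_def by (metis mult_minus_left)
qed

lemma uncovered_arc: "w \<in> units \<Longrightarrow> - covered (arc w) \<noteq> {}"
  using uncovered_nonempty[of "arc w" "- 1"] arc_range[of w "- 1"] by auto

lemma covered_arc_range:
  assumes "w \<in> units" "x \<in> covered (arc w)"
  shows "0 \<le> x" "x \<le> 2 * of_int (len w)"
proof -
  obtain i where i: "arc w i" "2 * of_int i \<le> x" "x \<le> 2 * of_int i + 2"
    using assms(2) by (auto simp: covered_def)
  have "0 \<le> real_of_int i" "real_of_int (i + 1) \<le> of_int (len w)"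
    using arc_range[OF assms(1) i(1)] by (simp_all only: of_int_0_le_iff of_int_le_iff)
  then show "0 \<le> x" "x \<le> 2 * of_int (len w)" using i by simp_all
qed

definition border :: "complex \<Rightarrow> real set \<Rightarrow> space set" where
  "border w X = row_graph (origin w) w (\<lambda>x. profile (arc w) x - 1) X"

text \<open>Height \<open>- 1\<close> in the frame of a side is the line through the vertices
  between its two outermost rows.\<close>

definition strip :: "complex \<Rightarrow> real set \<Rightarrow> space set" where
  "strip w X = row_graph (origin w) w (\<lambda>x. - 1) X"

definition pushed :: "complex \<Rightarrow> space \<Rightarrow> space" where
  "pushed w = plane_map (push (origin w) w (arc w))"

lemma isotopic_pushed: "w \<in> units \<Longrightarrow> isotopic A (pushed w ` A)"
  unfolding pushed_def using isotopic_push units_nonzero by blast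

lemma rect_turn:
  assumes "w \<in> units"
  shows "rect (\<i> * w) I D = rect w D ((\<lambda>i. len (\<i> * w) - i) ` I)"
    "rect (- (\<i> * w)) I D = rect w ((\<lambda>d. len w - d) ` D) I"
    "rect (- w) I D = rect w ((\<lambda>i. len w - i) ` I) ((\<lambda>d. len (\<i> * w) - d) ` D)"
  by (auto simp: rect_def pos_turn[OF assms] cell_turn[OF assms])

lemma rect_Un:
  "rect w (I \<union> J) D = rect w I D \<union> rect w J D" "rect w I (D \<union> E) = rect w I D \<union> rect w I E"
  by (auto simp: rect_def)

lemma rect_row:
  assumes w: "w \<in> units" and "m \<le> n"
  shows "rect w {m..n} {0} = border w (covered (arc w) \<inter> {2 * of_int m - 1..2 * of_int n + 1})"
proof -
  have t: "tile_at (pos w i 0) (cell w i 0) =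
      border w (covered (arc w) \<inter> {2 * of_int i - 1..2 * of_int i + 1})" for i
    unfolding border_def pos_def
    using side_tile[OF w no_outward[OF w], where a = "arc w" and i = i and p = "origin w"]
      arc_prev[OF w] uncovered_arc[OF w] by (simp add: arc_def)
  have u: "(\<Union>i\<in>{m..n}. {2 * real_of_int i - 1..2 * of_int i + 1}) = {2 * of_int m - 1..2 * of_int n + 1}"
    using assms(2)
  proof (induction n rule: int_ge_induct)
    case (step n)
    have "{m..n + 1} = insert (n + 1) {m..n}" using step by auto
    then show ?case using step by (auto simp: le_divide_eq)
  qed simp
  have "rect w {m..n} {0} = border w (\<Union>i\<in>{m..n}. covered (arc w) \<inter> {2 * of_int i - 1..2 * of_int i + 1})"
    unfolding rect_def by (simp add: t) (auto simp: border_def row_graph_def)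
  then show ?thesis by (simp only: Int_UN_distrib[symmetric] u)
qed

lemma pushed_border: "w \<in> units \<Longrightarrow> pushed w ` border w X = strip w X"
  unfolding pushed_def border_def strip_def using push_row_graph units_nonzero by blast

lemma pushed_rect:
  assumes w: "w \<in> units" and D: "\<And>d. d \<in> D \<Longrightarrow> d \<ge> 1"
  shows "pushed w ` rect w I D = rect w I D"
proof -
  have "pushed w ` tile_at (pos w i d) (cell w i d) = tile_at (pos w i d) (cell w i d)"
    if "d \<in> D" for i d
    unfolding pushed_def pos_def
  proof (rule push_fixed_tile[OF w D[OF that]])
    \<comment> \<open>A strand at depth 1 that reaches the outermost row continues into a tile with
      an inward end, where a cap begins or ends.\<close>
    assume "d = 1" "has_end (cell w i d) (\<i> * w)"
    then have "has_end (cell w i 0) (- \<i> * w)" using cell_vertical[OF w, of i 0] by simp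
    then show "\<not> (arc w (i - 1) \<and> arc w i)"
      using tile_curve_outward(1)[OF w no_outward[OF w], of i] arc_prev[OF w, of i] by (auto simp: arc_def)
  qed
  then show ?thesis by (simp add: rect_def image_UN)
qed

end

section \<open>Strips under the pushes of the other three sides\<close>

locale wide_mosaic = grid_mosaic +
  assumes wide: "M \<ge> 2" "N \<ge> 2"
begin

lemma len_ge_2: "len w \<ge> 2"
  using wide by (simp add: len_def)

lemma len_ge_2_real: "real_of_int (len w) \<ge> 2"
  using len_ge_2[of w] by linarith

text \<open>In the frame of the opposite side the strip is at height
  \<open>1 - 2 * of_int (len (\<i> * w))\<close>, at most \<open>- 3\<close> and thus out of reach.
  With two rows it would be at height \<open>- 1\<close>, and opposite sides would be pushed onto
  the same line.\<close>

lemma strip_far: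
  assumes w: "w \<in> units"
  shows "pushed (- w) ` strip w X = strip w X"
proof -
  have w0: "- w \<noteq> 0" using units_nonzero w by auto
  have "push (origin (- w)) (- w) (arc (- w)) (origin w + w * Complex x (- 1)) = origin w + w * Complex x (- 1)" for x
  proof -
    define c where "c = Complex (2 * of_int (len w) - x) (1 - 2 * of_int (len (\<i> * w)))"
    have e: "origin w + w * Complex x (- 1) = origin (- w) + (- w) * c"
      unfolding c_def origin_turn(3)[OF w] by (simp add: Complex_eq algebra_simps)
    show ?thesis unfolding e
      by (rule push_fixed_deep[OF w0]) (use len_ge_2_real[of "\<i> * w"] in \<open>simp add: c_def\<close>)
  qed
  then show ?thesis
    unfolding strip_def row_graph_def image_image pushed_def plane_map_def by simp
qed

text \<open>In the frame of the preceding side \<open>v\<close> the strip is vertical, at abscissa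
  \<open>2 * of_int K - 1\<close>, the middle of the last arc of \<open>v\<close>. If the corner is
  occupied, the profile is 1 there and the push retracts the beginning of the strip from 0 to 1.
  Otherwise the strip does not start before 2 and is out of reach. The set \<open>S\<close> allows
  for a strip that has already been retracted at its other end.\<close>

lemma strip_begin:
  assumes w: "w \<in> units" and S: "{..2} \<subseteq> S"
  shows "pushed (\<i> * w) ` strip w (covered (arc w) \<inter> S) = strip w (covered (arc w) \<inter> S \<inter> {1..})"
proof -
  define v where "v = \<i> * w"
  define K where "K = len v"
  have v: "v \<in> units" "v \<noteq> 0" using units_closed w units_nonzero unfolding v_def by blast+
  \<comment> \<open>With profile 1 the floor is \<open>- 3 / 2\<close>, so a point at height
    \<open>- x\<close> drops by \<open>2 / 3 * (3 / 2 - x)\<close> as long as this is positive. Thus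
    \<open>x\<close> becomes \<open>1 + x / 3\<close>, and \<open>{0..3 / 2}\<close> is compressed
    onto \<open>{1..3 / 2}\<close>.\<close>
  define g where "g x = (if arc w 0 then max x (1 + x / 3) else x)" for x :: real
  have g: "push (origin v) v (arc v) (origin w + w * Complex x (- 1)) = origin w + w * Complex (g x) (- 1)"
    if x: "x \<in> covered (arc w)" for x
  proof -
    have e: "origin w + w * Complex y (- 1) = origin v + v * Complex (2 * of_int K - 1) (- y)" for y
      unfolding origin_turn(1)[OF w] v_def[symmetric] K_def by (simp add: v_def Complex_eq algebra_simps)
    have x0: "x \<ge> 0" using covered_arc_range[OF w x] by simp
    show ?thesis
    proof (cases "arc w 0")
      case True
      then have "arc v (K - 1)" "\<not> arc v K"
        using arc_corner[OF w] arc_range[OF v(1), of K] by (auto simp: v_def K_def)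
      then have "profile (arc v) (2 * of_int K - 1) = 1"
        using profile_down[of "arc v" K "2 * of_int K - 1"] by (simp add: ramp_def)
      then show ?thesis unfolding e push_def shear_at_frame[OF v(2)] using True x0
        by (simp add: shear_def g_def max_def min_def diff_divide_distrib add_divide_distrib)
    next
      case False
      have "x \<ge> 2"
      proof (rule ccontr)
        assume "\<not> x \<ge> 2"
        then have "x = 0 \<or> (0 < x \<and> x < 2)" using x0 by auto
        then show False using uncovered[of "arc w" 0 x] False x covered_point[of x "arc w" 0] arc_range[OF w, of "- 1"]
          by auto
      qed
      then show ?thesis unfolding e using False
        by (subst push_fixed_deep[OF v(2)]) (auto simp: g_def)
    qed
  qed
  have "g ` (covered (arc w) \<inter> S) = covered (arc w) \<inter> S \<inter> {1..}"
  proof (cases "arc w 0")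
    case True
    then have sub: "{0..2} \<subseteq> covered (arc w)" by (force simp: covered_def)
    show ?thesis
    proof (intro equalityI subsetI)
      fix y assume "y \<in> g ` (covered (arc w) \<inter> S)"
      then obtain x where x: "x \<in> covered (arc w)" "x \<in> S" "y = g x" by blast
      have "x \<ge> 0" using covered_arc_range[OF w x(1)] by simp
      show "y \<in> covered (arc w) \<inter> S \<inter> {1..}"
      proof (cases "x \<le> 3 / 2")
        case True
        then have "1 \<le> y" "y \<le> 3 / 2" using \<open>x \<ge> 0\<close> \<open>arc w 0\<close> x(3) by (auto simp: g_def)
        then show ?thesis using sub S by auto
      next
        case False
        then have "y = x" using \<open>arc w 0\<close> x(3) by (simp add: g_def)
        then show ?thesis using x False by simp
      qed
    next
      fix y assume y: "y \<in> covered (arc w) \<inter> S \<inter> {1..}"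
      show "y \<in> g ` (covered (arc w) \<inter> S)"
      proof (cases "y \<le> 3 / 2")
        case True
        have "g (3 * (y - 1)) = y" using True \<open>arc w 0\<close> by (simp add: g_def max_def diff_divide_distrib)
        moreover have "3 * (y - 1) \<in> covered (arc w) \<inter> S"
          using True y sub S by auto
        ultimately show ?thesis by (metis image_eqI)
      next
        case False
        then have "g y = y" by (simp add: g_def)
        then show ?thesis using y by (metis IntD1 image_eqI)
      qed
    qed
  next
    case False
    have "x \<ge> 1" if "x \<in> covered (arc w)" for x
    proof (rule ccontr)
      assume "\<not> x \<ge> 1"
      then have "x = 0 \<or> (0 < x \<and> x < 2)" using covered_arc_range[OF w that] by auto
      then show False using uncovered[of "arc w" 0 x] False that covered_point[of x "arc w" 0] arc_range[OF w, of "- 1"]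
        by auto
    qed
    then show ?thesis using False by (auto simp: g_def)
  qed
  moreover have "pushed v ` strip w (covered (arc w) \<inter> S) = strip w (g ` (covered (arc w) \<inter> S))"
    unfolding strip_def row_graph_def image_image pushed_def plane_map_def by (intro image_cong refl) (simp add: g)
  ultimately show ?thesis by (simp add: v_def)
qed

text \<open>The mirror image of \<open>strip_begin\<close>: the following side \<open>v\<close>
  meets the strip at abscissa 1, the middle of its first arc.\<close>

lemma strip_end:
  assumes w: "w \<in> units" and S: "{2 * of_int (len w) - 2..} \<subseteq> S"
  shows "pushed (- (\<i> * w)) ` strip w (covered (arc w) \<inter> S) =
    strip w (covered (arc w) \<inter> S \<inter> {..2 * of_int (len w) - 1})"
proof -
  define v where "v = - (\<i> * w)"
  define K where "K = len w"
  have v: "v \<in> units" "v \<noteq> 0" using units_closed w units_nonzero unfolding v_def by blast+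
  have iv: "\<i> * v = w" by (simp add: v_def)
  have corner: "arc v 0 \<longleftrightarrow> arc w (K - 1)" using arc_corner[OF v(1)] by (simp add: iv K_def)
  \<comment> \<open>The map from \<open>strip_begin\<close>, applied to the distance
    \<open>2 * of_int K - x\<close> from the end.\<close>
  define g where "g x = (if arc v 0 then min x (x / 3 + 4 / 3 * of_int K - 1) else x)" for x :: real
  have far: "x \<le> 2 * of_int K - 2" if x: "x \<in> covered (arc w)" and "\<not> arc v 0" for x
  proof (rule ccontr)
    assume n: "\<not> ?thesis"
    have "x \<le> 2 * of_int K" using covered_arc_range[OF w x] by (simp add: K_def)
    then have "x = 2 * of_int K \<or> (2 * of_int (K - 1) < x \<and> x < 2 * of_int (K - 1) + 2)" using n by auto
    then show False using uncovered[of "arc w" "K - 1" x] that corner covered_point[of x "arc w" K]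
        arc_range(2)[OF w, of K] by (auto simp: K_def)
  qed
  have g: "push (origin v) v (arc v) (origin w + w * Complex x (- 1)) = origin w + w * Complex (g x) (- 1)"
    if x: "x \<in> covered (arc w)" for x
  proof -
    have e: "origin w + w * Complex y (- 1) = origin v + v * Complex 1 (y - 2 * of_int K)" for y
      unfolding origin_turn(2)[OF w, folded v_def] K_def by (simp add: v_def Complex_eq algebra_simps)
    have x0: "x \<le> 2 * of_int K" using covered_arc_range[OF w x] by (simp add: K_def)
    show ?thesis
    proof (cases "arc v 0")
      case True
      have "\<not> arc v (- 1)" using arc_range[OF v(1), of "- 1"] by auto
      then have "profile (arc v) 1 = 1"
        using profile_up[of "arc v" 0 1] True by (simp add: ramp_def)
      then show ?thesis unfolding e push_def shear_at_frame[OF v(2)] using True x0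
        by (simp add: shear_def g_def max_def min_def diff_divide_distrib add_divide_distrib)
    next
      case False
      then show ?thesis unfolding e using far[OF x]
        by (subst push_fixed_deep[OF v(2)]) (auto simp: g_def)
    qed
  qed
  have "g ` (covered (arc w) \<inter> S) = covered (arc w) \<inter> S \<inter> {..2 * of_int K - 1}"
  proof (cases "arc v 0")
    case True
    have sub: "{2 * of_int K - 2..2 * of_int K} \<subseteq> covered (arc w)"
      using True unfolding corner covered_def by (intro subsetI UN_I[of "K - 1"]) auto
    show ?thesis
    proof (intro equalityI subsetI)
      fix y assume "y \<in> g ` (covered (arc w) \<inter> S)"
      then obtain x where x: "x \<in> covered (arc w)" "x \<in> S" "y = g x" by blast
      have x0: "x \<le> 2 * of_int K" using covered_arc_range[OF w x(1)] by (simp add: K_def)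
      show "y \<in> covered (arc w) \<inter> S \<inter> {..2 * of_int K - 1}"
      proof (cases "x \<ge> 2 * of_int K - 3 / 2")
        case True
        then have "y \<le> 2 * of_int K - 1" "2 * of_int K - 3 / 2 \<le> y"
          using x0 \<open>arc v 0\<close> x(3) by (auto simp: g_def min_def)
        then show ?thesis using sub S by (auto simp: K_def)
      next
        case False
        then have "y = x" using \<open>arc v 0\<close> x(3) by (simp add: g_def)
        then show ?thesis using x False by simp
      qed
    next
      fix y assume y: "y \<in> covered (arc w) \<inter> S \<inter> {..2 * of_int K - 1}"
      show "y \<in> g ` (covered (arc w) \<inter> S)"
      proof (cases "y \<ge> 2 * of_int K - 3 / 2")
        case True
        define x where "x = 3 * (y + 1 - 2 * of_int K) + 2 * of_int K"
        have "x / 3 + 4 / 3 * of_int K - 1 = y" "y \<le> x" using True by (simp_all add: x_def field_simps)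
        then have "g x = y" using \<open>arc v 0\<close> by (simp add: g_def)
        moreover have "2 * of_int K - 2 \<le> x" "x \<le> 2 * of_int K" using True y by (simp_all add: x_def)
        then have "x \<in> covered (arc w) \<inter> S" using sub S by (auto simp: K_def)
        ultimately show ?thesis by (metis image_eqI)
      next
        case False
        then have "g y = y" by (simp add: g_def)
        then show ?thesis using y by (metis IntD1 image_eqI)
      qed
    qed
  next
    case False
    then show ?thesis using far[OF _ False] by (force simp: g_def)
  qed
  moreover have "pushed v ` strip w (covered (arc w) \<inter> S) = strip w (g ` (covered (arc w) \<inter> S))"
    unfolding strip_def row_graph_def image_image pushed_def plane_map_def by (intro image_cong refl) (simp add: g)
  ultimately show ?thesis by (simp add: v_def K_def)
qed

section \<open>Cutting off the turns at the corners\<close>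

definition frame :: "complex \<Rightarrow> complex set \<Rightarrow> space set" where
  "frame w X = (\<lambda>z. (origin w + w * z, 0)) ` X"

text \<open>The first and the last arc of a side are left out: where present, each has lost one half
  to a push and takes part in a corner.\<close>

definition core :: "complex \<Rightarrow> space set" where
  "core w = strip w (covered (\<lambda>i. arc w i \<and> 1 \<le> i \<and> i \<le> len w - 2))"

text \<open>The two legs of the right angle at the corner between the sides \<open>\<i> * w\<close> and \<open>w\<close>.\<close>

definition corner_path :: "complex \<Rightarrow> space set" where
  "corner_path w = (if arc w 0 then frame w ((\<lambda>x. Complex x (- 1)) ` {1..2} \<union> (\<lambda>y. Complex 1 (- y)) ` {1..2}) else {})"

definition corner_arc :: "complex \<Rightarrow> space set" where
  "corner_arc w = (if arc w 0 then strand_curve 1 (origin w + w * (1 - \<i>)) (w, - (\<i> * w), 0) else {})"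

lemma covered_core:
  assumes w: "w \<in> units"
  shows "covered (arc w) \<inter> {1..2 * of_int (len w) - 1} =
    covered (\<lambda>i. arc w i \<and> 1 \<le> i \<and> i \<le> len w - 2) \<union> (if arc w 0 then {1..2} else {}) \<union>
    (if arc w (len w - 1) then {2 * of_int (len w) - 2..2 * of_int (len w) - 1} else {})" (is "?A = ?B")
proof (intro equalityI subsetI)
  fix x assume "x \<in> ?A"
  then obtain i where i: "arc w i" "2 * of_int i \<le> x" "x \<le> 2 * of_int i + 2"
    and x: "1 \<le> x" "x \<le> 2 * of_int (len w) - 1" by (auto simp: covered_def)
  have r: "0 \<le> i" "i < len w" using arc_range[OF w i(1)] .
  then consider "i = 0" | "i = len w - 1" | "1 \<le> i" "i \<le> len w - 2" by linarith
  then show "x \<in> ?B"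
  proof cases
    case 3
    then have "x \<in> covered (\<lambda>i. arc w i \<and> 1 \<le> i \<and> i \<le> len w - 2)"
      using i unfolding covered_def by (intro UN_I[of i]) auto
    then show ?thesis by blast
  qed (use i x in auto)
next
  fix x assume "x \<in> ?B"
  then consider i where "arc w i" "1 \<le> i" "i \<le> len w - 2" "2 * of_int i \<le> x" "x \<le> 2 * of_int i + 2"
    | "arc w 0" "1 \<le> x" "x \<le> 2"
    | "arc w (len w - 1)" "2 * of_int (len w) - 2 \<le> x" "x \<le> 2 * of_int (len w) - 1"
    by (auto simp: covered_def split: if_splits)
  then show "x \<in> ?A"
  proof cases
    case 1
    have "real_of_int 1 \<le> of_int i" "real_of_int i \<le> of_int (len w - 2)"
      using 1 by (simp_all only: of_int_le_iff)
    then have "1 \<le> x" "x \<le> 2 * of_int (len w) - 1" using 1 by simp_all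
    moreover have "x \<in> covered (arc w)" using 1 unfolding covered_def by (intro UN_I[of i]) auto
    ultimately show ?thesis by simp
  next
    case 2
    moreover have "x \<in> covered (arc w)" using 2 unfolding covered_def by (intro UN_I[of 0]) auto
    ultimately show ?thesis using len_ge_2_real[of w] by simp
  next
    case 3
    moreover have "x \<in> covered (arc w)" using 3 unfolding covered_def by (intro UN_I[of "len w - 1"]) auto
    ultimately show ?thesis using len_ge_2_real[of w] by simp
  qed
qed

text \<open>What is left of the first arc is a leg of the corner of \<open>w\<close>; what is left
  of the last arc is a leg of the corner of the following side.\<close>

lemma strip_decomposition:
  assumes w: "w \<in> units"
  shows "strip w (covered (arc w) \<inter> {1..2 * of_int (len w) - 1}) =
    core w \<union> (if arc w 0 then frame w ((\<lambda>x. Complex x (- 1)) ` {1..2}) else {}) \<union>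
    (if arc (- (\<i> * w)) 0 then frame (- (\<i> * w)) ((\<lambda>y. Complex 1 (- y)) ` {1..2}) else {})"
proof -
  define v where "v = - (\<i> * w)"
  have v: "v \<in> units" using units_closed w unfolding v_def by blast
  have corner: "arc v 0 \<longleftrightarrow> arc w (len w - 1)" using arc_corner[OF v] by (simp add: v_def)
  have "{1..2::real} = (\<lambda>x. 2 * of_int (len w) - x) ` {2 * of_int (len w) - 2..2 * of_int (len w) - 1}"
    by simp
  then have "frame v ((\<lambda>y. Complex 1 (- y)) ` {1..2}) = strip w {2 * of_int (len w) - 2..2 * of_int (len w) - 1}"
    unfolding frame_def strip_def row_graph_def origin_turn(2)[OF w, folded v_def]
    by (simp only: image_image) (intro image_cong refl, simp add: v_def Complex_eq algebra_simps)
  moreover have "frame w ((\<lambda>x. Complex x (- 1)) ` {1..2}) = strip w {1..2}"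
    by (simp add: frame_def strip_def row_graph_def image_image)
  moreover have "strip w (A \<union> B) = strip w A \<union> strip w B" "strip w {} = {}" for A B
    by (auto simp: strip_def row_graph_def)
  ultimately show ?thesis unfolding covered_core[OF w] v_def[symmetric] corner core_def by simp
qed

text \<open>
  The kite halves the distance of the right angle from its chord; the middle point of an arc on a corner
  tile is halfway between the centre and the chord.
\<close>

definition kite :: "complex \<Rightarrow> space \<Rightarrow> space" where
  "kite w = plane_map (shear_at (origin w + w * (3 / 2 - 3 / 2 * \<i>)) (w * ((1 + \<i>) / 2))
    (\<lambda>x. max 0 ((1 - \<bar>x\<bar>) / 2)) (1 / 2) (\<lambda>_. 0))"

lemma kite_nonzero: "w \<in> units \<Longrightarrow> w * ((1 + \<i>) / 2) \<noteq> 0"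
  using units_nonzero by (auto simp: complex_eq_iff)

lemma isotopic_kite: "w \<in> units \<Longrightarrow> isotopic A (kite w ` A)"
  unfolding kite_def
  by (rule isotopic_shear_at[OF kite_nonzero, where C = 1]) (auto intro!: continuous_intros)

text \<open>The frame of the shear has its origin in the middle of the chord from
  \<open>2 - \<i>\<close> to \<open>1 - 2 * \<i>\<close>, the ends of the chord at 1 and
  \<open>- 1\<close>, and the apex \<open>1 - \<i>\<close> of the right angle at
  \<open>\<i>\<close>. There the right angle is the graph of \<open>1 - \<bar>x\<bar>\<close>, which
  the shear lowers to half its height.\<close>

lemma kite_frame:
  assumes w: "w \<in> units"
  shows "kite w (origin w + w * z, h) = (origin w + w * (3 / 2 - 3 / 2 * \<i> + (1 + \<i>) / 2 *
    shear (\<lambda>x. max 0 ((1 - \<bar>x\<bar>) / 2)) (1 / 2) (\<lambda>_. 0) (Complex (Re z + Im z) (Im z - Re z + 3))), h)"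
proof -
  have "z - (3 / 2 - 3 / 2 * \<i>) = (1 + \<i>) / 2 * Complex (Re z + Im z) (Im z - Re z + 3)"
    by (simp add: complex_eq_iff field_simps)
  then have "w * (z - (3 / 2 - 3 / 2 * \<i>)) =
      w * ((1 + \<i>) / 2) * Complex (Re z + Im z) (Im z - Re z + 3)"
    by (simp only: mult.assoc)
  then have "w * z - w * (3 / 2 - 3 / 2 * \<i>) = w * ((1 + \<i>) / 2) * Complex (Re z + Im z) (Im z - Re z + 3)"
    by (simp only: right_diff_distrib[of w z])
  then have "w * z = w * (3 / 2 - 3 / 2 * \<i>) + w * ((1 + \<i>) / 2) * Complex (Re z + Im z) (Im z - Re z + 3)"
    by (metis add.commute diff_add_cancel)
  then have "origin w + w * z = origin w + w * (3 / 2 - 3 / 2 * \<i>) +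
      w * ((1 + \<i>) / 2) * Complex (Re z + Im z) (Im z - Re z + 3)"
    by (metis add.assoc)
  then show ?thesis
    unfolding kite_def plane_map_def
    by (simp only: fst_conv snd_conv shear_at_frame[OF kite_nonzero[OF w]]) (simp add: distrib_left mult.assoc)
qed

text \<open>The condition describes the half-plane on the inner side of the chord. The later lemmas
  place all other parts of the curve there.\<close>

lemma kite_fixed:
  assumes w: "w \<in> units" and z: "Im z - Re z + 3 \<le> 0"
  shows "kite w (origin w + w * z, h) = (origin w + w * z, h)"
proof -
  have "3 / 2 - 3 / 2 * \<i> + (1 + \<i>) / 2 * Complex (Re z + Im z) (Im z - Re z + 3) = z"
    by (simp add: complex_eq_iff field_simps)
  then show ?thesis unfolding kite_frame[OF w] using z by (subst shear_below) auto
qed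

lemma kite_corner_path:
  assumes w: "w \<in> units"
  shows "kite w ` corner_path w = corner_arc w"
proof (cases "arc w 0")
  case True
  let ?F = "\<lambda>z. (origin w + w * z, 0::real)"
  \<comment> \<open>The apex goes to \<open>5 / 4 - 5 / 4 * \<i>\<close>, so the legs become
    segments of slopes \<open>1 / 3\<close> and 3, those of the turn in the tile centred at
    \<open>1 - \<i>\<close>.\<close>
  have a: "kite w (?F (Complex x (- 1))) = ?F (Complex (3 / 4 * x + 1 / 2) (1 / 3 * (3 / 4 * x + 1 / 2) + - (5 / 3)))"
    if "x \<in> {1..2}" for x
    unfolding kite_frame[OF w] using that by (simp add: shear_def complex_eq_iff) (simp add: field_simps)
  have b: "kite w (?F (Complex 1 (- y))) = ?F (Complex (- 1 / 4 * y + 3 / 2) (3 * (- 1 / 4 * y + 3 / 2) + - 5))"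
    if "y \<in> {1..2}" for y
    unfolding kite_frame[OF w] using that by (simp add: shear_def complex_eq_iff) (simp add: field_simps)
  have "kite w ` corner_path w =
      (\<lambda>x. ?F (Complex (3 / 4 * x + 1 / 2) (1 / 3 * (3 / 4 * x + 1 / 2) + - (5 / 3)))) ` {1..2} \<union>
      (\<lambda>y. ?F (Complex (- 1 / 4 * y + 3 / 2) (3 * (- 1 / 4 * y + 3 / 2) + - 5))) ` {1..2}"
    unfolding corner_path_def frame_def using True
    by (simp only: if_True image_Un image_image)
      (intro arg_cong2[where f = "(\<union>)"] image_cong refl a b)
  also have "\<dots> = (\<lambda>x. ?F (Complex x (1 / 3 * x + - (5 / 3)))) ` ((\<lambda>x. 3 / 4 * x + 1 / 2) ` {1..2}) \<union>
      (\<lambda>x. ?F (Complex x (3 * x + - 5))) ` ((\<lambda>y. - 1 / 4 * y + 3 / 2) ` {1..2})"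
    by (simp only: image_image)
  also have "(\<lambda>x. 3 / 4 * x + 1 / 2) ` {1..2::real} = {5 / 4..2}"
    by (simp only: image_affinity_atLeastAtMost) simp
  also have "(\<lambda>y. - 1 / 4 * y + 3 / 2) ` {1..2::real} = {1..5 / 4}"
    by (simp only: image_affinity_atLeastAtMost) simp
  also have "(\<lambda>x. ?F (Complex x (1 / 3 * x + - (5 / 3)))) ` {5 / 4..2} \<union> (\<lambda>x. ?F (Complex x (3 * x + - 5))) ` {1..5 / 4} =
      plane_map (\<lambda>z. origin w + w * z) `
        ((\<lambda>x. (Complex x (1 / 3 * x + - (5 / 3)), 0)) ` {5 / 4..2} \<union> (\<lambda>x. (Complex x (3 * x + - 5), 0)) ` {1..5 / 4})"
    by (simp only: image_image image_Un plane_map_def fst_conv snd_conv)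
  also have "\<dots> = plane_map (\<lambda>z. origin w + w * z) ` strand_curve 1 (1 - \<i>) (1, - \<i>, 0)"
    by (subst (1 2) closed_segment_graph[symmetric])
      (simp_all add: strand_curve_def closed_segment_commute Complex_eq field_simps)
  also have "\<dots> = corner_arc w"
  proof -
    let ?S = "strand_curve 1 0 (1, - \<i>, 0)" and ?c = "origin w + w * (1 - \<i>)"
    have "corner_arc w = strand_curve 1 ?c (w * 1, w * (- \<i>), 0)"
      using True by (simp add: corner_arc_def mult.commute)
    also have "\<dots> = plane_map (\<lambda>z. ?c + 1 * z) ` strand_curve 1 0 (w * 1, w * (- \<i>), 0)"
      by (rule strand_curve_plane_map)
    also have "\<dots> = plane_map (\<lambda>z. ?c + 1 * z) ` plane_map (\<lambda>z. w * z) ` ?S"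
      by (simp only: strand_curve_rotate)
    also have "\<dots> = plane_map (\<lambda>z. origin w + w * z) ` plane_map (\<lambda>z. (1 - \<i>) + 1 * z) ` ?S"
      by (simp add: image_image plane_map_def ring_distribs add.assoc)
    also have "\<dots> = plane_map (\<lambda>z. origin w + w * z) ` strand_curve 1 (1 - \<i>) (1, - \<i>, 0)"
      by (simp only: strand_curve_plane_map[of 1 "1 - \<i>", symmetric])
    finally show ?thesis ..
  qed
  finally show ?thesis .
qed (simp add: corner_path_def corner_arc_def)

lemma frame_turn:
  assumes w: "w \<in> units"
  shows "origin (\<i> * w) + \<i> * w * z = origin w + w * (\<i> * (z - 2 * of_int (len (\<i> * w))))"
    "origin (- (\<i> * w)) + - (\<i> * w) * z = origin w + w * (2 * of_int (len w) - \<i> * z)"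
    "origin (- w) + - w * z = origin w + w * (2 * of_int (len w) - 2 * of_int (len (\<i> * w)) * \<i> - z)"
  using origin_turn[OF w] by (simp_all add: algebra_simps)

lemma units_turn: "w \<in> units \<Longrightarrow> u \<in> units \<Longrightarrow> u = w \<or> u = \<i> * w \<or> u = - (\<i> * w) \<or> u = - w"
  by (auto simp: units_def)

text \<open>The boxes at the other corners are beyond the chord because every side has
  \<open>len\<close> at least 2; for the two neighbouring corners this is just enough.\<close>

lemma kite_fixed_box:
  assumes w: "w \<in> units" and u: "u \<in> units" "u \<noteq> w"
    and z: "1 \<le> Re z" "Re z \<le> 2" "- 2 \<le> Im z" "Im z \<le> - 1"
  shows "kite w (origin u + u * z, h) = (origin u + u * z, h)"
proof -
  have l: "real_of_int (len v) \<ge> 2" for v by (rule len_ge_2_real)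
  consider "u = \<i> * w" | "u = - (\<i> * w)" | "u = - w" using units_turn[OF w u(1)] u(2) by blast
  then show ?thesis
  proof cases
    case 1 then show ?thesis using z l[of u] by (simp only: frame_turn[OF w]) (rule kite_fixed[OF w], simp)
  next
    case 2 then show ?thesis using z l[of w] by (simp only: frame_turn[OF w]) (rule kite_fixed[OF w], simp)
  next
    case 3 then show ?thesis using z l[of w] l[of "\<i> * w"] by (simp only: frame_turn[OF w]) (rule kite_fixed[OF w], simp)
  qed
qed

lemma core_range:
  assumes "x \<in> covered (\<lambda>i. arc w i \<and> 1 \<le> i \<and> i \<le> len w - 2)"
  shows "2 \<le> x" "x \<le> 2 * of_int (len w) - 2"
proof -
  obtain i where i: "1 \<le> i" "i \<le> len w - 2" "2 * of_int i \<le> x" "x \<le> 2 * of_int i + 2"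
    using assms by (auto simp: covered_def)
  have "real_of_int 1 \<le> of_int i" "real_of_int i \<le> of_int (len w - 2)"
    using i by (simp_all only: of_int_le_iff)
  then show "2 \<le> x" "x \<le> 2 * of_int (len w) - 2" using i by simp_all
qed

lemma kite_core:
  assumes w: "w \<in> units" and u: "u \<in> units"
  shows "kite w ` core u = core u"
proof -
  have l: "real_of_int (len v) \<ge> 2" for v by (rule len_ge_2_real)
  have "kite w (origin u + u * Complex x (- 1), 0) = (origin u + u * Complex x (- 1), 0)"
    if "x \<in> covered (\<lambda>i. arc u i \<and> 1 \<le> i \<and> i \<le> len u - 2)" for x
  proof -
    note x = core_range[OF that]
    consider "u = w" | "u = \<i> * w" | "u = - (\<i> * w)" | "u = - w" using units_turn[OF w u] by blast
    then show ?thesis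
    proof cases
      case 1 then show ?thesis using x by (simp only:) (rule kite_fixed[OF w], simp)
    next
      case 2 then show ?thesis using x l[of u] by (simp only: frame_turn[OF w]) (rule kite_fixed[OF w], simp)
    next
      case 3 then show ?thesis using x l[of w] by (simp only: frame_turn[OF w]) (rule kite_fixed[OF w], simp)
    next
      case 4 then show ?thesis using x l[of w] l[of "\<i> * w"] by (simp only: frame_turn[OF w] len_simps(1)[OF w]) (rule kite_fixed[OF w], simp)
    qed
  qed
  then show ?thesis unfolding core_def strip_def row_graph_def image_image by simp
qed

lemma corner_path_box:
  assumes "p \<in> corner_path u"
  shows "\<exists>z. p = (origin u + u * z, 0) \<and> 1 \<le> Re z \<and> Re z \<le> 2 \<and> - 2 \<le> Im z \<and> Im z \<le> - 1"
  using assms by (force simp: corner_path_def frame_def split: if_splits)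

lemma corner_arc_box:
  assumes u: "u \<in> units" and p: "p \<in> corner_arc u"
  shows "\<exists>z. p = (origin u + u * z, 0) \<and> 1 \<le> Re z \<and> Re z \<le> 2 \<and> - 2 \<le> Im z \<and> Im z \<le> - 1"
proof -
  obtain q where q: "q \<in> corner_path u" "p = kite u q" using kite_corner_path[OF u] p by blast
  then obtain z where z: "q = (origin u + u * z, 0)"
    "(1 \<le> Re z \<and> Re z \<le> 2 \<and> Im z = - 1) \<or> (- 2 \<le> Im z \<and> Im z \<le> - 1 \<and> Re z = 1)"
    by (force simp: corner_path_def frame_def split: if_splits)
  show ?thesis unfolding q(2) z(1) kite_frame[OF u]
    by (intro exI, intro conjI, rule refl) (use z(2) in \<open>auto simp: shear_def max_def min_def abs_if field_simps\<close>)
qed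

lemma kite_other_corner:
  assumes w: "w \<in> units" and u: "u \<in> units" "u \<noteq> w"
  shows "kite w ` corner_path u = corner_path u" "kite w ` corner_arc u = corner_arc u"
proof -
  have "kite w p = p" if "p \<in> corner_path u \<union> corner_arc u" for p
    using that corner_path_box[of p u] corner_arc_box[OF u(1), of p] kite_fixed_box[OF w u] by blast
  then show "kite w ` corner_path u = corner_path u" "kite w ` corner_arc u = corner_arc u"
    by force+
qed

lemma kite_rect:
  assumes w: "w \<in> units" and I: "\<And>i. i \<in> I \<Longrightarrow> i \<ge> 1" and D: "\<And>d. d \<in> D \<Longrightarrow> d \<ge> 1"
  shows "kite w ` rect w I D = rect w I D"
proof -
  have "kite w p = p" if id: "i \<in> I" "d \<in> D" and p: "p \<in> tile_at (pos w i d) (cell w i d)" for i d p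
  proof -
    obtain z h where z: "(z, h) \<in> tile_curve (cell w i d)" "p = (pos w i d + z, h)"
      using p by (auto simp: tile_at_def plane_map_def)
    define y where "y = z / w"
    have w0: "w \<noteq> 0" using w units_nonzero by blast
    have "\<bar>Re z\<bar> + \<bar>Im z\<bar> \<le> 1" using tile_curve_cone[OF z(1) w] by simp
    then have y: "\<bar>Re y\<bar> + \<bar>Im y\<bar> \<le> 1" using w by (auto simp: y_def units_def)
    have "real_of_int i \<ge> 1" "real_of_int d \<ge> 1" using I[OF id(1)] D[OF id(2)] by simp_all
    then have "Im (2 * of_int i - 2 * of_int d * \<i> + y) - Re (2 * of_int i - 2 * of_int d * \<i> + y) + 3 \<le> 0"
      using y by simp
    moreover have "p = (origin w + w * (2 * of_int i - 2 * of_int d * \<i> + y), h)"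
      using z w0 by (simp add: pos_def y_def distrib_left)
    ultimately show ?thesis using kite_fixed[OF w] by simp
  qed
  then have "kite w p = p" if "p \<in> rect w I D" for p using that unfolding rect_def by blast
  then show ?thesis by force
qed

section \<open>The whole border pushed in\<close>

definition inner :: "space set" where
  "inner = rect 1 {1..M - 1} {1..N - 1}"

lemma image_minus_Icc: "(\<lambda>i. c - i) ` {a..b} = {c - b..c - a}" for a b c :: int
  by (simp add: image_diff_atLeastAtMost)

lemma inner_eq: "w \<in> units \<Longrightarrow> inner = rect w {1..len w - 1} {1..len (\<i> * w) - 1}"
proof -
  have 1: "(1::complex) \<in> units" by (simp add: units_def)
  have "inner = rect (- 1) {1..M - 1} {1..N - 1}" "inner = rect \<i> {1..N - 1} {1..M - 1}"
    "inner = rect (- \<i>) {1..N - 1} {1..M - 1}"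
    using rect_turn[OF 1] by (simp_all add: inner_def image_minus_Icc)
  then show "w \<in> units \<Longrightarrow> ?thesis" by (auto simp: units_def len_def inner_def)
qed

lemma kite_inner: "w \<in> units \<Longrightarrow> kite w ` inner = inner"
  using kite_rect[of w "{1..len w - 1}" "{1..len (\<i> * w) - 1}"] inner_eq[of w] by simp

text \<open>\<open>U\<close> records the corners that have already been cut off.\<close>

definition cut :: "complex set \<Rightarrow> space set" where
  "cut U = inner \<union> (\<Union>w\<in>units. core w) \<union> (\<Union>w\<in>units. if w \<in> U then corner_arc w else corner_path w)"

lemma isotopic_cut:
  assumes w: "w \<in> units" "w \<notin> U"
  shows "isotopic (cut U) (cut (insert w U))"
proof -
  have "kite w ` (if u \<in> U then corner_arc u else corner_path u) =
      (if u \<in> insert w U then corner_arc u else corner_path u)" if "u \<in> units" for u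
    using w kite_corner_path[OF w(1)] kite_other_corner[OF w(1) that] by (cases "u = w") auto
  then have "(\<Union>u\<in>units. kite w ` (if u \<in> U then corner_arc u else corner_path u)) =
      (\<Union>u\<in>units. if u \<in> insert w U then corner_arc u else corner_path u)" by (rule SUP_cong[OF refl])
  then have "kite w ` cut U = cut (insert w U)"
    unfolding cut_def image_Un image_UN by (simp only: kite_inner[OF w(1)] kite_core[OF w(1)] cong: SUP_cong)
  then show ?thesis using isotopic_kite[OF w(1), of "cut U"] by simp
qed

text \<open>The four sides are pushed in the order top, bottom, left, right, and then the corners are cut.\<close>

lemma isotopic_pushed_in:
  "isotopic (rect 1 {0..M} {0..N}) (inner \<union> (\<Union>w\<in>units. core w) \<union> (\<Union>w\<in>units. corner_arc w))"
proof -
  have u: "1 \<in> units" "- 1 \<in> units" "\<i> \<in> units" "- \<i> \<in> units" by (auto simp: units_def)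
  have l: "len 1 = M" "len (- 1) = M" "len \<i> = N" "len (- \<i>) = N" by (auto simp: len_def)
  have ii: "\<i> * \<i> = - 1" "\<i> * - \<i> = 1" "\<i> * - 1 = - \<i>" by simp_all
  let ?c = "\<lambda>w. covered (arc w)"
  \<comment> \<open>Top and bottom keep the corner tiles; left and right are restricted to the rows
    strictly between. With \<open>inner\<close>, the four pieces make up the grid.\<close>
  define T B L R where "T = border 1 (?c 1)" and "B = border (- 1) (?c (- 1))"
    and "L = border \<i> (?c \<i> \<inter> {1..2 * of_int N - 1})" and "R = border (- \<i>) (?c (- \<i>) \<inter> {1..2 * of_int N - 1})"
  have full: "?c w \<inter> {- 1..2 * of_int (len w) + 1} = ?c w" if "w \<in> units" for w
    using covered_arc_range[OF that] by force
  have T: "rect 1 {0..M} {0} = T"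
    using rect_row[OF u(1), of 0 M] full[OF u(1)] wide by (simp add: T_def l)
  have B': "rect (- 1) {0..M} {0} = B"
    using rect_row[OF u(2), of 0 M] full[OF u(2)] wide by (simp add: B_def l)
  have B: "rect 1 {0..M} {N} = B"
    using rect_turn(3)[OF u(1), of "{0..M}" "{0}"] B' by (simp add: image_minus_Icc l)
  have L': "rect \<i> {1..N - 1} {0} = L"
    using rect_row[OF u(3), of 1 "N - 1"] wide by (simp add: L_def l)
  have R': "rect (- \<i>) {1..N - 1} {0} = R"
    using rect_row[OF u(4), of 1 "N - 1"] wide by (simp add: R_def l)
  have L1: "rect 1 {0} {1..N - 1} = L" "rect (- 1) {M} {1..N - 1} = L" "rect (- \<i>) {1..N - 1} {M} = L"
    using rect_turn(1)[OF u(1), of "{1..N - 1}" "{0}"] rect_turn(3)[OF u(1), of "{M}" "{1..N - 1}"]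
      rect_turn(3)[OF u(3), of "{1..N - 1}" "{M}"]
    by (simp_all add: L'[symmetric] image_minus_Icc l)
  have R1: "rect 1 {M} {1..N - 1} = R" "rect (- 1) {0} {1..N - 1} = R" "rect \<i> {1..N - 1} {M} = R"
    using rect_turn(2)[OF u(1), of "{1..N - 1}" "{0}"] rect_turn(3)[OF u(1), of "{0}" "{1..N - 1}"]
      rect_turn(3)[OF u(4), of "{1..N - 1}" "{M}"]
    by (simp_all add: R'[symmetric] image_minus_Icc l)
  have "rect 1 {0..M} {0..N} = T \<union> B \<union> L \<union> R \<union> inner"
  proof -
    have "{0..M} = {0} \<union> {1..M - 1} \<union> {M}" "{0..N} = {0} \<union> {1..N - 1} \<union> {N}" using wide by auto
    then have "rect 1 {0..M} {1..N - 1} = L \<union> inner \<union> R"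
      "rect 1 {0..M} {0..N} = T \<union> rect 1 {0..M} {1..N - 1} \<union> B"
      unfolding T[symmetric] B[symmetric] L1(1)[symmetric] R1(1)[symmetric] inner_def
      by (metis rect_Un)+
    then show ?thesis by (simp add: Un_ac)
  qed
  \<comment> \<open>Seen from the top, all other pieces lie at depth 1 or more and are fixed,
    although some of their strands are attached to the caps that move.\<close>
  also have "isotopic (T \<union> B \<union> L \<union> R \<union> inner) (strip 1 (?c 1) \<union> B \<union> L \<union> R \<union> inner)"
  proof -
    have "pushed 1 ` B = B" "pushed 1 ` L = L" "pushed 1 ` R = R" "pushed 1 ` inner = inner"
      unfolding B[symmetric] L1(1)[symmetric] R1(1)[symmetric] inner_def
      by (rule pushed_rect[OF u(1)]; use wide in auto)+
    then show ?thesis using isotopic_pushed[OF u(1), of "T \<union> B \<union> L \<union> R \<union> inner"]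
      by (simp add: image_Un T_def pushed_border[OF u(1)])
  qed
  also have "isotopic \<dots> (strip 1 (?c 1) \<union> strip (- 1) (?c (- 1)) \<union> L \<union> R \<union> inner)"
  proof -
    have "pushed (- 1) ` L = L" "pushed (- 1) ` R = R" "pushed (- 1) ` inner = inner"
      unfolding L1(2)[symmetric] R1(2)[symmetric] inner_eq[OF u(2)]
      by (rule pushed_rect[OF u(2)]; use wide in auto)+
    then show ?thesis
      using isotopic_pushed[OF u(2), of "strip 1 (?c 1) \<union> B \<union> L \<union> R \<union> inner"] strip_far[OF u(1)]
      by (simp add: image_Un B_def pushed_border[OF u(2)])
  qed
  \<comment> \<open>Now there are strips that meet the pushed side at a right angle: the left push
    retracts the beginning of the top one and the end of the bottom one.\<close>
  also have "isotopic \<dots> (strip 1 (?c 1 \<inter> {1..}) \<union> strip (- 1) (?c (- 1) \<inter> {..2 * of_int M - 1}) \<union>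
      strip \<i> (?c \<i> \<inter> {1..2 * of_int N - 1}) \<union> R \<union> inner)"
  proof -
    have "pushed \<i> ` R = R" "pushed \<i> ` inner = inner"
      unfolding R1(3)[symmetric] inner_eq[OF u(3)]
      by (rule pushed_rect[OF u(3)]; use wide in auto)+
    moreover have "pushed \<i> ` strip 1 (?c 1) = strip 1 (?c 1 \<inter> {1..})"
      using strip_begin[OF u(1), of UNIV] by simp
    moreover have "pushed \<i> ` strip (- 1) (?c (- 1)) = strip (- 1) (?c (- 1) \<inter> {..2 * of_int M - 1})"
      using strip_end[OF u(2), of UNIV] by (simp add: l)
    ultimately show ?thesis
      using isotopic_pushed[OF u(3), of "strip 1 (?c 1) \<union> strip (- 1) (?c (- 1)) \<union> L \<union> R \<union> inner"]
      by (simp add: image_Un L_def pushed_border[OF u(3)])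
  qed
  also have "isotopic \<dots> (strip 1 (?c 1 \<inter> {1..2 * of_int M - 1}) \<union> strip (- 1) (?c (- 1) \<inter> {1..2 * of_int M - 1}) \<union>
      strip \<i> (?c \<i> \<inter> {1..2 * of_int N - 1}) \<union> strip (- \<i>) (?c (- \<i>) \<inter> {1..2 * of_int N - 1}) \<union> inner)"
  proof -
    have M2: "real_of_int M \<ge> 2" using wide by simp
    have c: "{1..} \<inter> {..2 * of_int M - 1} = {1..2 * real_of_int M - 1}"
      "{..2 * of_int M - 1} \<inter> {1..} = {1..2 * real_of_int M - 1}" by auto
    have "pushed (- \<i>) ` inner = inner"
      unfolding inner_eq[OF u(4)] by (rule pushed_rect[OF u(4)]; use wide in auto)+
    moreover have "pushed (- \<i>) ` strip 1 (?c 1 \<inter> {1..}) = strip 1 (?c 1 \<inter> {1..2 * of_int M - 1})"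
      using strip_end[OF u(1), of "{1..}"] M2 by (simp add: l Int_assoc c)
    moreover have "pushed (- \<i>) ` strip (- 1) (?c (- 1) \<inter> {..2 * of_int M - 1}) =
        strip (- 1) (?c (- 1) \<inter> {1..2 * of_int M - 1})"
      using strip_begin[OF u(2), of "{..2 * of_int M - 1}"] M2 by (simp add: l Int_assoc c)
    ultimately show ?thesis
      using isotopic_pushed[OF u(4), of "strip 1 (?c 1 \<inter> {1..}) \<union> strip (- 1) (?c (- 1) \<inter> {..2 * of_int M - 1}) \<union>
      strip \<i> (?c \<i> \<inter> {1..2 * of_int N - 1}) \<union> R \<union> inner"] strip_far[OF u(3)]
      by (simp add: image_Un R_def pushed_border[OF u(4)])
  qed
  \<comment> \<open>Every strip, now retracted at both ends, splits into its core and two possible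
    legs; the legs are regrouped by corners.\<close>
  also have "\<dots> = cut {}"
    using strip_decomposition[OF u(1)] strip_decomposition[OF u(2)] strip_decomposition[OF u(3)]
      strip_decomposition[OF u(4)]
    by (simp add: l ii cut_def units_def corner_path_def frame_def image_Un) blast
  also have "isotopic \<dots> (cut {1})" using isotopic_cut[of 1 "{}"] u by simp
  also have "isotopic \<dots> (cut {1, - 1})" using isotopic_cut[of "- 1" "{1}"] u by (simp add: insert_commute)
  also have "isotopic \<dots> (cut {1, - 1, \<i>})" using isotopic_cut[of \<i> "{1, - 1}"] u by (simp add: insert_commute)
  also have "isotopic \<dots> (cut units)" using isotopic_cut[of "- \<i>" "{1, - 1, \<i>}"] u
    by (simp add: insert_commute units_def)
  also have "cut units = inner \<union> (\<Union>w\<in>units. core w) \<union> (\<Union>w\<in>units. corner_arc w)"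
    by (auto simp: cut_def)
  finally show ?thesis .
qed

end

section \<open>The corner mosaic\<close>

definition turn_tile :: "complex \<Rightarrow> tile" where
  "turn_tile w = (if w = 1 then T2 else if w = \<i> then T3 else if w = - 1 then T4 else T1)"

definition straight_tile :: "complex \<Rightarrow> tile" where
  "straight_tile w = (if w = 1 \<or> w = - 1 then T5 else T6)"

lemma tile_curve_turn: "w \<in> units \<Longrightarrow> tile_curve (turn_tile w) = strand_curve 1 0 (w, - (\<i> * w), 0)"
  by (auto simp: units_def turn_tile_def tile_curve_def strand_curve_commute)

lemma tile_curve_straight: "w \<in> units \<Longrightarrow> tile_curve (straight_tile w) = strand_curve 1 0 (w * 1, w * (- 1), 0)"
  by (auto simp: units_def straight_tile_def tile_curve_def strand_curve_commute)

lemma tile_at_T0 [simp]: "tile_at c T0 = {}"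
  by (simp add: tile_at_def tile_curve_def)

lemma card_units: "card {d \<in> units. P d} = of_bool (P 1) + of_bool (P (- 1)) + of_bool (P \<i>) + of_bool (P (- \<i>))"
proof -
  have "finite units" by (simp add: units_def)
  from sum.inter_filter[OF this, of "\<lambda>_. 1 :: nat" P]
  have "card {d \<in> units. P d} = (\<Sum>d\<in>units. of_bool (P d))" by (simp add: of_bool_def)
  then show ?thesis unfolding units_def by (simp del: sum_of_bool_eq)
qed

lemma strand_unique:
  "s \<in> strands t \<Longrightarrow> s' \<in> strands t \<Longrightarrow> d = fst s \<or> d = fst (snd s) \<Longrightarrow> d = fst s' \<or> d = fst (snd s') \<Longrightarrow> s = s'"
  by (cases t; simp only: strands.simps; elim insertE emptyE disjE; simp)

context wide_mosaic
begin

definition inside :: "int \<Rightarrow> int \<Rightarrow> tile" where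
  "inside i j = (if 1 \<le> i \<and> i \<le> M - 1 \<and> 1 \<le> j \<and> j \<le> N - 1 then Z i j else T0)"

text \<open>Index 0 stands for the whole corner between the preceding side and \<open>w\<close>. The
  last arc of the side is absorbed by index 0 of the following side.\<close>

definition pushed_tile :: "complex \<Rightarrow> int \<Rightarrow> tile" where
  "pushed_tile w i = (if \<not> arc w i then T0 else if i = 0 then turn_tile w else straight_tile w)"

text \<open>The tile \<open>dual i j\<close> is centred at the vertex of the edge mosaic between the tiles \<open>(i, j)\<close> and \<open>(i + 1, j + 1)\<close>.\<close>

definition dual :: "int \<Rightarrow> int \<Rightarrow> tile" where
  "dual i j =
    (if j = N - 1 \<and> 0 \<le> i \<and> i \<le> M - 2 then pushed_tile 1 i
     else if i = M - 1 \<and> 1 \<le> j \<and> j \<le> N - 1 then pushed_tile (- \<i>) (N - 1 - j)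
     else if j = 0 \<and> 1 \<le> i \<and> i \<le> M - 1 then pushed_tile (- 1) (M - 1 - i)
     else if i = 0 \<and> 0 \<le> j \<and> j \<le> N - 2 then pushed_tile \<i> j else T0)"

text \<open>The vertex cell into which the push takes the arc \<open>i\<close> of the side
  \<open>w\<close>.\<close>

definition dual_index :: "complex \<Rightarrow> int \<Rightarrow> int \<times> int" where
  "dual_index w i = (if w = 1 then (i, N - 1) else if w = - \<i> then (M - 1, N - 1 - i)
    else if w = - 1 then (M - 1 - i, 0) else (0, i))"

lemma dual_index:
  assumes "w \<in> units" "0 \<le> i" "i \<le> len w - 2"
  shows "case_prod dual (dual_index w i) = pushed_tile w i"
  using assms wide by (auto simp: units_def dual_index_def dual_def len_def)

lemma dual_cases:
  assumes "dual i j \<noteq> T0"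
  obtains w k where "w \<in> units" "0 \<le> k" "k \<le> len w - 2" "(i, j) = dual_index w k" "arc w k"
proof -
  have "\<exists>w\<in>units. \<exists>k. 0 \<le> k \<and> k \<le> len w - 2 \<and> (i, j) = dual_index w k"
  proof -
    consider "j = N - 1 \<and> 0 \<le> i \<and> i \<le> M - 2" | "i = M - 1 \<and> 1 \<le> j \<and> j \<le> N - 1"
      | "j = 0 \<and> 1 \<le> i \<and> i \<le> M - 1" | "i = 0 \<and> 0 \<le> j \<and> j \<le> N - 2"
      using assms unfolding dual_def by (auto split: if_split_asm)
    then show ?thesis
    proof cases
      case 1 then show ?thesis by (intro bexI[of _ 1] exI[of _ i]) (auto simp: dual_index_def len_def units_def)
    next
      case 2 then show ?thesis
        by (intro bexI[of _ "- \<i>"] exI[of _ "N - 1 - j"]) (auto simp: dual_index_def len_def units_def)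
    next
      case 3 then show ?thesis
        by (intro bexI[of _ "- 1"] exI[of _ "M - 1 - i"]) (auto simp: dual_index_def len_def units_def)
    next
      case 4 then show ?thesis by (intro bexI[of _ \<i>] exI[of _ j]) (auto simp: dual_index_def len_def units_def)
    qed
  qed
  then obtain w k where w: "w \<in> units" "0 \<le> k" "k \<le> len w - 2" "(i, j) = dual_index w k" by blast
  have "pushed_tile w k \<noteq> T0" using dual_index[OF w(1-3)] assms w(4) by (metis case_prod_conv)
  then have "arc w k" by (metis pushed_tile_def)
  then show ?thesis using that w by blast
qed

definition dual_centre :: "int \<Rightarrow> int \<Rightarrow> complex" where
  "dual_centre i j = 2 * of_int i + 1 + (2 * of_int j + 1) * \<i>"

lemma dual_centre_index:
  "w \<in> units \<Longrightarrow> case_prod dual_centre (dual_index w i) = origin w + w * (2 * of_int i + 1 - \<i>)"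
  by (auto simp: units_def dual_index_def dual_centre_def origin_def len_def algebra_simps)

lemma strip_tile:
  assumes w: "w \<in> units"
  shows "strip w {2 * of_int i..2 * of_int i + 2} =
    tile_at (origin w + w * (2 * of_int i + 1 - \<i>)) (straight_tile w)"
proof -
  have "{2 * real_of_int i..2 * of_int i + 2} = (\<lambda>x. 2 * of_int i + 1 + x) ` {- 1..1}" by simp
  then have "strip w {2 * of_int i..2 * of_int i + 2} =
      (\<lambda>x. (origin w + w * Complex (2 * of_int i + 1 + x) (- 1), 0)) ` {- 1..1}"
    by (simp only: strip_def row_graph_def image_image)
  also have "\<dots> = plane_map (\<lambda>z. origin w + w * (2 * of_int i + 1 - \<i>) + z) ` plane_map (\<lambda>z. w * z) `
      (\<lambda>x. (Complex x 0, 0)) ` {- 1..1}"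
    unfolding image_image plane_map_def
    by (intro image_cong refl) (simp add: Complex_eq algebra_simps)
  also have "\<dots> = tile_at (origin w + w * (2 * of_int i + 1 - \<i>)) (straight_tile w)"
    unfolding tile_at_def tile_curve_straight[OF w] strand_curve_rotate strand_arc_graph ..
  finally show ?thesis .
qed

lemma corner_arc_tile:
  assumes w: "w \<in> units" "arc w 0"
  shows "corner_arc w = tile_at (origin w + w * (1 - \<i>)) (turn_tile w)"
  using w strand_curve_plane_map[of 1 "origin w + w * (1 - \<i>)"]
  by (simp add: corner_arc_def tile_at_def tile_curve_turn)

lemma pushed_tiles:
  assumes w: "w \<in> units"
  shows "core w \<union> corner_arc w =
    (\<Union>i\<in>{0..len w - 2}. tile_at (origin w + w * (2 * of_int i + 1 - \<i>)) (pushed_tile w i))"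
proof -
  have "core w = (\<Union>i\<in>{i. arc w i \<and> 1 \<le> i \<and> i \<le> len w - 2}. strip w {2 * of_int i..2 * of_int i + 2})"
    by (auto simp: core_def covered_def strip_def row_graph_def)
  also have "\<dots> = (\<Union>i\<in>{1..len w - 2}. tile_at (origin w + w * (2 * of_int i + 1 - \<i>)) (pushed_tile w i))"
    by (auto simp: strip_tile[OF w] pushed_tile_def split: if_splits)
  finally have 1: "core w = (\<Union>i\<in>{1..len w - 2}. tile_at (origin w + w * (2 * of_int i + 1 - \<i>)) (pushed_tile w i))" .
  have 2: "corner_arc w = tile_at (origin w + w * (2 * of_int 0 + 1 - \<i>)) (pushed_tile w 0)"
    using corner_arc_tile[OF w] by (cases "arc w 0") (simp_all add: pushed_tile_def corner_arc_def)
  have "{0..len w - 2} = insert 0 {1..len w - 2}" using len_ge_2[of w] by auto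
  then show ?thesis unfolding 1 2 by (simp only: UN_insert Un_commute)
qed

text \<open>The result of the push, before the multiplication by \<open>1 - \<i>\<close>: edge tiles
  at the lattice points together with tiles of the same orientation at the vertices.\<close>

definition mixed_curve :: "space set" where
  "mixed_curve = (\<Union>i. \<Union>j. tile_at (2 * of_int i + 2 * of_int j * \<i>) (inside i j)) \<union>
    (\<Union>i. \<Union>j. tile_at (dual_centre i j) (dual i j))"

lemma mixed_curve_eq: "mixed_curve = inner \<union> (\<Union>w\<in>units. core w) \<union> (\<Union>w\<in>units. corner_arc w)"
proof -
  have "inner = (\<Union>i\<in>{1..M - 1}. \<Union>j\<in>(\<lambda>d. N - d) ` {1..N - 1}. tile_at (2 * of_int i + 2 * of_int j * \<i>) (Z i j))"
    unfolding inner_def rect_def pos_def cell_def image_image UN_simps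
    by (intro SUP_cong refl) (simp add: origin_def algebra_simps)
  also have "\<dots> = (\<Union>i\<in>{1..M - 1}. \<Union>j\<in>{1..N - 1}. tile_at (2 * of_int i + 2 * of_int j * \<i>) (Z i j))"
    by (simp add: image_minus_Icc)
  also have "\<dots> = (\<Union>i. \<Union>j. tile_at (2 * of_int i + 2 * of_int j * \<i>) (inside i j))"
  proof -
    have "(\<Union>i\<in>I. \<Union>j\<in>J. A i j) = (\<Union>i. \<Union>j. if i \<in> I \<and> j \<in> J then A i j else {})"
      for I J :: "int set" and A :: "int \<Rightarrow> int \<Rightarrow> space set"
    proof (intro equalityI subsetI)
      fix p assume "p \<in> (\<Union>i\<in>I. \<Union>j\<in>J. A i j)"
      then obtain i j where "i \<in> I \<and> j \<in> J" "p \<in> A i j" by blast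
      then have "p \<in> (if i \<in> I \<and> j \<in> J then A i j else {})" by simp
      then show "p \<in> (\<Union>i. \<Union>j. if i \<in> I \<and> j \<in> J then A i j else {})" by blast
    qed (auto split: if_splits)
    then show ?thesis by (simp add: inside_def if_distrib[of "tile_at _"] conj_assoc)
  qed
  finally have 1: "inner = (\<Union>i. \<Union>j. tile_at (2 * of_int i + 2 * of_int j * \<i>) (inside i j))" .
  have "(\<Union>w\<in>units. core w) \<union> (\<Union>w\<in>units. corner_arc w) = (\<Union>w\<in>units. core w \<union> corner_arc w)" by blast
  also have "\<dots> = (\<Union>w\<in>units. \<Union>k\<in>{0..len w - 2}. tile_at (case_prod dual_centre (dual_index w k))
      (case_prod dual (dual_index w k)))"
    by (intro SUP_cong refl) (simp add: pushed_tiles dual_centre_index dual_index)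
  also have "\<dots> = (\<Union>i. \<Union>j. tile_at (dual_centre i j) (dual i j))"
  proof (intro equalityI subsetI)
    fix p assume "p \<in> (\<Union>i. \<Union>j. tile_at (dual_centre i j) (dual i j))"
    then obtain i j where p: "p \<in> tile_at (dual_centre i j) (dual i j)" by blast
    then have "dual i j \<noteq> T0" by auto
    from dual_cases[OF this] obtain w k where w: "w \<in> units" "k \<in> {0..len w - 2}" "(i, j) = dual_index w k"
      by (metis atLeastAtMost_iff)
    have "p \<in> tile_at (case_prod dual_centre (dual_index w k)) (case_prod dual (dual_index w k))"
      using p by (simp flip: w(3))
    then show "p \<in> (\<Union>w\<in>units. \<Union>k\<in>{0..len w - 2}. tile_at (case_prod dual_centre (dual_index w k))
      (case_prod dual (dual_index w k)))" using w(1,2) by blast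
  next
    fix p assume "p \<in> (\<Union>w\<in>units. \<Union>k\<in>{0..len w - 2}. tile_at (case_prod dual_centre (dual_index w k))
      (case_prod dual (dual_index w k)))"
    then obtain w k where "p \<in> tile_at (case_prod dual_centre (dual_index w k)) (case_prod dual (dual_index w k))"
      by blast
    then show "p \<in> (\<Union>i. \<Union>j. tile_at (dual_centre i j) (dual i j))"
      by (cases "dual_index w k") auto
  qed
  finally show ?thesis unfolding mixed_curve_def 1 by (simp only: Un_assoc)
qed

text \<open>The inverse of the passage to the rotated grid. An edge tile \<open>(i, j)\<close> goes
  to \<open>(i + j, j - i)\<close>; a vertex cell \<open>(i, j)\<close>, centred half a tile further
  in both directions, goes to \<open>(i + j + 1, j - i)\<close>. The parity of \<open>p + q\<close>
  tells them apart.\<close>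

definition corner_cell :: "int \<Rightarrow> int \<Rightarrow> tile" where
  "corner_cell p q = (if even (p + q) then inside ((p - q) div 2) ((p + q) div 2)
    else dual ((p - q) div 2) ((p + q) div 2))"

text \<open>The nonempty cells have \<open>p\<close> between 0 and \<open>M + N\<close> and
  \<open>q\<close> between \<open>- M\<close> and \<open>N\<close>, whence this size and the shift
  by \<open>M\<close> in \<open>corner_grid\<close>.\<close>

definition corner_size :: nat where
  "corner_size = nat (M + N + 1)"

definition corner_grid :: grid where
  "corner_grid k l = corner_cell (int k) (int l - M)"

lemma dual_range: "dual i j \<noteq> T0 \<Longrightarrow> 0 \<le> i \<and> i \<le> M - 1 \<and> 0 \<le> j \<and> j \<le> N - 1"
  using wide by (auto simp: dual_def split: if_splits)

lemma corner_cell_even: "corner_cell (i + j) (j - i) = inside i j"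
proof -
  have "i + j - (j - i) = i * 2" "i + j + (j - i) = j * 2" by simp_all
  then show ?thesis by (simp only: corner_cell_def) simp
qed

lemma corner_cell_odd: "corner_cell (i + j + 1) (j - i) = dual i j"
proof -
  have "i + j + 1 - (j - i) = i * 2 + 1" "i + j + 1 + (j - i) = j * 2 + 1" by simp_all
  then show ?thesis by (simp only: corner_cell_def) simp
qed

lemma parity_cases:
  fixes p q :: int
  obtains i j where "p = i + j" "q = j - i" | i j where "p = i + j + 1" "q = j - i"
proof (cases "even (p + q)")
  case True
  then obtain j where "p + q = 2 * j" by blast
  then show ?thesis using that(1)[of "p - j" j] by simp
next
  case False
  then obtain j where "p + q = 2 * j + 1" by (elim oddE)
  then show ?thesis using that(2)[of "p - 1 - j" j] by simp
qed

lemma corner_cell_range: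
  assumes "corner_cell p q \<noteq> T0"
  shows "0 \<le> p" "p < M + N + 1" "0 \<le> q + M" "q + M < M + N + 1"
proof -
  have "0 \<le> p \<and> p < M + N + 1 \<and> 0 \<le> q + M \<and> q + M < M + N + 1"
  proof (rule parity_cases[of p q])
    fix i j assume "p = i + j" "q = j - i"
    then show ?thesis using assms by (auto simp: corner_cell_even inside_def split: if_splits)
  next
    fix i j assume "p = i + j + 1" "q = j - i"
    then show ?thesis using assms dual_range[of i j] by (auto simp: corner_cell_odd)
  qed
  then show "0 \<le> p" "p < M + N + 1" "0 \<le> q + M" "q + M < M + N + 1" by simp_all
qed

lemma corner_curve:
  "mosaic_curve corner_factor corner_size corner_size corner_grid =
    plane_map (\<lambda>z. (1 - \<i>) * z + 2 * of_int M * \<i>) ` mixed_curve"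
proof -
  define f where "f = plane_map (\<lambda>z. (1 - \<i>) * z + 2 * of_int M * \<i>)"
  have s: "plane_map (\<lambda>z. c + (1 - \<i>) * z) ` tile_curve t = f ` tile_at c' t"
    if "c = (1 - \<i>) * c' + 2 * of_int M * \<i>" for c c' t
    unfolding tile_at_def f_def image_image that
    by (intro image_cong refl) (simp add: plane_map_def algebra_simps)
  define g where "g p q = plane_map (\<lambda>z. (2 * of_int p + 2 * of_int (q + M) * \<i>) + (1 - \<i>) * z) ` tile_curve (corner_cell p q)"
    for p q
  have ev: "g (i + j) (j - i) = f ` tile_at (2 * of_int i + 2 * of_int j * \<i>) (inside i j)" for i j
    unfolding g_def corner_cell_even by (rule s) (simp add: algebra_simps)
  have od: "g (i + j + 1) (j - i) = f ` tile_at (dual_centre i j) (dual i j)" for i j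
    unfolding g_def corner_cell_odd by (rule s) (simp add: dual_centre_def algebra_simps)
  have "mosaic_curve corner_factor corner_size corner_size corner_grid =
      (\<Union>k<corner_size. \<Union>l<corner_size. plane_map (\<lambda>z. centre k l + (1 - \<i>) * z) ` tile_curve (corner_grid k l))"
    unfolding mosaic_curve_def tile_curve_def image_UN corner_factor_def
    by (intro SUP_cong refl strand_curve_plane_map)
  also have "\<dots> = (\<Union>k<corner_size. \<Union>l<corner_size. g (int k) (int l - M))"
    by (intro SUP_cong refl) (simp add: g_def corner_grid_def centre_def Complex_eq mult.commute mult.left_commute)
  also have "\<dots> = (\<Union>p. \<Union>q. g p q)"
  proof (intro equalityI subsetI)
    fix x assume "x \<in> (\<Union>p. \<Union>q. g p q)"
    then obtain p q where x: "x \<in> g p q" by blast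
    then have "corner_cell p q \<noteq> T0" by (auto simp: g_def tile_curve_def)
    note r = corner_cell_range[OF this]
    have "nat p < corner_size" "nat (q + M) < corner_size" using r by (auto simp: corner_size_def)
    moreover have "x \<in> g (int (nat p)) (int (nat (q + M)) - M)" using x r by simp
    ultimately show "x \<in> (\<Union>k<corner_size. \<Union>l<corner_size. g (int k) (int l - M))" by blast
  qed blast
  also have "\<dots> = f ` mixed_curve"
  proof (intro equalityI subsetI)
    fix x assume "x \<in> (\<Union>p. \<Union>q. g p q)"
    then obtain p q where x: "x \<in> g p q" by blast
    obtain i j where "p = i + j \<and> q = j - i \<or> p = i + j + 1 \<and> q = j - i"
      using parity_cases[of p q] by metis
    then have "x \<in> f ` tile_at (2 * of_int i + 2 * of_int j * \<i>) (inside i j) \<or>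
        x \<in> f ` tile_at (dual_centre i j) (dual i j)" using x ev od by metis
    then show "x \<in> f ` mixed_curve" unfolding mixed_curve_def by blast
  next
    fix x assume "x \<in> f ` mixed_curve"
    then obtain i j where "x \<in> g (i + j) (j - i) \<or> x \<in> g (i + j + 1) (j - i)"
      unfolding ev od mixed_curve_def image_Un image_UN by blast
    then show "x \<in> (\<Union>p. \<Union>q. g p q)" by blast
  qed
  finally show ?thesis by (simp add: f_def)
qed

section \<open>Ends of strands at the vertices of the rotated grid\<close>

lemma has_end_inside:
  "has_end (inside i j) u \<longleftrightarrow> 1 \<le> i \<and> i \<le> M - 1 \<and> 1 \<le> j \<and> j \<le> N - 1 \<and> has_end (Z i j) u"
  by (auto simp: inside_def)

lemma has_end_pushed:
  "w \<in> units \<Longrightarrow> has_end (pushed_tile w i) u \<longleftrightarrow> arc w i \<and> (u = w \<or> u = (if i = 0 then - (\<i> * w) else - w))"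
  by (auto simp: pushed_tile_def turn_tile_def straight_tile_def units_def has_end_def)

lemma arc_global:
  "arc 1 i \<longleftrightarrow> has_end (Z i N) 1" "arc \<i> i \<longleftrightarrow> has_end (Z 0 i) \<i>"
  "arc (- 1) (M - 1 - i) \<longleftrightarrow> has_end (Z i 0) 1" "arc (- \<i>) (N - 1 - i) \<longleftrightarrow> has_end (Z M i) \<i>"
  using horizontal[of i 0] vertical[of M i] by (auto simp: arc_def cell_def algebra_simps)

lemma arc_corner_global:
  "arc 1 0 \<longleftrightarrow> has_end (Z 0 (N - 1)) \<i>" "arc \<i> 0 \<longleftrightarrow> has_end (Z 0 0) 1"
  "arc (- 1) 0 \<longleftrightarrow> has_end (Z M 0) \<i>" "arc (- \<i>) 0 \<longleftrightarrow> has_end (Z (M - 1) N) 1"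
  using arc_corner[of 1] arc_corner[of \<i>] arc_corner[of "- 1"] arc_corner[of "- \<i>"]
    arc_global(1)[of "M - 1"] arc_global(2)[of "N - 1"] arc_global(3)[of 0] arc_global(4)[of 0]
  by (auto simp: units_def len_def)

text \<open>A pushed arc keeps its two ends, except an end that would leave the ring of vertex
  cells. At a corner, a horizontal and a vertical arc share a cell; by \<open>arc_corner\<close>
  they are present together, and each contributes one end of the turn.\<close>

lemma has_end_dual:
  "has_end (dual i j) 1 \<longleftrightarrow> 0 \<le> i \<and> i \<le> M - 2 \<and> (j = 0 \<and> has_end (Z i 0) 1 \<or> j = N - 1 \<and> has_end (Z i N) 1)" (is ?R)
  "has_end (dual i j) (- 1) \<longleftrightarrow> 1 \<le> i \<and> i \<le> M - 1 \<and> (j = 0 \<and> has_end (Z i 0) 1 \<or> j = N - 1 \<and> has_end (Z i N) 1)" (is ?L)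
  "has_end (dual i j) \<i> \<longleftrightarrow> 0 \<le> j \<and> j \<le> N - 2 \<and> (i = 0 \<and> has_end (Z 0 j) \<i> \<or> i = M - 1 \<and> has_end (Z M j) \<i>)" (is ?U)
  "has_end (dual i j) (- \<i>) \<longleftrightarrow> 1 \<le> j \<and> j \<le> N - 1 \<and> (i = 0 \<and> has_end (Z 0 j) \<i> \<or> i = M - 1 \<and> has_end (Z M j) \<i>)" (is ?D)
proof -
  have u: "1 \<in> units" "- 1 \<in> units" "\<i> \<in> units" "- \<i> \<in> units" by (auto simp: units_def)
  note e = has_end_pushed[OF u(1)] has_end_pushed[OF u(2)] has_end_pushed[OF u(3)] has_end_pushed[OF u(4)]
  have c: "has_end (Z 0 0) 1 \<longleftrightarrow> has_end (Z 0 0) \<i>" "has_end (Z M (N - 1)) \<i> \<longleftrightarrow> has_end (Z (M - 1) N) 1"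
    "has_end (Z (M - 1) 0) 1 \<longleftrightarrow> has_end (Z M 0) \<i>" "has_end (Z 0 N) 1 \<longleftrightarrow> has_end (Z 0 (N - 1)) \<i>"
    using arc_corner_global arc_global(1,2)[of 0] arc_global(3)[of "M - 1"] arc_global(4)[of "N - 1"] by simp_all
  show ?R ?L ?U ?D
    using wide unfolding dual_def
    by (auto simp: e arc_global arc_corner_global c)
qed

text \<open>A border tile is empty or carries a single strand, which has two ends.\<close>

lemma border_parity:
  assumes "w \<in> units"
  shows "of_bool (has_end (cell w i 0) w) + of_bool (has_end (cell w i 0) (- w)) +
    of_bool (has_end (cell w i 0) (- \<i> * w)) \<in> {0, 2 :: nat}"
  using tile_curve_outward[OF assms no_outward[OF assms], of i] has_end_T0
  by (cases "has_end (cell w i 0) w"; cases "has_end (cell w i 0) (- w)") auto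

text \<open>A vertex of the rotated grid is the midpoint of the side between two edge tiles; the
  other two cells around it are vertex cells. Away from the border the two edge tiles agree and the
  vertex cells have no end there. Next to the border one of the edge tiles has been removed, but its
  arcs along the border reappear in the two vertex cells, so that \<open>border_parity\<close> for
  the removed tile gives the count.\<close>

lemma vertex_parity:
  "card {d \<in> units. has_end (corner_cell (p - of_bool (d = 1 \<or> d = \<i>)) (q - of_bool (d = \<i> \<or> d = - 1))) d} \<in> {0, 2}"
proof -
  define n where "n = card {d \<in> units. has_end (corner_cell (p - of_bool (d = 1 \<or> d = \<i>)) (q - of_bool (d = \<i> \<or> d = - 1))) d}"
  have n: "n = of_bool (has_end (corner_cell (p - 1) q) 1) + of_bool (has_end (corner_cell p (q - 1)) (- 1)) +
    of_bool (has_end (corner_cell (p - 1) (q - 1)) \<i>) + of_bool (has_end (corner_cell p q) (- \<i>))"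
    unfolding n_def card_units by simp
  have u: "1 \<in> units" "- 1 \<in> units" "\<i> \<in> units" "- \<i> \<in> units" by (auto simp: units_def)
  have "n \<in> {0, 2}"
  proof (rule parity_cases[of p q])
    \<comment> \<open>The midpoint between the edge tiles \<open>(i, j - 1)\<close> and
      \<open>(i, j)\<close>.\<close>
    fix i j assume pq: "p = i + j" "q = j - i"
    have c: "corner_cell p q = inside i j" "corner_cell (p - 1) (q - 1) = inside i (j - 1)"
      "corner_cell (p - 1) q = dual (i - 1) (j - 1)" "corner_cell p (q - 1) = dual i (j - 1)"
      using corner_cell_even[of i j] corner_cell_even[of i "j - 1"] corner_cell_odd[of "i - 1" "j - 1"]
        corner_cell_odd[of i "j - 1"] by (simp_all add: pq algebra_simps)
    have v: "has_end (Z i j) (- \<i>) \<longleftrightarrow> has_end (Z i (j - 1)) \<i>" using vertical[of i "j - 1"] by simp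
    have h: "has_end (Z i k) (- 1) \<longleftrightarrow> has_end (Z (i - 1) k) 1" for k using horizontal[of "i - 1" k] by simp
    have b: "of_bool (has_end (Z i 0) 1) + of_bool (has_end (Z (i - 1) 0) 1) + of_bool (has_end (Z i 0) \<i>) \<in> {0, 2 :: nat}"
      using border_parity[OF u(2), of "M - i"] by (simp add: cell_def h add.commute)
    have t: "of_bool (has_end (Z i N) 1) + of_bool (has_end (Z (i - 1) N) 1) + of_bool (has_end (Z i (N - 1)) \<i>) \<in> {0, 2 :: nat}"
      using border_parity[OF u(1), of i] vertical[of i "N - 1"] by (simp add: cell_def h)
    show ?thesis
    proof (cases "1 \<le> i \<and> i \<le> M - 1 \<and> 1 \<le> j \<and> j \<le> N")
      case False
      then have "n = 0" unfolding n c has_end_inside has_end_dual using wide by auto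
      then show ?thesis by simp
    next
      case True
      then consider "j = 1" | "j = N" | "1 < j" "j < N" by linarith
      then show ?thesis
      proof cases
        case 1
        then have "n = of_bool (has_end (Z i 0) 1) + of_bool (has_end (Z (i - 1) 0) 1) + of_bool (has_end (Z i 0) \<i>)"
          unfolding n c has_end_inside has_end_dual using wide True v by auto
        then show ?thesis using b by simp
      next
        case 2
        then have "n = of_bool (has_end (Z i N) 1) + of_bool (has_end (Z (i - 1) N) 1) + of_bool (has_end (Z i (N - 1)) \<i>)"
          unfolding n c has_end_inside has_end_dual using wide True v by auto
        then show ?thesis using t by simp
      next
        case 3
        then show ?thesis unfolding n c has_end_inside has_end_dual using wide True v by auto
      qed
    qed
  next
    \<comment> \<open>The midpoint between the edge tiles \<open>(i, j)\<close> and
      \<open>(i + 1, j)\<close>.\<close>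
    fix i j assume pq: "p = i + j + 1" "q = j - i"
    have c: "corner_cell p q = dual i j" "corner_cell (p - 1) (q - 1) = dual i (j - 1)"
      "corner_cell (p - 1) q = inside i j" "corner_cell p (q - 1) = inside (i + 1) j"
      using corner_cell_odd[of i j] corner_cell_odd[of i "j - 1"] corner_cell_even[of i j]
        corner_cell_even[of "i + 1" j] by (simp_all add: pq algebra_simps)
    note h = horizontal[of i j]
    have v: "has_end (Z k j) (- \<i>) \<longleftrightarrow> has_end (Z k (j - 1)) \<i>" for k using vertical[of k "j - 1"] by simp
    have l: "of_bool (has_end (Z 0 j) 1) + of_bool (has_end (Z 0 j) \<i>) + of_bool (has_end (Z 0 (j - 1)) \<i>) \<in> {0, 2 :: nat}"
      using border_parity[OF u(3), of j]
      by (cases "has_end (Z 0 j) 1"; cases "has_end (Z 0 j) \<i>"; cases "has_end (Z 0 (j - 1)) \<i>";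
          simp add: cell_def v)
    have r: "of_bool (has_end (Z (M - 1) j) 1) + of_bool (has_end (Z M j) \<i>) + of_bool (has_end (Z M (j - 1)) \<i>) \<in> {0, 2 :: nat}"
      using border_parity[OF u(4), of "N - j"] horizontal[of "M - 1" j]
      by (cases "has_end (Z M j) (- 1)"; cases "has_end (Z M j) \<i>"; cases "has_end (Z M (j - 1)) \<i>";
          simp add: cell_def v)
    show ?thesis
    proof (cases "0 \<le> i \<and> i \<le> M - 1 \<and> 1 \<le> j \<and> j \<le> N - 1")
      case False
      then have "n = 0" unfolding n c has_end_inside has_end_dual using wide by auto
      then show ?thesis by simp
    next
      case True
      then consider "i = 0" | "i = M - 1" | "0 < i" "i < M - 1" by linarith
      then show ?thesis
      proof cases
        case 1
        then have "n = of_bool (has_end (Z 0 j) 1) + of_bool (has_end (Z 0 j) \<i>) + of_bool (has_end (Z 0 (j - 1)) \<i>)"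
          unfolding n c has_end_inside has_end_dual using wide True h by auto
        then show ?thesis using l by simp
      next
        case 2
        then have "n = of_bool (has_end (Z (M - 1) j) 1) + of_bool (has_end (Z M j) \<i>) + of_bool (has_end (Z M (j - 1)) \<i>)"
          unfolding n c has_end_inside has_end_dual using wide True h by auto
        then show ?thesis using r by simp
      next
        case 3
        then show ?thesis unfolding n c has_end_inside has_end_dual using wide True h by auto
      qed
    qed
  qed
  then show ?thesis by (simp add: n_def)
qed

end

lemma units_int:
  assumes "u \<in> units"
  obtains a b :: int where "u = Complex (of_int a) (of_int b)" "(a, b) \<in> {(1, 0), (- 1, 0), (0, 1), (0, - 1)}"
proof -
  have "u = Complex (of_int 1) (of_int 0) \<or> u = Complex (of_int (- 1)) (of_int 0) \<or>
      u = Complex (of_int 0) (of_int 1) \<or> u = Complex (of_int 0) (of_int (- 1))"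
    using assms by (auto simp: units_def complex_eq_iff)
  then show ?thesis using that by blast
qed

lemma vertex_end:
  assumes "d \<in> units"
  shows "Complex (2 * real i - 1) (2 * real j - 1) = centre k l + (1 - \<i>) * d \<longleftrightarrow>
    int k = int i - of_bool (d = 1 \<or> d = \<i>) \<and> int l = int j - of_bool (d = \<i> \<or> d = - 1)"
proof -
  obtain a b where d: "d = Complex (of_int a) (of_int b)" "(a, b) \<in> {(1, 0), (- 1, 0), (0, 1), (0, - 1)}"
    using units_int[OF assms] .
  have e: "2 * real m - 1 = 2 * real n + of_int z \<longleftrightarrow> 2 * int m - 1 = 2 * int n + z" for m n z
    using of_int_eq_iff[where 'a = real, of "2 * int m - 1" "2 * int n + z"] by simp
  have c: "centre k l + (1 - \<i>) * d = Complex (2 * real k + of_int (a + b)) (2 * real l + of_int (b - a))"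
    by (simp add: d(1) centre_def complex_eq_iff)
  have "Complex (2 * real i - 1) (2 * real j - 1) = centre k l + (1 - \<i>) * d \<longleftrightarrow>
      2 * int i - 1 = 2 * int k + (a + b) \<and> 2 * int j - 1 = 2 * int l + (b - a)"
    unfolding c complex.inject e ..
  also have "\<dots> \<longleftrightarrow> int k = int i - of_bool (d = 1 \<or> d = \<i>) \<and> int l = int j - of_bool (d = \<i> \<or> d = - 1)"
  proof -
    have "(d = 1 \<or> d = \<i>) = (a = 1 \<or> b = 1)" "(d = \<i> \<or> d = - 1) = (b = 1 \<or> a = - 1)"
      using d(2) unfolding d(1) complex_eq_iff by auto
    then show ?thesis using d(2) by auto
  qed
  finally show ?thesis .
qed

context wide_mosaic
begin

text \<open>Strand ends at a vertex are counted by the direction \<open>d\<close> from the centre of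
  their tile to the vertex, before rotation: \<open>d\<close> determines the tile, and at most one
  strand of a tile ends at \<open>d\<close>. This reduces the count to
  \<open>vertex_parity\<close>.\<close>

lemma corner_mosaic_corner_grid: "corner_mosaic corner_size corner_size corner_grid"
  unfolding corner_mosaic_def
proof (intro allI impI)
  fix i j
  define V where "V = Complex (2 * real i - 1) (2 * real j - 1)"
  define D where "D = {d \<in> units. has_end (corner_cell (int i - of_bool (d = 1 \<or> d = \<i>))
    ((int j - M) - of_bool (d = \<i> \<or> d = - 1))) d}"
  define S where "S = {(k, l, s). k < corner_size \<and> l < corner_size \<and> s \<in> strands (corner_grid k l) \<and>
    V \<in> strand_ends corner_factor (centre k l) s}"
  define F where "F = (\<lambda>(k, l, s :: strand). if V = centre k l + (1 - \<i>) * fst s then fst s else fst (snd s) :: complex)"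
  have F: "V = centre k l + (1 - \<i>) * F (k, l, s) \<and> (F (k, l, s) = fst s \<or> F (k, l, s) = fst (snd s)) \<and> F (k, l, s) \<in> units"
    if "(k, l, s) \<in> S" for k l s
    using that strands_units[of "fst s" "fst (snd s)" "snd (snd s)" "corner_grid k l"]
    by (auto simp: S_def F_def strand_ends_def corner_factor_def split: prod.splits)
  have "inj_on F S"
  proof (rule inj_onI)
    fix x y assume xy: "x \<in> S" "y \<in> S" "F x = F y"
    obtain k l s k' l' s' where e: "x = (k, l, s)" "y = (k', l', s')" by (cases x; cases y) auto
    have "centre k l = centre k' l'" using F[of k l s] F[of k' l' s'] xy unfolding e by simp
    then have "k = k'" "l = l'" by (auto simp: centre_def complex_eq_iff)
    moreover have "s = s'"
    proof (rule strand_unique)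
      show "s \<in> strands (corner_grid k l)" using xy(1) by (simp add: e S_def)
      show "s' \<in> strands (corner_grid k l)" using xy(2) \<open>k = k'\<close> \<open>l = l'\<close> by (simp add: e S_def)
      show "F x = fst s \<or> F x = fst (snd s)" using F[of k l s] xy(1) by (simp only: e)
      show "F x = fst s' \<or> F x = fst (snd s')" using F[of k' l' s'] xy(2) unfolding xy(3) by (simp only: e)
    qed
    ultimately show "x = y" by (simp add: e)
  qed
  moreover have "F ` S = D"
  proof (intro equalityI subsetI)
    fix d assume "d \<in> F ` S"
    then obtain k l s where S: "(k, l, s) \<in> S" and d: "d = F (k, l, s)" by auto
    have u: "d \<in> units" using F[OF S] d by simp
    have "V = centre k l + (1 - \<i>) * d" using F[OF S] d by simp
    then have kl: "int k = int i - of_bool (d = 1 \<or> d = \<i>)" "int l = int j - of_bool (d = \<i> \<or> d = - 1)"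
      using vertex_end[OF u, of i j k l] by (simp_all add: V_def)
    have "s \<in> strands (corner_grid k l)" "d = fst s \<or> d = fst (snd s)"
      using S F[OF S] by (simp_all add: S_def d)
    then have "has_end (corner_grid k l) d"
      unfolding has_end_def by (intro bexI[of _ s]) (simp_all add: case_prod_unfold)
    moreover have "corner_grid k l = corner_cell (int i - of_bool (d = 1 \<or> d = \<i>)) ((int j - M) - of_bool (d = \<i> \<or> d = - 1))"
      unfolding corner_grid_def kl by (simp add: algebra_simps)
    ultimately show "d \<in> D" using u by (simp add: D_def)
  next
    fix d assume d: "d \<in> D"
    define p q where "p = int i - of_bool (d = 1 \<or> d = \<i>)" and "q = int j - of_bool (d = \<i> \<or> d = - 1)"
    have u: "d \<in> units" and h: "has_end (corner_cell p (q - M)) d"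
      using d by (auto simp: D_def p_def q_def algebra_simps)
    have "corner_cell p (q - M) \<noteq> T0" using h by auto
    note r = corner_cell_range[OF this]
    define k l where "k = nat p" and "l = nat q"
    have kl: "int k = p" "int l = q" "k < corner_size" "l < corner_size"
      using r by (auto simp: k_def l_def corner_size_def)
    have V: "V = centre k l + (1 - \<i>) * d"
      unfolding V_def vertex_end[OF u] using kl by (simp add: p_def q_def)
    have g: "corner_grid k l = corner_cell p (q - M)" by (simp add: corner_grid_def kl)
    obtain s where s: "s \<in> strands (corner_grid k l)" "d = fst s \<or> d = fst (snd s)"
      using h unfolding g has_end_def by force
    have S: "(k, l, s) \<in> S"
      using s V kl by (auto simp: S_def strand_ends_def corner_factor_def split: prod.splits)
    have "(1 - \<i>) * F (k, l, s) = (1 - \<i>) * d" using F[OF S] V by (metis add_left_cancel)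
    moreover have "1 - \<i> \<noteq> 0" by (simp add: complex_eq_iff)
    ultimately have "F (k, l, s) = d" by simp
    then show "d \<in> F ` S" using S by force
  qed
  ultimately have "card S = card D" by (metis card_image)
  also have "\<dots> \<in> {0, 2}" unfolding D_def by (rule vertex_parity)
  finally show "card {(k, l, s). k < corner_size \<and> l < corner_size \<and> s \<in> strands (corner_grid k l) \<and>
    Complex (2 * real i - 1) (2 * real j - 1) \<in> strand_ends corner_factor (centre k l) s} \<in> {0, 2}"
    by (simp add: S_def V_def)
qed

lemma isotopic_corner_grid:
  "isotopic (rect 1 {0..M} {0..N}) (mosaic_curve corner_factor corner_size corner_size corner_grid)"
proof -
  have "isotopic (rect 1 {0..M} {0..N}) mixed_curve"
    using isotopic_pushed_in by (simp add: mixed_curve_eq)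
  also have "isotopic \<dots> (plane_map (\<lambda>z. (1 - \<i>) * z) ` mixed_curve)"
    by (rule isotopic_mult) (simp add: complex_eq_iff)
  also have "isotopic \<dots> (plane_map (\<lambda>z. z + 2 * of_int M * \<i>) ` \<dots>)" by (rule isotopic_translate)
  also have "\<dots> = mosaic_curve corner_factor corner_size corner_size corner_grid"
    unfolding corner_curve image_image by (simp add: plane_map_def)
  finally show ?thesis .
qed

section \<open>Counting tiles\<close>

definition border_index :: "complex \<Rightarrow> int \<Rightarrow> int \<times> int" where
  "border_index w i = (if w = 1 then (i, N) else if w = - \<i> then (M, N - i)
    else if w = - 1 then (M - i, 0) else (0, i))"

lemma border_index_cell: "w \<in> units \<Longrightarrow> case_prod Z (border_index w i) = cell w i 0"
  by (auto simp: units_def border_index_def cell_def)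

text \<open>The range omits the last tile of the side, which is the first one of the next side, so
  that every border tile is counted once. Likewise \<open>border_arcs\<close> omits the last arc,
  whose vertex cell is counted for the next side.\<close>

definition border_cells :: "complex \<Rightarrow> int set" where
  "border_cells w = {i. 0 \<le> i \<and> i \<le> len w - 1 \<and> cell w i 0 \<noteq> T0}"

definition inner_cells :: "(int \<times> int) set" where
  "inner_cells = {(i, j). inside i j \<noteq> T0}"

definition border_arcs :: "complex \<Rightarrow> int set" where
  "border_arcs w = {i. 0 \<le> i \<and> i \<le> len w - 2 \<and> arc w i}"

lemma finite_cells: "finite {(i, j). Z i j \<noteq> T0}" "finite inner_cells" "finite (border_cells w)" "finite (border_arcs w)"
proof -
  have f: "finite ({0..M} \<times> {0..N})" by simp
  show "finite {(i, j). Z i j \<noteq> T0}" by (rule finite_subset[OF _ f]) (use outside in auto)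
  show "finite inner_cells" by (rule finite_subset[OF _ f]) (use outside in \<open>auto simp: inner_cells_def inside_def split: if_splits\<close>)
  show "finite (border_cells w)" by (rule finite_subset[of _ "{0..len w}"]) (auto simp: border_cells_def)
  show "finite (border_arcs w)" by (rule finite_subset[of _ "{0..len w}"]) (auto simp: border_arcs_def)
qed

text \<open>
  Pushed in, a side carries one tile less for each of its caps, that is, for each of its maximal
  sequences of consecutive arcs.
\<close>

lemma card_border_arcs:
  assumes w: "w \<in> units" and ne: "\<exists>i. cell w i 0 \<noteq> T0"
  shows "card (border_arcs w) + 1 \<le> card (border_cells w)"
proof -
  have "\<exists>i. arc w i"
  proof (rule ccontr)
    assume "\<not> ?thesis"
    then have "\<not> has_end (cell w i 0) w \<and> \<not> has_end (cell w i 0) (- w)" for i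
      using arc_prev[OF w] by (auto simp: arc_def)
    then show False using tile_curve_outward(4)[OF w no_outward[OF w]] ne by blast
  qed
  moreover have "finite {i. arc w i}"
    by (rule finite_subset[of _ "{0..len w}"]) (use arc_range[OF w] in force)+
  ultimately have m: "arc w (Max {i. arc w i})" "\<And>i. arc w i \<Longrightarrow> i \<le> Max {i. arc w i}"
    using Max_in[of "{i. arc w i}"] by auto
  define m where "m = Max {i. arc w i}"
  have am: "arc w m" and mm: "\<And>i. arc w i \<Longrightarrow> i \<le> m" using m by (auto simp: m_def)
  \<comment> \<open>The tile in which the last arc ends has no arc of its own. If it is the corner
    tile, it belongs to the next side; but then the last arc is not counted either, and the tile
    where it starts is left over.\<close>
  define e where "e = (if m = len w - 1 then m else m + 1)"
  have r: "0 \<le> m" "m < len w" using arc_range[OF w am] .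
  have "cell w m 0 \<noteq> T0" "cell w (m + 1) 0 \<noteq> T0"
    using am arc_prev[OF w, of "m + 1"] by (auto simp: arc_def)
  then have "e \<in> border_cells w" using r by (auto simp: border_cells_def e_def)
  moreover have "e \<notin> border_arcs w" using mm[of e] by (auto simp: border_arcs_def e_def split: if_splits)
  moreover have "border_arcs w \<subseteq> border_cells w" by (auto simp: border_arcs_def border_cells_def arc_def)
  ultimately have "insert e (border_arcs w) \<subseteq> border_cells w" by blast
  then have "card (insert e (border_arcs w)) \<le> card (border_cells w)"
    by (rule card_mono[OF finite_cells(3)])
  then show ?thesis using \<open>e \<notin> border_arcs w\<close> finite_cells(4) by simp
qed

lemma border_index_inj:
  assumes "w \<in> units" "v \<in> units" "border_index w i = border_index v k"
    and "0 \<le> i" "i \<le> len w - 1" "0 \<le> k" "k \<le> len v - 1"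
  shows "w = v \<and> i = k"
proof -
  have "w = 1 \<or> w = - 1 \<or> w = \<i> \<or> w = - \<i>" "v = 1 \<or> v = - 1 \<or> v = \<i> \<or> v = - \<i>"
    using assms(1,2) by (auto simp: units_def)
  then show ?thesis
    using assms(3-) wide unfolding len_def by (elim disjE) (simp_all add: border_index_def)
qed

lemma inner_not_border:
  assumes "p \<in> inner_cells" "w \<in> units"
  shows "p \<noteq> border_index w i"
  using assms by (auto simp: inner_cells_def inside_def border_index_def split: if_splits)

lemma card_cells:
  "card inner_cells + (\<Sum>w\<in>units. card (border_cells w)) \<le> card {(i, j). Z i j \<noteq> T0}"
proof -
  define f where "f x = (case x of Inl p \<Rightarrow> p | Inr (w, i) \<Rightarrow> border_index w i)" for x :: "int \<times> int + complex \<times> int"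
  let ?A = "inner_cells <+> (SIGMA w:units. border_cells w)"
  have fin: "finite units" by (simp add: units_def)
  have "inj_on f ?A"
  proof (rule inj_onI)
    fix x y assume xy: "x \<in> ?A" "y \<in> ?A" "f x = f y"
    show "x = y"
    proof (cases x; cases y)
      fix p p' assume "x = Inl p" "y = Inl p'" then show ?thesis using xy by (simp add: f_def)
    next
      fix p p' assume "x = Inl p" "y = Inr p'"
      then show ?thesis using xy inner_not_border[of p "fst p'" "snd p'"]
        by (simp add: f_def case_prod_unfold mem_Times_iff Sigma_def) auto
    next
      fix p p' assume "x = Inr p" "y = Inl p'"
      then show ?thesis using xy inner_not_border[of p' "fst p" "snd p"]
        by (simp add: f_def case_prod_unfold mem_Times_iff Sigma_def) auto
    next
      fix p p' assume "x = Inr p" "y = Inr p'"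
      then show ?thesis using xy border_index_inj[of "fst p" "fst p'" "snd p" "snd p'"]
        by (simp add: f_def case_prod_unfold Sigma_def prod_eq_iff) (auto simp: border_cells_def)
    qed
  qed
  moreover have "f ` ?A \<subseteq> {(i, j). Z i j \<noteq> T0}"
  proof
    fix x assume "x \<in> f ` ?A"
    then consider p where "p \<in> inner_cells" "x = p" | w i where "w \<in> units" "i \<in> border_cells w" "x = border_index w i"
      by (auto simp: f_def)
    then show "x \<in> {(i, j). Z i j \<noteq> T0}"
    proof cases
      case 1
      then show ?thesis by (auto simp: inner_cells_def inside_def split: if_splits)
    next
      case 2
      then show ?thesis using border_index_cell[of w i] by (cases x) (auto simp: border_cells_def)
    qed
  qed
  ultimately have "card ?A \<le> card {(i, j). Z i j \<noteq> T0}"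
    by (metis card_image card_mono finite_cells(1))
  then show ?thesis using fin finite_cells by (simp add: card_Plus card_SigmaI)
qed

lemma card_corner_cells:
  "nonempty_tiles corner_size corner_size corner_grid \<le> card inner_cells + (\<Sum>w\<in>units. card (border_arcs w))"
proof -
  define g where "g p q = (nat p, nat (q + M))" for p q :: int
  define f where "f x = (case x of Inl (i, j) \<Rightarrow> g (i + j) (j - i)
    | Inr (w, k) \<Rightarrow> (case dual_index w k of (i, j) \<Rightarrow> g (i + j + 1) (j - i)))" for x :: "int \<times> int + complex \<times> int"
  let ?A = "inner_cells <+> (SIGMA w:units. border_arcs w)"
  have fin: "finite units" by (simp add: units_def)
  have finA: "finite ?A" using fin finite_cells by (intro finite_Plus finite_SigmaI) auto
  have "{(k, l). k < corner_size \<and> l < corner_size \<and> corner_grid k l \<noteq> T0} \<subseteq> f ` ?A"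
  proof safe
    fix k l assume kl: "corner_grid k l \<noteq> T0"
    define p q where "p = int k" and "q = int l - M"
    have gpq: "g p q = (k, l)" by (simp add: g_def p_def q_def)
    have c: "corner_cell p q \<noteq> T0" using kl by (simp add: corner_grid_def p_def q_def)
    have "(k, l) \<in> f ` ?A"
    proof (rule parity_cases[of p q])
      fix i j assume "p = i + j" "q = j - i"
      moreover from this have "(i, j) \<in> inner_cells" using c by (simp add: inner_cells_def corner_cell_even)
      ultimately show ?thesis using gpq by (intro image_eqI[of _ _ "Inl (i, j)"]) (auto simp: f_def)
    next
      fix i j assume pq: "p = i + j + 1" "q = j - i"
      then have "dual i j \<noteq> T0" using c by (simp add: corner_cell_odd)
      then obtain w m where "w \<in> units" "0 \<le> m" "m \<le> len w - 2" "(i, j) = dual_index w m" "arc w m"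
        by (rule dual_cases)
      then have "Inr (w, m) \<in> ?A" "f (Inr (w, m)) = (k, l)"
        using gpq pq by (auto simp: border_arcs_def f_def split: prod.splits)
      then show ?thesis by (metis image_eqI)
    qed
    then show "(k, l) \<in> f ` ?A" .
  qed
  then have "nonempty_tiles corner_size corner_size corner_grid \<le> card (f ` ?A)"
    unfolding nonempty_tiles_def using finA by (intro card_mono) auto
  also have "\<dots> \<le> card ?A" by (rule card_image_le[OF finA])
  also have "\<dots> = card inner_cells + (\<Sum>w\<in>units. card (border_arcs w))"
    using fin finite_cells by (simp add: card_Plus card_SigmaI)
  finally show ?thesis .
qed

lemma nonempty_corner_grid:
  assumes "\<And>w. w \<in> units \<Longrightarrow> \<exists>i. cell w i 0 \<noteq> T0"
  shows "nonempty_tiles corner_size corner_size corner_grid + 4 \<le> card {(i, j). Z i j \<noteq> T0}"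
proof -
  have "card units = 4" by (simp add: units_def)
  then have "(\<Sum>w\<in>units. card (border_arcs w)) + 4 = (\<Sum>w\<in>units. card (border_arcs w) + 1)"
    by (simp add: sum_Suc)
  also have "\<dots> \<le> (\<Sum>w\<in>units. card (border_cells w))"
    by (intro sum_mono card_border_arcs assms)
  finally show ?thesis using card_cells card_corner_cells by linarith
qed

end

section \<open>Split unknots\<close>

lemma component_if_clopen:
  assumes "connected C" "C \<noteq> {}" "C = A \<inter> S" "A - C = A \<inter> T" "open S" "open T"
  shows "C \<in> components A"
  unfolding in_components_maximal
proof (intro conjI allI impI)
  fix D assume D: "D \<noteq> {} \<and> C \<subseteq> D \<and> D \<subseteq> A \<and> connected D"
  have "S \<inter> T \<inter> D = {}" "D \<subseteq> S \<union> T" using assms(3,4) D by blast+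
  then have "S \<inter> D = {} \<or> T \<inter> D = {}" using D connectedD assms(5,6) by blast
  then show "D = C" using assms(2-4) D by blast
next
  show "C \<subseteq> A" using assms(3) by blast
qed (fact assms)+

lemma component_image:
  assumes h: "homeomorphism X Y f g" and C: "C \<in> components A" and A: "A \<subseteq> X"
  shows "f ` C \<in> components (f ` A)"
proof -
  note C' = in_components_nonempty[OF C] in_components_subset[OF C] in_components_connected[OF C]
  have C_max: "D = C" if "D \<noteq> {}" "C \<subseteq> D" "D \<subseteq> A" "connected D" for D
    using C that unfolding in_components_maximal by simp
  have gf: "g (f x) = x" if "x \<in> X" for x using h that by (simp add: homeomorphism_def)
  have fg: "f (g y) = y" if "y \<in> Y" for y using h that by (simp add: homeomorphism_def)
  have fX: "f ` X = Y" using h by (simp add: homeomorphism_def)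
  show ?thesis unfolding in_components_maximal
  proof (intro conjI allI impI)
    have "C \<subseteq> X" using A C'(2) by blast
    then show "connected (f ` C)"
      by (rule connected_continuous_image[OF continuous_on_subset[OF homeomorphism_cont1[OF h]] C'(3)])
    fix D assume D: "D \<noteq> {} \<and> f ` C \<subseteq> D \<and> D \<subseteq> f ` A \<and> connected D"
    have DY: "D \<subseteq> Y" using D A fX by blast
    have "g ` D = C"
    proof (rule C_max)
      show "connected (g ` D)"
        by (rule connected_continuous_image[OF continuous_on_subset[OF homeomorphism_cont2[OF h] DY]]) (use D in simp)
      show "C \<subseteq> g ` D"
      proof
        fix x assume "x \<in> C"
        then have "f x \<in> D" "g (f x) = x" using D gf A C'(2) by blast+
        then show "x \<in> g ` D" by (metis imageI)
      qed
      show "g ` D \<subseteq> A"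
      proof
        fix x assume "x \<in> g ` D"
        then obtain a where "x = g (f a)" "a \<in> A" using D by blast
        then show "x \<in> A" using gf A by auto
      qed
    qed (use D in simp)
    then have "f ` C = f ` g ` D" by simp
    also have "\<dots> = D" using fg DY by (simp add: image_image subset_iff)
    finally show "D = f ` C" ..
  next
    show "f ` C \<noteq> {}" "f ` C \<subseteq> f ` A" using C'(1,2) by blast+
  qed
qed

lemma to_S3_open:
  assumes "open W"
  obtains T where "open T" "to_S3 ` W = S3 \<inter> T"
proof -
  have "to_S3 ` W = (S3 - {north}) \<inter> from_S3 -` W"
  proof (intro equalityI subsetI)
    fix x assume "x \<in> to_S3 ` W"
    then obtain v where "x = to_S3 v" "v \<in> W" by blast
    then show "x \<in> (S3 - {north}) \<inter> from_S3 -` W" using to_S3_in_S3 to_S3_neq_north by simp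
  next
    fix x assume "x \<in> (S3 - {north}) \<inter> from_S3 -` W"
    then have "to_S3 (from_S3 x) = x" "from_S3 x \<in> W" using to_from_S3[of x] by simp_all
    then show "x \<in> to_S3 ` W" by (metis imageI)
  qed
  moreover have "openin (top_of_set (S3 - {north})) ((S3 - {north}) \<inter> from_S3 -` W)"
    by (rule continuous_openin_preimage_gen[OF continuous_on_from_S3 assms])
  ultimately obtain T where T: "open T" "to_S3 ` W = (S3 - {north}) \<inter> T"
    by (metis openin_open)
  show ?thesis
  proof (rule that)
    show "open (T - {north})" using T(1) by (rule open_delete)
    show "to_S3 ` W = S3 \<inter> (T - {north})" unfolding T(2) by blast
  qed
qed

text \<open>The two pieces are open in the difference and disjoint, so connectedness makes them
  components. For the outer one, the complement of a bounded convex set is connected in dimension at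
  least 2, and \<open>north\<close> is a limit of its image. The boundary of a convex body is a
  sphere.\<close>

lemma convex_body_components:
  fixes Q :: "space set"
  assumes Q: "convex Q" "compact Q" "interior Q \<noteq> {}"
  shows "to_S3 ` interior Q \<in> components (S3 - to_S3 ` frontier Q)"
    and "insert north (to_S3 ` (- Q)) \<in> components (S3 - to_S3 ` frontier Q)"
    and "to_S3 ` frontier Q homeomorphic sphere (0::space) 1"
proof -
  have cl: "closed Q" "bounded Q" using Q(2) compact_imp_closed compact_imp_bounded by auto
  have fr: "frontier Q = Q - interior Q" using cl by (simp add: frontier_def)
  obtain T where T: "open T" "to_S3 ` interior Q = S3 \<inter> T" using to_S3_open[OF open_interior] by metis
  have inj: "to_S3 x = to_S3 y \<longleftrightarrow> x = y" for x y by (simp add: inj_eq[OF inj_to_S3])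
  have nn: "north \<noteq> to_S3 x" for x using to_S3_neq_north by metis
  have cover: "S3 = insert north (range to_S3)" using north_in_S3 by (auto simp: to_S3_image_UNIV)
  have T': "open (- to_S3 ` Q)"
    using compact_imp_closed[OF compact_continuous_image[OF continuous_on_to_S3 Q(2)]] by (simp add: open_Compl)
  have U: "to_S3 ` interior Q = (S3 - to_S3 ` frontier Q) \<inter> T"
  proof -
    have "to_S3 ` interior Q \<inter> to_S3 ` frontier Q = {}"
      unfolding image_Int[OF inj_to_S3, symmetric] fr by simp
    then show ?thesis using T(2) by blast
  qed
  have V: "insert north (to_S3 ` (- Q)) = (S3 - to_S3 ` frontier Q) \<inter> - to_S3 ` Q"
    unfolding fr cover by (auto simp: inj nn to_S3_neq_north)
  have UV: "S3 - to_S3 ` frontier Q - to_S3 ` interior Q = insert north (to_S3 ` (- Q))"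
    using interior_subset[of Q] unfolding fr cover by (auto simp: inj nn to_S3_neq_north)
  have VU: "S3 - to_S3 ` frontier Q - insert north (to_S3 ` (- Q)) = to_S3 ` interior Q"
    using interior_subset[of Q] unfolding fr cover by (auto simp: inj nn to_S3_neq_north)
  have "connected (interior Q)" using Q(1) by (simp add: convex_connected)
  then have c1: "connected (to_S3 ` interior Q)" by (rule connected_continuous_image[OF continuous_on_to_S3])
  show "to_S3 ` interior Q \<in> components (S3 - to_S3 ` frontier Q)"
    by (rule component_if_clopen[OF c1 _ U _ T(1) T']) (use Q(3) UV V in auto)
  have "connected (- Q)"
    by (rule connected_complement_bounded_convex[OF cl(2) Q(1)]) (simp add: DIM_complex)
  then have c2: "connected (to_S3 ` (- Q))" by (rule connected_continuous_image[OF continuous_on_to_S3])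
  have "north \<in> closure (to_S3 ` (- Q))"
    unfolding closure_approachable
  proof (intro allI impI)
    fix e :: real assume e: "e > 0"
    obtain b where b: "\<And>x. x \<in> Q \<Longrightarrow> norm x \<le> b" using cl(2) by (auto simp: bounded_iff)
    \<comment> \<open>Large enough for a point outside \<open>Q\<close> and, as
      \<open>r \<le> r\<^sup>2\<close>, for a distance to \<open>north\<close> below
      \<open>e\<close>.\<close>
    define r where "r = max (\<bar>b\<bar> + 1) (4 / e\<^sup>2 + 1)"
    have r: "r > b" "r \<ge> 1" "r > 4 / e\<^sup>2" by (auto simp: r_def)
    define v :: space where "v = (of_real r, 0)"
    have nv: "norm v = r" using r by (simp add: v_def norm_Pair)
    have "r \<le> r\<^sup>2" using r by (simp add: power2_eq_square)
    then have "dist (to_S3 v) north < e" using r by (simp add: dist_north_less_iff[OF e] nv)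
    moreover have "v \<notin> Q" using b nv r by fastforce
    ultimately show "\<exists>y\<in>to_S3 ` (- Q). dist y north < e" by blast
  qed
  then have c3: "connected (insert north (to_S3 ` (- Q)))"
    using connected_intermediate_closure[OF c2] closure_subset by (metis insert_subset subset_insertI)
  show "insert north (to_S3 ` (- Q)) \<in> components (S3 - to_S3 ` frontier Q)"
    by (rule component_if_clopen[OF c3 _ V _ T' T(1)]) (use VU U in auto)
  have "rel_frontier Q homeomorphic rel_frontier (cball (0::space) 1)"
    using Q cl by (intro homeomorphic_rel_frontiers_convex_bounded_sets)
      (auto simp: aff_dim_nonempty_interior)
  then have "frontier Q homeomorphic sphere (0::space) 1"
    using Q(3) by (simp add: rel_frontier_nonempty_interior)
  moreover have "frontier Q homeomorphic to_S3 ` frontier Q"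
    using Q(2) by (intro homeomorphic_compact[OF _ continuous_on_to_S3 refl])
      (auto simp: compact_frontier inj_on_def inj)
  ultimately show "to_S3 ` frontier Q homeomorphic sphere (0::space) 1"
    using homeomorphic_sym homeomorphic_trans by blast
qed

text \<open>The curve \<open>N z = 1\<close> is a round circle up to radial isotopy, and the
  boundary of a box of half-width \<open>k + 1\<close> separates it from \<open>R\<close>. The
  inverse \<open>g\<close> of the final stage of the given isotopy transports both facts to
  \<open>L\<close>.\<close>

lemma split_unknot:
  fixes N :: "complex \<Rightarrow> real"
  assumes L: "L \<subseteq> S3" "ambient_isotopic S3 L (to_S3 ` ({z. N z = 1} \<times> {0} \<union> R))"
    and N: "continuous_on UNIV N" "\<And>t z. t \<ge> 0 \<Longrightarrow> N (of_real t * z) = t * N z"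
      "c > 0" "\<And>z. N z \<ge> c * norm z"
    and k: "k > 0" "\<And>z. N z = 1 \<Longrightarrow> \<bar>Re z\<bar> \<le> k \<and> \<bar>Im z\<bar> \<le> 1"
    and R: "\<And>p. p \<in> R \<Longrightarrow> Re (fst p) \<ge> k + 2"
  shows "\<not> no_unlinked_unknotted_components L"
proof -
  define K where "K = {z. N z = 1} \<times> {0 :: real}"
  define X where "X = K \<union> R"
  have "ambient_isotopic S3 L (to_S3 ` X)" using L(2) by (simp only: X_def K_def)
  then obtain h g where h: "continuous_on ({0..1} \<times> S3) (\<lambda>(t, x). h t x)"
      "\<And>t. t \<in> {0..1} \<Longrightarrow> \<exists>g. homeomorphism S3 S3 (h t) g"
      "\<And>x. x \<in> S3 \<Longrightarrow> h 0 x = x" "h (1::real) ` L = to_S3 ` X" and g: "homeomorphism S3 S3 (h 1) g"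
    by (rule ambient_isotopicE) (rule that)
  have g': "homeomorphism S3 S3 g (h 1)" using g by (rule homeomorphism_symD)
  have gh: "g (h 1 x) = x" if "x \<in> S3" for x using g that by (simp add: homeomorphism_def)
  have hg: "h 1 (g x) = x" if "x \<in> S3" for x using g that by (simp add: homeomorphism_def)
  have gS3: "g ` S3 = S3" using g by (simp add: homeomorphism_def)
  have S3: "to_S3 ` A \<subseteq> S3" for A using to_S3_in_S3 by blast
  have "(\<lambda>x. g (h 1 x)) ` L = (\<lambda>x. x) ` L" by (rule image_cong[OF refl]) (use gh L(1) in blast)
  then have "g ` h 1 ` L = L" by (simp add: image_image)
  then have gL: "g ` to_S3 ` X = L" by (simp only: h(4))
  have inj: "to_S3 x = to_S3 y \<longleftrightarrow> x = y" for x y by (simp add: inj_eq[OF inj_to_S3])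
  have ginj: "inj_on g S3" using hg by (metis inj_on_def)
  have iso: "isotopic K (sphere 0 1 \<times> {0})" unfolding K_def by (rule isotopic_radial) (use N in auto)
  obtain f f' where f: "f ` to_S3 ` K = to_S3 ` (sphere 0 1 \<times> {0})" and f': "homeomorphism S3 S3 f f'"
    using iso unfolding isotopic_def by (rule ambient_isotopicE) (rule that)
  have Kc: "connected (to_S3 ` K)" "K \<noteq> {}"
  proof -
    have "connected (sphere (0::complex) 1)" by (rule connected_sphere) (simp add: DIM_complex)
    then have "connected (to_S3 ` (sphere 0 1 \<times> {0}))"
      by (intro connected_continuous_image continuous_on_to_S3 connected_Times) auto
    then have "connected (f' ` to_S3 ` (sphere 0 1 \<times> {0}))"
      by (rule connected_continuous_image[OF continuous_on_subset[OF homeomorphism_cont2[OF f'] S3]])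
    moreover have "f' ` f ` to_S3 ` K = to_S3 ` K"
      using f' by (simp add: homeomorphism_def image_image to_S3_in_S3)
    ultimately show "connected (to_S3 ` K)" by (simp add: f)
    have "(1::complex) \<in> sphere 0 1" by simp
    then have "to_S3 ` (sphere (0::complex) 1 \<times> {0}) \<noteq> {}" by blast
    then show "K \<noteq> {}" unfolding f[symmetric] by blast
  qed
  have K_Re: "Re (fst p) < k + 1" "p \<in> {p. \<bar>Re (fst p)\<bar> \<le> k \<and> \<bar>Im (fst p)\<bar> \<le> 1 \<and> snd p = 0}" if "p \<in> K" for p
    using that k(2)[of "fst p"] by (auto simp: K_def)
  have R_Re: "Re (fst p) > k + 1" if "p \<in> R" for p using R[OF that] by simp
  \<comment> \<open>The plane \<open>Re = k + 1\<close> lies between \<open>K\<close> and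
    \<open>R\<close>, so \<open>K\<close> is open and closed in \<open>X\<close>.\<close>
  have "to_S3 ` K \<in> components (to_S3 ` X)"
  proof -
    have "open {p :: space. Re (fst p) < k + 1}" by (intro open_Collect_less continuous_intros)
    then obtain S where S: "open S" "to_S3 ` {p. Re (fst p) < k + 1} = S3 \<inter> S" by (rule to_S3_open)
    have "open {p :: space. k + 1 < Re (fst p)}" by (intro open_Collect_less continuous_intros)
    then obtain T where T: "open T" "to_S3 ` {p. k + 1 < Re (fst p)} = S3 \<inter> T" by (rule to_S3_open)
    have XK: "X \<inter> {p. Re (fst p) < k + 1} = K" "X \<inter> {p. k + 1 < Re (fst p)} = R" "X - K = R"
      using K_Re(1) R_Re less_asym unfolding X_def by blast+
    have "to_S3 ` X \<inter> S = to_S3 ` X \<inter> (S3 \<inter> S)" using S3 by blast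
    also have "\<dots> = to_S3 ` K" unfolding S(2)[symmetric] image_Int[OF inj_to_S3, symmetric] XK(1) ..
    finally have KS: "to_S3 ` K = to_S3 ` X \<inter> S" ..
    have "to_S3 ` X \<inter> T = to_S3 ` X \<inter> (S3 \<inter> T)" using S3 by blast
    also have "\<dots> = to_S3 ` R" unfolding T(2)[symmetric] image_Int[OF inj_to_S3, symmetric] XK(2) ..
    also have "\<dots> = to_S3 ` X - to_S3 ` K" unfolding image_set_diff[OF inj_to_S3, symmetric] XK(3) ..
    finally have "to_S3 ` X - to_S3 ` K = to_S3 ` X \<inter> T" ..
    then show ?thesis using component_if_clopen[OF Kc(1) _ KS _ S(1) T(1)] Kc(2) by blast
  qed
  then have comp: "g ` to_S3 ` K \<in> components L"
    using component_image[OF g' _ S3] gL by metis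
  \<comment> \<open>The isotopy of the whole link serves for this component too.\<close>
  have "ambient_isotopic S3 (g ` to_S3 ` K) (to_S3 ` K)"
    unfolding ambient_isotopic_def
    by (intro exI[of _ h] conjI ballI h(1,2,3)) (simp_all add: image_image hg to_S3_in_S3)
  from ambient_isotopic_trans[OF this iso[unfolded isotopic_def]]
  have "ambient_isotopic S3 (g ` to_S3 ` K) (to_S3 ` (sphere 0 1 \<times> {0}))" .
  moreover have "sphere 0 1 \<times> {0} = {(z, 0 :: real) |z. norm (z::complex) = 1}" by auto
  ultimately have unk: "unknotted (g ` to_S3 ` K)" by (simp only: unknotted_def)
  define Q :: "space set" where "Q = cbox (Complex (- k - 1) (- 2), - 1) (Complex (k + 1) 2, 1)"
  have Q: "convex Q" "compact Q" by (simp_all add: Q_def)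
  have iQ: "interior Q = box (Complex (- k - 1) (- 2), - 1) (Complex (k + 1) 2, 1)" by (simp add: Q_def)
  have mem: "p \<in> interior Q \<longleftrightarrow> - k - 1 < Re (fst p) \<and> Re (fst p) < k + 1 \<and> - 2 < Im (fst p) \<and> Im (fst p) < 2
      \<and> - 1 < snd p \<and> snd p < 1" for p
    unfolding iQ by (cases p) (auto simp: box_def Basis_prod_def Basis_complex_def)
  have memQ: "p \<in> Q \<Longrightarrow> Re (fst p) \<le> k + 1" for p
    unfolding Q_def by (cases p) (auto simp: cbox_def Basis_prod_def Basis_complex_def)
  have KQ: "K \<subseteq> interior Q" using K_Re k(1) by (force simp: mem)
  then have "interior Q \<noteq> {}" using Kc(2) by blast
  note QC = convex_body_components[OF Q this]
  have RQ: "R \<subseteq> - Q" using memQ R_Re by fastforce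
  define S where "S = g ` to_S3 ` frontier Q"
  have gdiff: "S3 - S = g ` (S3 - to_S3 ` frontier Q)"
    unfolding S_def using gS3 inj_on_image_set_diff[OF ginj, of S3 "to_S3 ` frontier Q"] S3 by simp
  have "unlinked_in L (g ` to_S3 ` K)"
    unfolding unlinked_in_def
  proof (intro exI[of _ S] conjI)
    have "X \<inter> frontier Q = {}"
      using KQ RQ compact_imp_closed[OF Q(2)] unfolding X_def frontier_def by (simp, blast)
    then have "to_S3 ` X \<inter> to_S3 ` frontier Q = {}" by (metis image_Int[OF inj_to_S3] image_empty)
    then have "L \<inter> S = {}"
      unfolding gL[symmetric] S_def using inj_on_image_Int[OF ginj S3 S3] by (metis image_empty)
    moreover have "S \<subseteq> S3" unfolding S_def using gS3 S3 by blast
    ultimately show "S \<subseteq> S3 - L" by blast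
    have "to_S3 ` frontier Q homeomorphic S"
      unfolding S_def homeomorphic_def using homeomorphism_of_subsets[OF g' S3 subset_refl refl] by blast
    then show "S homeomorphic sphere (0::space) 1"
      using QC(3) homeomorphic_sym homeomorphic_trans by blast
    have c: "g ` to_S3 ` interior Q \<in> components (S3 - S)" "g ` insert north (to_S3 ` (- Q)) \<in> components (S3 - S)"
      unfolding gdiff by (rule component_image[OF g' QC(1)] component_image[OF g' QC(2)]; blast)+
    have KU: "g ` to_S3 ` K \<subseteq> g ` to_S3 ` interior Q" using KQ by blast
    have "L - g ` to_S3 ` K \<subseteq> g ` to_S3 ` R" unfolding gL[symmetric] X_def by blast
    then have RV: "L - g ` to_S3 ` K \<subseteq> g ` insert north (to_S3 ` (- Q))" using RQ by blast
    have "g ` to_S3 ` interior Q \<noteq> g ` insert north (to_S3 ` (- Q))"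
    proof
      assume eq: "g ` to_S3 ` interior Q = g ` insert north (to_S3 ` (- Q))"
      have "insert north (to_S3 ` (- Q)) \<subseteq> S3" using S3 north_in_S3 by blast
      then have "to_S3 ` interior Q = insert north (to_S3 ` (- Q))"
        using eq by (rule iffD1[OF inj_on_image_eq_iff[OF ginj S3]])
      then have "north \<in> to_S3 ` interior Q" by (simp only: insertI1)
      then show False using to_S3_neq_north by (metis imageE)
    qed
    then show "\<exists>U\<in>components (S3 - S). \<exists>V\<in>components (S3 - S). U \<noteq> V \<and> g ` to_S3 ` K \<subseteq> U \<and> L - g ` to_S3 ` K \<subseteq> V"
      using c KU RV by (meson bexI)
  qed
  with comp unk have "\<exists>K\<in>components L. unknotted K \<and> unlinked_in L K" by (intro bexI conjI)
  then show ?thesis by (simp only: no_unlinked_unknotted_components_def not_not)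
qed

section \<open>Mosaics with two rows\<close>

text \<open>On a maximal sequence of consecutive arcs, the nearest uncovered points are just beyond
  its two ends.\<close>

lemma profile_run:
  assumes a: "\<And>j. i \<le> j \<Longrightarrow> j < i + int n \<Longrightarrow> a j" and e: "\<not> a (i - 1)" "\<not> a (i + int n)"
    and x: "2 * of_int i \<le> x" "x \<le> 2 * of_int i + 2 * real n"
  shows "profile a x = ramp (min (x - 2 * of_int i) (2 * of_int i + 2 * real n - x))"
proof -
  have ne: "- covered a \<noteq> {}" using uncovered_nonempty e(1) by blast
  have "\<exists>y\<in>- covered a. \<bar>x - y\<bar> \<le> x - 2 * of_int i + \<epsilon>" if "0 < \<epsilon>" "\<epsilon> < 1" for \<epsilon>
    using uncovered[of a "i - 1" "2 * of_int i - \<epsilon>"] e x that by (intro bexI[of _ "2 * of_int i - \<epsilon>"]) auto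
  then have 1: "infdist x (- covered a) \<le> x - 2 * of_int i" by (rule infdist_le_approach)
  have "\<exists>y\<in>- covered a. \<bar>x - y\<bar> \<le> 2 * of_int i + 2 * real n - x + \<epsilon>" if "0 < \<epsilon>" "\<epsilon> < 1" for \<epsilon>
    using uncovered[of a "i + int n" "2 * of_int i + 2 * real n + \<epsilon>"] e x that
    by (intro bexI[of _ "2 * of_int i + 2 * real n + \<epsilon>"]) auto
  then have 2: "infdist x (- covered a) \<le> 2 * of_int i + 2 * real n - x" by (rule infdist_le_approach)
  have "infdist x (- covered a) \<ge> min (x - 2 * of_int i) (2 * of_int i + 2 * real n - x)"
  proof (rule infdist_ge[OF ne])
    fix y assume y: "y \<in> - covered a"
    have "\<not> (2 * of_int i \<le> y \<and> y < 2 * of_int i + 2 * real n)"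
    proof
      assume b: "2 * of_int i \<le> y \<and> y < 2 * of_int i + 2 * real n"
      define j where "j = \<lfloor>y / 2\<rfloor>"
      have j: "of_int j \<le> y / 2" "y / 2 < of_int j + 1" unfolding j_def by linarith+
      have "real_of_int i < of_int (j + 1)" "real_of_int j < of_int (i + int n)" using j b by simp_all
      then have "i \<le> j" "j < i + int n" unfolding of_int_less_iff by linarith+
      then have "y \<in> covered a" using a[of j] j by (force simp: covered_def)
      then show False using y by blast
    qed
    then show "min (x - 2 * of_int i) (2 * of_int i + 2 * real n - x) \<le> \<bar>x - y\<bar>" using x by linarith
  qed
  then have "infdist x (- covered a) = min (x - 2 * of_int i) (2 * of_int i + 2 * real n - x)"
    using 1 2 by linarith
  then show ?thesis by (simp add: profile_def)
qed

lemma infdist_reflect: "infdist (c - x) ((\<lambda>y. c - y) ` S) = infdist x (S :: real set)"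
proof -
  have "(\<lambda>y. dist (c - x) y) ` (\<lambda>y. c - y) ` S = (\<lambda>y. dist x y) ` S"
    by (simp add: image_image dist_real_def abs_minus_commute)
  then show ?thesis by (simp add: infdist_def)
qed

text \<open>When a row with last tile \<open>c\<close> is read from its other end, tile
  \<open>i\<close> becomes tile \<open>c - i\<close>. The arc between \<open>i\<close> and
  \<open>i + 1\<close> is then named after \<open>c - 1 - i\<close>, the first of its tiles in the
  new order.\<close>

lemma covered_reflect: "covered (\<lambda>i. a (c - 1 - i)) = (\<lambda>x. 2 * of_int c - x) ` covered a"
proof (intro equalityI subsetI)
  fix x assume "x \<in> covered (\<lambda>i. a (c - 1 - i))"
  then obtain i where "a (c - 1 - i)" "2 * of_int i \<le> x" "x \<le> 2 * of_int i + 2" by (auto simp: covered_def)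
  then have "2 * of_int c - x \<in> covered a" unfolding covered_def by (intro UN_I[of "c - 1 - i"]) auto
  then show "x \<in> (\<lambda>x. 2 * of_int c - x) ` covered a" by (intro image_eqI) auto
next
  fix x assume "x \<in> (\<lambda>x. 2 * of_int c - x) ` covered a"
  then obtain i where "a i" "2 * of_int i \<le> 2 * of_int c - x" "2 * of_int c - x \<le> 2 * of_int i + 2"
    by (auto simp: covered_def)
  then show "x \<in> covered (\<lambda>i. a (c - 1 - i))" unfolding covered_def by (intro UN_I[of "c - 1 - i"]) auto
qed

lemma profile_reflect: "profile (\<lambda>i. a (c - 1 - i)) x = profile a (2 * of_int c - x)"
proof -
  have "bij (\<lambda>x. 2 * real_of_int c - x)" by (rule o_bij[of "\<lambda>x. 2 * real_of_int c - x"]) auto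
  then have "- covered (\<lambda>i. a (c - 1 - i)) = (\<lambda>x. 2 * of_int c - x) ` (- covered a)"
    unfolding covered_reflect by (simp add: bij_image_Compl_eq)
  then show ?thesis
    using infdist_reflect[of "2 * of_int c" "2 * of_int c - x" "- covered a"] by (simp add: profile_def)
qed

text \<open>The gauge of the convex octagon that is drawn by a rectangular mosaic with two rows and \<open>k + 1\<close> columns.\<close>

definition octagon :: "real \<Rightarrow> complex \<Rightarrow> real" where
  "octagon k z = max \<bar>Im z\<bar> (max ((3 * \<bar>Re z\<bar> + \<bar>Im z\<bar>) / (3 * k)) ((\<bar>Re z\<bar> + 3 * \<bar>Im z\<bar>) / (k + 2)))"

text \<open>With \<open>d = k - \<bar>Re z\<bar>\<close>, the three terms of the maximum are at most
  1 exactly when \<open>\<bar>Im z\<bar>\<close> is at most 1, \<open>3 * d\<close> and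
  \<open>2 / 3 + d / 3\<close>, the three terms of \<open>ramp d\<close>.\<close>

lemma octagon_eq_1:
  assumes k: "k > 0"
  shows "octagon k z = 1 \<longleftrightarrow> \<bar>Re z\<bar> \<le> k \<and> \<bar>Im z\<bar> = ramp (k - \<bar>Re z\<bar>)"
proof -
  have m: "max a (max b c) = 1 \<longleftrightarrow> (a \<le> 1 \<and> b \<le> 1 \<and> c \<le> 1) \<and> (a = 1 \<or> b = 1 \<or> c = 1)" for a b c :: real
    by (auto simp: max_def)
  define r s where "r = \<bar>Re z\<bar>" and "s = \<bar>Im z\<bar>"
  have rs: "r \<ge> 0" "s \<ge> 0" by (simp_all add: r_def s_def)
  have "octagon k z = 1 \<longleftrightarrow> (s \<le> 1 \<and> 3 * r + s \<le> 3 * k \<and> r + 3 * s \<le> k + 2) \<and>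
      (s = 1 \<or> 3 * r + s = 3 * k \<or> r + 3 * s = k + 2)"
    unfolding octagon_def r_def[symmetric] s_def[symmetric] m using k by (simp add: divide_le_eq divide_eq_eq)
  also have "\<dots> \<longleftrightarrow> r \<le> k \<and> s = ramp (k - r)"
    unfolding ramp_def min_def using rs by (auto simp: diff_divide_distrib split: if_splits)
  finally show ?thesis by (simp only: r_def s_def)
qed

lemma octagon_scale:
  assumes t: "t \<ge> 0"
  shows "octagon k (of_real t * z) = t * octagon k z"
proof -
  have e: "\<bar>t * Re z\<bar> = t * \<bar>Re z\<bar>" "\<bar>t * Im z\<bar> = t * \<bar>Im z\<bar>"
    "(3 * (t * \<bar>Re z\<bar>) + t * \<bar>Im z\<bar>) / (3 * k) = t * ((3 * \<bar>Re z\<bar> + \<bar>Im z\<bar>) / (3 * k))"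
    "(t * \<bar>Re z\<bar> + 3 * (t * \<bar>Im z\<bar>)) / (k + 2) = t * ((\<bar>Re z\<bar> + 3 * \<bar>Im z\<bar>) / (k + 2))"
    using t by (simp_all add: abs_mult algebra_simps)
  have "octagon k (of_real t * z) = max \<bar>t * Im z\<bar> (max ((3 * \<bar>t * Re z\<bar> + \<bar>t * Im z\<bar>) / (3 * k))
      ((\<bar>t * Re z\<bar> + 3 * \<bar>t * Im z\<bar>) / (k + 2)))"
  proof -
    have "Re (of_real t * z) = t * Re z" "Im (of_real t * z) = t * Im z" by simp_all
    then show ?thesis by (simp only: octagon_def)
  qed
  also have "\<dots> = t * octagon k z"
    unfolding e octagon_def using t by (simp only: max_mult_distrib_left if_True)
  finally show ?thesis .
qed

lemma octagon_ge: "k > 0 \<Longrightarrow> octagon k z \<ge> 1 / (k + 2) * norm z"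
proof -
  assume k: "k > 0"
  have "1 / (k + 2) * norm z \<le> (\<bar>Re z\<bar> + 3 * \<bar>Im z\<bar>) / (k + 2)"
    using cmod_le[of z] k by (simp add: divide_right_mono)
  then show ?thesis unfolding octagon_def by (intro max.coboundedI2)
qed

lemma continuous_on_octagon: "k > 0 \<Longrightarrow> continuous_on A (octagon k)"
  unfolding octagon_def[abs_def] by (intro continuous_intros) auto

context grid_mosaic
begin

lemma inward: "w \<in> units \<Longrightarrow> has_end (cell w i 0) (- \<i> * w) \<longleftrightarrow> arc w i \<noteq> arc w (i - 1)"
  using tile_curve_outward[of w "cell w i 0", OF _ no_outward] arc_prev[of w i] has_end_T0
  unfolding arc_def by metis

lemma arc_empty:
  assumes w: "w \<in> units" and eq: "\<And>i. arc w i = arc w (i - 1)"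
  shows "\<not> arc w i"
proof (cases "i \<ge> - 1")
  case True
  then show ?thesis
  proof (induction i rule: int_ge_induct)
    case base
    then show ?case using arc_range(1)[OF w, of "- 1"] by auto
  next
    case (step i)
    then show ?case using eq[of "i + 1"] by simp
  qed
next
  case False
  then show ?thesis using arc_range(1)[OF w, of i] by auto
qed

text \<open>Without a second row no tile has an inward end, so \<open>arc\<close> is constant along
  the row, and it is false outside the grid.\<close>

lemma not_one_row:
  assumes w: "w \<in> units" and ne: "cell w i 0 \<noteq> T0"
  shows "len (\<i> * w) \<noteq> 0"
proof
  assume 0: "len (\<i> * w) = 0"
  have "\<not> has_end (cell w i 0) (- \<i> * w)" for i
    using cell_vertical[OF w, of i 0] cell_outside(4)[OF w, of i 1] 0 has_end_T0 by force
  then have "arc w i = arc w (i - 1)" for i using inward[OF w] by blast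
  then have "\<not> arc w i" for i using arc_empty[OF w] by blast
  then have "\<not> has_end (cell w i 0) w" "\<not> has_end (cell w i 0) (- w)" using arc_prev[OF w] by (auto simp: arc_def)
  then show False using tile_curve_outward(4)[OF w no_outward[OF w]] ne by blast
qed

text \<open>The inward ends of the two rows are joined to each other, so caps begin and end at the
  same columns in both; outside the grid neither row has arcs. The opposite side is traversed
  backwards, whence the reflected index.\<close>

lemma two_rows_arc:
  assumes w: "w \<in> units" and 1: "len (\<i> * w) = 1"
  shows "arc (- w) = (\<lambda>i. arc w (len w - 1 - i))"
proof -
  have mw: "- w \<in> units" using units_closed w by blast
  have l: "len (\<i> * - w) = 1" "len (- w) = len w" using w 1 by (auto simp: units_def len_def)
  define b where "b i = arc (- w) (len w - 1 - i)" for i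
  have step: "(arc w i \<noteq> arc w (i - 1)) = (b i \<noteq> b (i - 1))" for i
  proof -
    have "has_end (cell w i 1) (\<i> * w) \<longleftrightarrow> has_end (cell w i 0) (- \<i> * w)" using cell_vertical[OF w, of i 0] by simp
    moreover have "cell w i 1 = cell (- w) (len w - i) 0" by (simp add: cell_turn(3)[OF w] 1)
    moreover have "- \<i> * - w = \<i> * w" by simp
    ultimately have "(arc w i \<noteq> arc w (i - 1)) = (arc (- w) (len w - i) \<noteq> arc (- w) (len w - i - 1))"
      using inward[OF w, of i] inward[OF mw, of "len w - i"] by metis
    then show ?thesis by (auto simp: b_def algebra_simps)
  qed
  have "arc w i = b i" for i
  proof (cases "i \<ge> - 1")
    case True
    then show ?thesis
    proof (induction i rule: int_ge_induct)
      case base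
      then show ?case using arc_range(1)[OF w, of "- 1"] arc_range(2)[OF mw, of "len w"] l by (auto simp: b_def)
    next
      case (step i)
      then show ?case using \<open>\<And>i. _ = (b i \<noteq> b (i - 1))\<close>[of "i + 1"] by auto
    qed
  next
    case False
    then show ?thesis using arc_range(1)[OF w, of i] arc_range(2)[OF mw, of "len w - 1 - i"] l by (auto simp: b_def)
  qed
  then show ?thesis by (auto simp: b_def fun_eq_iff)
qed

text \<open>Seen from the middle line between the rows, which passes through
  \<open>origin w - w * \<i>\<close>, the two rows are mirror images of each other.\<close>

lemma two_rows_curve:
  assumes w: "w \<in> units" and 1: "len (\<i> * w) = 1" "len w \<ge> 0"
  shows "rect w {0..len w} {0..1} = (\<Union>s\<in>{1, - 1}. row_graph (origin w - w * \<i>) w (\<lambda>x. s * profile (arc w) x) (covered (arc w)))"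
proof -
  have mw: "- w \<in> units" using units_closed w by blast
  have lm: "len (- w) = len w" using w by simp
  have full: "covered (arc v) \<inter> {2 * of_int 0 - 1..2 * of_int (len v) + 1} = covered (arc v)" if "v \<in> units" for v
    using covered_arc_range[OF that] by force
  have r0: "rect w {0..len w} {0} = border w (covered (arc w))"
    using rect_row[OF w 1(2)] full[OF w] by simp
  have "rect w {0..len w} {1} = rect (- w) {0..len w} {0}"
    unfolding rect_turn(3)[OF w] by (simp add: 1 image_diff_atLeastAtMost)
  also have "\<dots> = border (- w) (covered (arc (- w)))"
    using rect_row[OF mw, of 0 "len w"] full[OF mw] 1(2) lm by simp
  also have "\<dots> = row_graph (origin (- w)) (- w) (\<lambda>x. profile (arc w) (2 * of_int (len w) - x) - 1)
      ((\<lambda>x. 2 * of_int (len w) - x) ` covered (arc w))"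
    by (simp only: border_def two_rows_arc[OF w 1(1)] covered_reflect profile_reflect)
  also have "\<dots> = row_graph (origin w - w * \<i>) w (\<lambda>x. - 1 * profile (arc w) x) (covered (arc w))"
    unfolding row_graph_def image_image origin_turn(3)[OF w] 1(1)
    by (intro image_cong refl) (simp add: Complex_eq algebra_simps)
  finally have r1: "rect w {0..len w} {1} = row_graph (origin w - w * \<i>) w (\<lambda>x. - 1 * profile (arc w) x) (covered (arc w))" .
  have "border w (covered (arc w)) = row_graph (origin w - w * \<i>) w (\<lambda>x. 1 * profile (arc w) x) (covered (arc w))"
    unfolding row_graph_def border_def by (intro image_cong refl) (simp add: Complex_eq algebra_simps)
  moreover have "rect w {0..len w} {0..1} = rect w {0..len w} {0} \<union> rect w {0..len w} {1}"
  proof -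
    have "{0..1} = {0} \<union> {1::int}" by auto
    then show ?thesis by (simp only: rect_Un)
  qed
  ultimately show ?thesis using r0 r1 by simp
qed

text \<open>The first maximal sequence of arcs, \<open>n\<close> in number, occurs in both rows and
  yields an octagon of half-width \<open>n\<close>. The next arc is missing, so any further part of
  the curve starts at least 2 to the right: the gap that \<open>split_unknot\<close>
  requires.\<close>

lemma two_rows_split_unknot:
  assumes w: "w \<in> units" and 1: "len (\<i> * w) = 1" and ne: "cell w i 0 \<noteq> T0"
    and L: "L \<subseteq> S3" "ambient_isotopic S3 L (to_S3 ` rect w {0..len w} {0..len (\<i> * w)})"
  shows "\<not> no_unlinked_unknotted_components L"
proof -
  have w0: "w \<noteq> 0" using w units_nonzero by blast
  have "\<exists>i. arc w i"
  proof (rule ccontr)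
    assume "\<not> ?thesis"
    then have "\<not> has_end (cell w i 0) w" "\<not> has_end (cell w i 0) (- w)"
      using arc_prev[OF w] by (auto simp: arc_def)
    then show False using tile_curve_outward(4)[OF w no_outward[OF w]] ne by blast
  qed
  moreover have fin: "finite {i. arc w i}"
    by (rule finite_subset[of _ "{0..len w}"]) (use arc_range[OF w] in force)+
  ultimately obtain l where l: "arc w l" "\<And>i. arc w i \<Longrightarrow> l \<le> i"
    using Min_in[OF fin] Min_le[OF fin] by (metis (mono_tags) Collect_empty_eq mem_Collect_eq)
  \<comment> \<open>The index is \<open>len w\<close>, where no arc can start; hence the sequence of
    arcs from \<open>l\<close> on comes to an end.\<close>
  have "\<not> arc w (l + int (nat (len w - l)))" using arc_range(2)[OF w, of "l + int (nat (len w - l))"] arc_range(2)[OF w l(1)] by auto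
  then have ex: "\<exists>n. \<not> arc w (l + int n)" by blast
  define n where "n = (LEAST n. \<not> arc w (l + int n))"
  have n: "\<not> arc w (l + int n)" using ex unfolding n_def by (rule LeastI_ex)
  have run: "arc w j" if "l \<le> j" "j < l + int n" for j
    using not_less_Least[of "nat (j - l)" "\<lambda>n. \<not> arc w (l + int n)"] that by (auto simp: n_def[symmetric])
  have n0: "n > 0" using n l(1) by (cases n) auto
  have before: "\<not> arc w (l - 1)" using l(2)[of "l - 1"] by auto
  have len0: "len w \<ge> 0" using arc_range[OF w l(1)] by simp
  define c where "c = 2 * real_of_int l + real n"
  define I where "I = {2 * real_of_int l..2 * of_int l + 2 * real n}"
  define F where "F = profile (arc w)"
  have cov: "I \<subseteq> covered (arc w)"
  proof
    fix x assume x: "x \<in> I"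
    show "x \<in> covered (arc w)"
    proof (cases "x = 2 * of_int l + 2 * real n")
      case True
      then show ?thesis using run[of "l + int n - 1"] n0 unfolding covered_def
        by (intro UN_I[of "l + int n - 1"]) auto
    next
      case False
      define j where "j = \<lfloor>x / 2\<rfloor>"
      have j: "of_int j \<le> x / 2" "x / 2 < of_int j + 1" unfolding j_def by linarith+
      have "real_of_int l < of_int (j + 1)" "real_of_int j < of_int (l + int n)"
        using j x False by (simp_all add: I_def)
      then have "l \<le> j" "j < l + int n" unfolding of_int_less_iff by linarith+
      then show ?thesis using run[of j] j by (force simp: covered_def)
    qed
  qed
  have far: "x \<ge> 2 * of_int l + 2 * real n + 2" if x: "x \<in> covered (arc w)" "x \<notin> I" for x
  proof -
    obtain j where j: "arc w j" "2 * of_int j \<le> x" "x \<le> 2 * of_int j + 2" using x(1) by (auto simp: covered_def)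
    have "l \<le> j" using l(2) j(1) by blast
    moreover have "\<not> j < l + int n"
    proof
      assume "j < l + int n"
      then have "real_of_int (j + 1) \<le> of_int (l + int n)" "real_of_int l \<le> of_int j"
        using \<open>l \<le> j\<close> by (simp_all only: of_int_le_iff)
      then show False using x(2) j by (simp add: I_def)
    qed
    moreover have "j \<noteq> l + int n" using n j(1) by blast
    ultimately have "real_of_int (l + int n + 1) \<le> of_int j" by (simp only: of_int_le_iff)
    then show ?thesis using j by simp
  qed
  \<comment> \<open>The centre of the octagon is moved to 0: it lies over the middle
    \<open>c\<close> of the sequence, on the middle line.\<close>
  define shift where "shift z = z + - (origin w + w * (of_real c - \<i>))" for z
  define X where "X = plane_map (\<lambda>z. 1 / w * z) ` plane_map shift ` rect w {0..len w} {0..1}"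
  have "isotopic (rect w {0..len w} {0..1}) X"
    unfolding X_def shift_def by (rule isotopic_trans[OF isotopic_translate isotopic_mult]) (use w0 in simp)
  then have LX: "ambient_isotopic S3 L (to_S3 ` X)"
    using L(2)[unfolded 1] ambient_isotopic_trans unfolding isotopic_def by blast
  have gr: "plane_map (\<lambda>z. 1 / w * z) ` plane_map shift ` row_graph (origin w - w * \<i>) w f S =
      (\<lambda>x. (Complex (x - c) (f x), 0)) ` S" for f S
    unfolding row_graph_def image_image plane_map_def shift_def
    by (intro image_cong refl) (use w0 in \<open>simp add: Complex_eq field_simps\<close>)
  have X_eq: "X = (\<Union>s\<in>{1, - 1}. (\<lambda>x. (Complex (x - c) (s * F x), 0)) ` covered (arc w))"
    unfolding X_def two_rows_curve[OF w 1 len0] image_UN gr F_def ..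
  define R where "R = (\<Union>s\<in>{1, - 1}. (\<lambda>x. (Complex (x - c) (s * F x), 0 :: real)) ` (covered (arc w) - I))"
  have "X = (\<Union>s\<in>{1, - 1}. (\<lambda>x. (Complex (x - c) (s * F x), 0)) ` I) \<union> R"
  proof -
    have "covered (arc w) = I \<union> (covered (arc w) - I)" using cov by blast
    then have "X = (\<Union>s\<in>{1, - 1}. (\<lambda>x. (Complex (x - c) (s * F x), 0)) ` (I \<union> (covered (arc w) - I)))"
      using X_eq by simp
    then show ?thesis unfolding R_def image_Un by blast
  qed
  also have "(\<Union>s\<in>{1, - 1}. (\<lambda>x. (Complex (x - c) (s * F x), 0 :: real)) ` I) = {z. octagon n z = 1} \<times> {0}"
  proof -
    have F: "F x = ramp (real n - \<bar>x - c\<bar>)" if "x \<in> I" for x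
    proof -
      have "min (x - 2 * of_int l) (2 * of_int l + 2 * real n - x) = real n - \<bar>x - c\<bar>"
        by (auto simp: c_def)
      then show ?thesis using profile_run[of l n "arc w" x] run before n that by (simp add: F_def I_def)
    qed
    have I: "x \<in> I \<longleftrightarrow> \<bar>x - c\<bar> \<le> real n" for x by (auto simp: I_def c_def)
    have F0: "F x \<ge> 0" for x by (simp add: F_def profile_bounds)
    show ?thesis
    proof (intro equalityI subsetI)
      fix p assume "p \<in> (\<Union>s\<in>{1, - 1}. (\<lambda>x. (Complex (x - c) (s * F x), 0 :: real)) ` I)"
      then obtain s x where "s \<in> {1, - 1}" "x \<in> I" "p = (Complex (x - c) (s * F x), 0)" by blast
      then show "p \<in> {z. octagon n z = 1} \<times> {0}" using F[of x] F0[of x] I[of x] n0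
        by (auto simp: octagon_eq_1)
    next
      fix p assume p: "p \<in> {z. octagon (real n) z = 1} \<times> {0 :: real}"
      then obtain z where z: "p = (z, 0)" "octagon n z = 1" by blast
      define x where "x = Re z + c"
      have x: "x \<in> I" "\<bar>Im z\<bar> = F x" using z(2) n0 F[of x] I[of x] by (auto simp: octagon_eq_1 x_def)
      have "p = (Complex (x - c) ((if Im z \<ge> 0 then 1 else - 1) * F x), 0)"
        using x(2) by (auto simp: z(1) complex_eq_iff x_def)
      moreover have "(if Im z \<ge> 0 then 1 else - 1 :: real) \<in> {1, - 1}" by simp
      ultimately show "p \<in> (\<Union>s\<in>{1, - 1}. (\<lambda>x. (Complex (x - c) (s * F x), 0 :: real)) ` I)"
        using x(1) by blast
    qed
  qed
  finally have X: "X = {z. octagon n z = 1} \<times> {0} \<union> R" .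
  show ?thesis
  proof (rule split_unknot[where N = "octagon n" and c = "1 / (real n + 2)" and k = "real n" and R = R])
    show "ambient_isotopic S3 L (to_S3 ` ({z. octagon n z = 1} \<times> {0} \<union> R))" using LX by (simp only: X)
    show "\<bar>Re z\<bar> \<le> real n \<and> \<bar>Im z\<bar> \<le> 1" if "octagon n z = 1" for z
      using that n0 by (simp add: octagon_eq_1) (simp add: ramp_def)
    show "Re (fst p) \<ge> real n + 2" if p: "p \<in> R" for p
    proof -
      obtain s x where "x \<in> covered (arc w)" "x \<notin> I" "p = (Complex (x - c) (s * F x), 0)"
        using p unfolding R_def by blast
      then show ?thesis using far[of x] by (simp add: c_def)
    qed
    show "octagon n z \<ge> 1 / (real n + 2) * norm z" for z by (rule octagon_ge) (use n0 in simp)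
  qed (use L(1) n0 octagon_scale continuous_on_octagon in auto)
qed

end

section \<open>From edge mosaics to corner mosaics\<close>

lemma tile_ends_iff:
  "p \<in> tile_ends edge_factor T i j \<longleftrightarrow> (\<exists>u. has_end (T i j) u \<and> p = centre i j + u)"
  by (force simp: tile_ends_def strand_ends_def edge_factor_def has_end_def)

text \<open>The definition only asks for some edge-adjacent tile with the same endpoint. Comparing
  coordinates shows that it is the tile across the side in question, with an end on its opposite
  side.\<close>

lemma edge_match:
  assumes m: "edge_mosaic m n T" "i < m" "j < n" and u: "has_end (T i j) (Complex (of_int a) (of_int b))"
  obtains k l where "k < m" "l < n" "has_end (T k l) (- Complex (of_int a) (of_int b))"
    "int k = int i + a" "int l = int j + b"
proof -
  define u where "u = Complex (of_int a) (of_int b)"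
  have "centre i j + u \<in> tile_ends edge_factor T i j" unfolding tile_ends_iff u_def using u by blast
  then obtain k l where kl: "k < m" "l < n" "edge_adjacent i j k l" "centre i j + u \<in> tile_ends edge_factor T k l"
    using m unfolding edge_mosaic_def by blast
  then obtain v where v: "has_end (T k l) v" "centre i j + u = centre k l + v"
    unfolding tile_ends_iff by blast
  obtain c d where cd: "v = Complex (of_int c) (of_int d)" "(c, d) \<in> {(1, 0), (- 1, 0), (0, 1), (0, - 1)}"
    using units_int[OF has_end_units[OF v(1)]] .
  obtain a' b' where ab': "u = Complex (of_int a') (of_int b')" "(a', b') \<in> {(1, 0), (- 1, 0), (0, 1), (0, - 1)}"
    using units_int has_end_units u unfolding u_def by metis
  have ab: "a' = a" "b' = b" using ab'(1) by (simp_all add: u_def)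
  have "real_of_int (2 * int i + a) = of_int (2 * int k + c)" "real_of_int (2 * int j + b) = of_int (2 * int l + d)"
    using v(2) by (simp_all add: centre_def cd(1) u_def complex_eq_iff)
  then have e: "2 * int i + a = 2 * int k + c" "2 * int j + b = 2 * int l + d" by (simp_all only: of_int_eq_iff)
  have adj: "int i = int k \<and> (int j = int l + 1 \<or> int l = int j + 1) \<or>
      int j = int l \<and> (int i = int k + 1 \<or> int k = int i + 1)"
    using kl(3) unfolding edge_adjacent_def by linarith
  have "c = - a \<and> d = - b \<and> int k = int i + a \<and> int l = int j + b"
    using e adj cd(2) ab'(2) unfolding ab by auto
  moreover from this have "v = - u" by (simp add: cd(1) u_def complex_eq_iff)
  ultimately show ?thesis using that[of k l] kl(1,2) v(1) by (simp add: u_def)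
qed

text \<open>Surrounded by empty tiles, the outer boundary obeys the same matching condition as the
  sides between two tiles of the grid.\<close>

definition int_grid :: "nat \<Rightarrow> nat \<Rightarrow> grid \<Rightarrow> int \<Rightarrow> int \<Rightarrow> tile" where
  "int_grid m n T i j = (if 0 \<le> i \<and> i < int m \<and> 0 \<le> j \<and> j < int n then T (nat i) (nat j) else T0)"

lemma int_grid_nat: "k < m \<Longrightarrow> l < n \<Longrightarrow> int_grid m n T (int k) (int l) = T k l"
  by (simp add: int_grid_def)

lemma int_grid_match:
  assumes m: "edge_mosaic m n T" and u: "has_end (int_grid m n T i j) (Complex (of_int a) (of_int b))"
  shows "has_end (int_grid m n T (i + a) (j + b)) (- Complex (of_int a) (of_int b))"
proof -
  have r: "0 \<le> i" "i < int m" "0 \<le> j" "j < int n"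
    using u by (auto simp: int_grid_def has_end_def split: if_splits)
  define k l where "k = nat i" and "l = nat j"
  have kl: "i = int k" "j = int l" "k < m" "l < n" using r by (auto simp: k_def l_def)
  have "has_end (T k l) (Complex (of_int a) (of_int b))" using u kl by (simp add: int_grid_nat)
  from edge_match[OF m kl(3,4) this] obtain k' l' where "k' < m" "l' < n"
    "has_end (T k' l') (- Complex (of_int a) (of_int b))" "int k' = int k + a" "int l' = int l + b" .
  then show ?thesis unfolding kl using int_grid_nat by metis
qed

lemma int_grid_adjacent:
  assumes m: "edge_mosaic m n T"
  shows "has_end (int_grid m n T i j) 1 \<longleftrightarrow> has_end (int_grid m n T (i + 1) j) (- 1)"
    and "has_end (int_grid m n T i j) \<i> \<longleftrightarrow> has_end (int_grid m n T i (j + 1)) (- \<i>)"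
proof -
  have c: "Complex (of_int 1) (of_int 0) = 1" "Complex (of_int (- 1)) (of_int 0) = - 1"
    "Complex (of_int 0) (of_int 1) = \<i>" "Complex (of_int 0) (of_int (- 1)) = - \<i>"
    by (simp_all add: complex_eq_iff)
  note M = int_grid_match[OF m]
  show "has_end (int_grid m n T i j) 1 \<longleftrightarrow> has_end (int_grid m n T (i + 1) j) (- 1)"
    using M[of i j 1 0] M[of "i + 1" j "- 1" 0] unfolding c by auto
  show "has_end (int_grid m n T i j) \<i> \<longleftrightarrow> has_end (int_grid m n T i (j + 1)) (- \<i>)"
    using M[of i j 0 1] M[of i "j + 1" 0 "- 1"] unfolding c by auto
qed

section \<open>Grids indexed by integers, and trimming\<close>

definition grid_curve :: "(int \<Rightarrow> int \<Rightarrow> tile) \<Rightarrow> space set" where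
  "grid_curve Z = (\<Union>i. \<Union>j. tile_at (2 * of_int i + 2 * of_int j * \<i>) (Z i j))"

lemma mosaic_curve_edge: "mosaic_curve edge_factor m n T = grid_curve (int_grid m n T)"
proof -
  define A where "A i j = tile_at (2 * of_int i + 2 * of_int j * \<i>) (int_grid m n T i j)" for i j
  have "mosaic_curve edge_factor m n T = (\<Union>k<m. \<Union>l<n. A (int k) (int l))"
  proof -
    have "(\<Union>s\<in>strands (T k l). strand_curve edge_factor (centre k l) s) = A (int k) (int l)" if "k < m" "l < n" for k l
    proof -
      have "(\<Union>s\<in>strands (T k l). strand_curve edge_factor (centre k l) s) =
          (\<Union>s\<in>strands (T k l). plane_map (\<lambda>z. centre k l + 1 * z) ` strand_curve 1 0 s)"
        unfolding edge_factor_def by (intro SUP_cong refl strand_curve_plane_map)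
      also have "\<dots> = tile_at (centre k l) (T k l)" by (simp add: tile_at_def tile_curve_def image_UN)
      also have "\<dots> = A (int k) (int l)"
        unfolding A_def int_grid_nat[OF that] by (simp add: centre_def Complex_eq mult.commute mult.left_commute)
      finally show ?thesis .
    qed
    then show ?thesis unfolding mosaic_curve_def by (intro SUP_cong refl) simp
  qed
  also have "\<dots> = grid_curve (int_grid m n T)"
  proof (intro equalityI subsetI)
    fix p assume "p \<in> grid_curve (int_grid m n T)"
    then obtain i j where p: "p \<in> A i j" by (auto simp: grid_curve_def A_def)
    then have "int_grid m n T i j \<noteq> T0" by (auto simp: A_def)
    then have r: "0 \<le> i" "i < int m" "0 \<le> j" "j < int n" by (auto simp: int_grid_def split: if_splits)
    then have "nat i < m" "nat j < n" by auto
    moreover have "p \<in> A (int (nat i)) (int (nat j))" using p r by simp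
    ultimately show "p \<in> (\<Union>k<m. \<Union>l<n. A (int k) (int l))" by blast
  next
    fix p assume "p \<in> (\<Union>k<m. \<Union>l<n. A (int k) (int l))"
    then show "p \<in> grid_curve (int_grid m n T)" unfolding grid_curve_def A_def by blast
  qed
  finally show ?thesis .
qed

lemma grid_curve_shift:
  "grid_curve (\<lambda>i j. G (i + a) (j + b)) = plane_map (\<lambda>z. z + - (2 * of_int a + 2 * of_int b * \<i>)) ` grid_curve G"
proof -
  define s where "s = plane_map (\<lambda>z. z + - (2 * of_int a + 2 * of_int b * \<i>))"
  have t: "s ` tile_at (2 * of_int (i + a) + 2 * of_int (j + b) * \<i>) t = tile_at (2 * of_int i + 2 * of_int j * \<i>) t" for i j t
    unfolding tile_at_def image_image s_def
    by (intro image_cong refl) (simp add: plane_map_def algebra_simps)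
  have r: "(\<Union>i. f i) = (\<Union>i. f (i + c))" for f :: "int \<Rightarrow> space set" and c
  proof -
    have "surj (\<lambda>i. i + c)" by (rule surjI[of _ "\<lambda>i. i - c"]) simp
    then have "(\<Union>i. f i) = (\<Union>i\<in>range (\<lambda>i. i + c). f i)" by (simp only:)
    then show ?thesis by (simp only: image_image)
  qed
  have "grid_curve G = (\<Union>i. \<Union>j. tile_at (2 * of_int (i + a) + 2 * of_int (j + b) * \<i>) (G (i + a) (j + b)))"
    unfolding grid_curve_def by (subst r[of _ a], subst r[of _ b]) (rule refl)
  then have "s ` grid_curve G = grid_curve (\<lambda>i j. G (i + a) (j + b))"
    by (simp only: image_UN t) (simp only: grid_curve_def)
  then show ?thesis by (simp add: s_def)
qed

lemma (in grid_mosaic) grid_curve_rect: "grid_curve Z = rect 1 {0..M} {0..N}"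
proof -
  have p: "pos 1 i d = 2 * of_int i + 2 * of_int (N - d) * \<i>" "cell 1 i d = Z i (N - d)" for i d
    by (simp_all add: pos_def cell_def origin_def len_def algebra_simps)
  show ?thesis
  proof (intro equalityI subsetI)
    fix x assume "x \<in> grid_curve Z"
    then obtain i j where x: "x \<in> tile_at (2 * of_int i + 2 * of_int j * \<i>) (Z i j)" by (auto simp: grid_curve_def)
    then have "Z i j \<noteq> T0" by auto
    from outside[OF this] have "i \<in> {0..M}" "N - j \<in> {0..N}" by auto
    moreover have "x \<in> tile_at (pos 1 i (N - j)) (cell 1 i (N - j))" using x by (simp add: p)
    ultimately show "x \<in> rect 1 {0..M} {0..N}" unfolding rect_def by blast
  next
    fix x assume "x \<in> rect 1 {0..M} {0..N}"
    then show "x \<in> grid_curve Z" unfolding rect_def grid_curve_def p by blast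
  qed
qed

lemma trim_grid:
  fixes G :: "int \<Rightarrow> int \<Rightarrow> tile"
  assumes fin: "finite {(i, j). G i j \<noteq> T0}" and ne: "{(i, j). G i j \<noteq> T0} \<noteq> {}"
    and adj: "\<And>i j. has_end (G i j) 1 \<longleftrightarrow> has_end (G (i + 1) j) (- 1)"
      "\<And>i j. has_end (G i j) \<i> \<longleftrightarrow> has_end (G i (j + 1)) (- \<i>)"
  obtains a b M N where "grid_mosaic (\<lambda>i j. G (i + a) (j + b)) M N"
    "\<And>w. w \<in> units \<Longrightarrow> \<exists>i. grid_mosaic.cell (\<lambda>i j. G (i + a) (j + b)) M N w i 0 \<noteq> T0"
proof -
  define X where "X = fst ` {(i, j). G i j \<noteq> T0}"
  define Y where "Y = snd ` {(i, j). G i j \<noteq> T0}"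
  have XY: "finite X" "X \<noteq> {}" "finite Y" "Y \<noteq> {}" using fin ne by (simp_all add: X_def Y_def)
  have X: "x \<in> X \<longleftrightarrow> (\<exists>j. G x j \<noteq> T0)" and Y: "x \<in> Y \<longleftrightarrow> (\<exists>i. G i x \<noteq> T0)" for x
    by (force simp: X_def Y_def)+
  define a b M N where "a = Min X" and "b = Min Y" and "M = Max X - Min X" and "N = Max Y - Min Y"
  define Z where "Z i j = G (i + a) (j + b)" for i j
  interpret grid_mosaic Z M N
  proof
    fix i j
    show "0 \<le> i \<and> i \<le> M \<and> 0 \<le> j \<and> j \<le> N" if "Z i j \<noteq> T0"
    proof -
      have ij: "i + a \<in> X" "j + b \<in> Y" using that unfolding X Y Z_def by blast+
      then show ?thesis
        using Min_le[OF XY(1) ij(1)] Max_ge[OF XY(1) ij(1)] Min_le[OF XY(3) ij(2)] Max_ge[OF XY(3) ij(2)]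
        by (simp add: M_def N_def a_def b_def)
    qed
    show "has_end (Z i j) 1 \<longleftrightarrow> has_end (Z (i + 1) j) (- 1)"
      using adj(1)[of "i + a" "j + b"] by (simp add: Z_def add.commute add.left_commute)
    show "has_end (Z i j) \<i> \<longleftrightarrow> has_end (Z i (j + 1)) (- \<i>)"
      using adj(2)[of "i + a" "j + b"] by (simp add: Z_def add.commute add.left_commute)
  qed
  have e: "\<exists>j. Z 0 j \<noteq> T0" "\<exists>j. Z M j \<noteq> T0" "\<exists>i. Z i 0 \<noteq> T0" "\<exists>i. Z i N \<noteq> T0"
  proof -
    have "\<exists>j. G a j \<noteq> T0" "\<exists>j. G (M + a) j \<noteq> T0" "\<exists>i. G i b \<noteq> T0" "\<exists>i. G i (N + b) \<noteq> T0"
      using Min_in[OF XY(1,2)] Max_in[OF XY(1,2)] Min_in[OF XY(3,4)] Max_in[OF XY(3,4)]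
      unfolding X[symmetric] Y[symmetric] by (simp_all add: a_def b_def M_def N_def)
    then show "\<exists>j. Z 0 j \<noteq> T0" "\<exists>j. Z M j \<noteq> T0" "\<exists>i. Z i 0 \<noteq> T0" "\<exists>i. Z i N \<noteq> T0"
      unfolding Z_def by (metis add.commute add_0 diff_add_cancel)+
  qed
  show ?thesis
  proof (rule that)
    show "grid_mosaic (\<lambda>i j. G (i + a) (j + b)) M N" using grid_mosaic_axioms by (simp add: Z_def[abs_def])
    fix w assume w: "w \<in> units"
    have "\<exists>i. cell w i 0 \<noteq> T0"
    proof -
      consider "w = 1" | "w = - 1" | "w = \<i>" | "w = - \<i>" using w by (auto simp: units_def)
      then show ?thesis
      proof cases
        case 1 then show ?thesis using e(4) by (auto simp: cell_def)
      next
        case 2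
        obtain i where "Z (M - (M - i)) 0 \<noteq> T0" using e(3) by auto
        then show ?thesis unfolding 2 cell_def by (intro exI[of _ "M - i"]) simp
      next
        case 3 then show ?thesis using e(1) by (auto simp: cell_def)
      next
        case 4
        obtain j where "Z M (N - (N - j)) \<noteq> T0" using e(2) by auto
        then show ?thesis unfolding 4 cell_def by (intro exI[of _ "N - j"]) simp
      qed
    qed
    then show "\<exists>i. grid_mosaic.cell (\<lambda>i j. G (i + a) (j + b)) M N w i 0 \<noteq> T0"
      by (simp add: Z_def[abs_def])
  qed
qed

lemma (in grid_mosaic) wide_if_not_split_unknot:
  assumes ne: "\<And>w. w \<in> units \<Longrightarrow> \<exists>i. cell w i 0 \<noteq> T0"
    and L: "L \<subseteq> S3" "ambient_isotopic S3 L (to_S3 ` grid_curve Z)" "no_unlinked_unknotted_components L"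
  shows "wide_mosaic Z M N"
proof -
  have u: "1 \<in> units" "\<i> \<in> units" by (auto simp: units_def)
  obtain i where i: "cell 1 i 0 \<noteq> T0" using ne[OF u(1)] by blast
  obtain j where j: "cell \<i> j 0 \<noteq> T0" using ne[OF u(2)] by blast
  have l: "len (\<i> * 1) = N" "len (\<i> * \<i>) = M" "len 1 = M" "len \<i> = N" by (simp_all add: len_def)
  have "N \<noteq> 0" "M \<noteq> 0" using not_one_row[OF u(1) i] not_one_row[OF u(2) j] by (simp_all only: l not_False_eq_True)
  moreover have "N \<ge> 0" "M \<ge> 0" using cell_outside[OF u(1) i] by (auto simp: l)
  moreover have "N \<noteq> 1"
  proof
    assume N: "N = 1"
    have amb: "ambient_isotopic S3 L (to_S3 ` rect 1 {0..len 1} {0..len (\<i> * 1)})"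
      using L(2) unfolding grid_curve_rect l .
    have "len (\<i> * 1) = 1" using l(1) N by (rule trans)
    from two_rows_split_unknot[OF u(1) this i L(1) amb] L(3) show False by blast
  qed
  moreover have "M \<noteq> 1"
  proof
    assume M: "M = 1"
    \<comment> \<open>Seen from the left side, the two columns are two rows.\<close>
    have "rect \<i> {0..N} {0..M} = rect 1 {0..M} {0..N}"
      using rect_turn(1)[OF u(1), of "{0..N}" "{0..M}"] by (simp add: l image_diff_atLeastAtMost)
    then have amb: "ambient_isotopic S3 L (to_S3 ` rect \<i> {0..len \<i>} {0..len (\<i> * \<i>)})"
      using L(2) unfolding grid_curve_rect l by simp
    have "len (\<i> * \<i>) = 1" using l(2) M by (rule trans)
    from two_rows_split_unknot[OF u(2) this j L(1) amb] L(3) show False by blast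
  qed
  ultimately show ?thesis by unfold_locales auto
qed

lemma corner_mosaic_of_edge_mosaic:
  assumes m: "edge_mosaic m n T" "mosaic_represents edge_factor m n T L"
    and L: "L \<subseteq> S3" "L \<noteq> {}" "no_unlinked_unknotted_components L"
  obtains m' n' T' where "corner_mosaic m' n' T'" "mosaic_represents corner_factor m' n' T' L"
    "nonempty_tiles m' n' T' + 4 \<le> nonempty_tiles m n T"
proof -
  define G where "G = int_grid m n T"
  have LG: "ambient_isotopic S3 L (to_S3 ` grid_curve G)"
    using m(2) by (simp add: mosaic_represents_def mosaic_curve_edge G_def)
  have sub: "{(i, j). G i j \<noteq> T0} \<subseteq> (\<lambda>(k, l). (int k, int l)) ` {(k, l). k < m \<and> l < n \<and> T k l \<noteq> T0}"
  proof safe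
    fix i j assume ij: "G i j \<noteq> T0"
    then have "0 \<le> i" "i < int m" "0 \<le> j" "j < int n" "T (nat i) (nat j) \<noteq> T0"
      by (auto simp: G_def int_grid_def split: if_splits)
    then show "(i, j) \<in> (\<lambda>(k, l). (int k, int l)) ` {(k, l). k < m \<and> l < n \<and> T k l \<noteq> T0}"
      by (intro image_eqI[of _ _ "(nat i, nat j)"]) auto
  qed
  have finT: "finite {(k, l). k < m \<and> l < n \<and> T k l \<noteq> T0}"
    by (rule finite_subset[of _ "{..<m} \<times> {..<n}"]) auto
  have fin: "finite {(i, j). G i j \<noteq> T0}" by (rule finite_subset[OF sub]) (use finT in simp)
  have card_G: "card {(i, j). G i j \<noteq> T0} \<le> nonempty_tiles m n T"
    unfolding nonempty_tiles_def
    by (rule order_trans[OF card_mono[OF finite_imageI[OF finT] sub] card_image_le[OF finT]])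
  \<comment> \<open>Trimming needs a nonempty tile, and there is one because a link is
    nonempty.\<close>
  have "{(i, j). G i j \<noteq> T0} \<noteq> {}"
  proof
    assume "{(i, j). G i j \<noteq> T0} = {}"
    then have "G i j = T0" for i j by blast
    then have "grid_curve G = {}" by (simp add: grid_curve_def)
    then show False using LG L(2) unfolding ambient_isotopic_def by simp
  qed
  from trim_grid[OF fin this] int_grid_adjacent[OF m(1)]
  obtain a b M N where g: "grid_mosaic (\<lambda>i j. G (i + a) (j + b)) M N"
    and ne: "\<And>w. w \<in> units \<Longrightarrow> \<exists>i. grid_mosaic.cell (\<lambda>i j. G (i + a) (j + b)) M N w i 0 \<noteq> T0"
    unfolding G_def by metis
  define Z where "Z = (\<lambda>i j. G (i + a) (j + b))"
  interpret grid_mosaic Z M N using g by (simp add: Z_def)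
  have neZ: "\<exists>i. cell w i 0 \<noteq> T0" if "w \<in> units" for w using ne[OF that] by (simp add: Z_def)
  have "isotopic (grid_curve G) (grid_curve Z)"
    unfolding Z_def grid_curve_shift by (rule isotopic_translate)
  then have LZ: "ambient_isotopic S3 L (to_S3 ` grid_curve Z)"
    using LG ambient_isotopic_trans unfolding isotopic_def by blast
  interpret wide_mosaic Z M N by (rule wide_if_not_split_unknot[OF neZ L(1) LZ L(3)])
  have "card {(i, j). Z i j \<noteq> T0} \<le> card {(i, j). G i j \<noteq> T0}"
    by (rule card_inj_on_le[of "\<lambda>(i, j). (i + a, j + b)"]) (auto simp: inj_on_def Z_def fin)
  then have "nonempty_tiles corner_size corner_size corner_grid + 4 \<le> nonempty_tiles m n T"
    using nonempty_corner_grid[OF neZ] card_G by linarith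
  moreover have "mosaic_represents corner_factor corner_size corner_size corner_grid L"
    unfolding mosaic_represents_def
    by (rule ambient_isotopic_trans[OF LZ]) (use isotopic_corner_grid in \<open>simp only: isotopic_def grid_curve_rect\<close>)
  ultimately show ?thesis using corner_mosaic_corner_grid that by blast
qed

theorem corollary1p1:
  fixes L :: "(space \<times> real) set"
  assumes "tame_link L"
    and "no_unlinked_unknotted_components L"
  shows "corner_tile_number L + 4 \<le> edge_tile_number L"
  unfolding edge_tile_number_def
proof (rule Inf_greatest)
  fix x assume "x \<in> {enat (nonempty_tiles m n T) |m n T.
            edge_mosaic m n T \<and> mosaic_represents edge_factor m n T L}"
  then obtain m n T where x: "x = enat (nonempty_tiles m n T)"
    and m: "edge_mosaic m n T" "mosaic_represents edge_factor m n T L" by blast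
  have L: "L \<subseteq> S3" "L \<noteq> {}" using assms(1) by (simp_all add: tame_link_def is_link_def)
  obtain m' n' T' where c: "corner_mosaic m' n' T'" "mosaic_represents corner_factor m' n' T' L"
    "nonempty_tiles m' n' T' + 4 \<le> nonempty_tiles m n T"
    using corner_mosaic_of_edge_mosaic[OF m L assms(2)] .
  have "corner_tile_number L \<le> enat (nonempty_tiles m' n' T')"
    unfolding corner_tile_number_def by (rule Inf_lower) (use c in blast)
  then have "corner_tile_number L + 4 \<le> enat (nonempty_tiles m' n' T') + 4" by (rule add_right_mono)
  also have "\<dots> = enat (nonempty_tiles m' n' T' + 4)" by (simp add: numeral_eq_enat)
  also have "\<dots> \<le> x" using c(3) by (simp add: x)
  finally show "corner_tile_number L + 4 \<le> x" .
qed

end
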